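(* With respect to the first-order language $\mathsf{TOTO}$ the following holds. (1) If $q>0$, $q\neq 1$ is fixed and $\Pi_n\sim\mathrm{Mallows}(n,q)$, then the convergence law holds, i.e. for every $\mathsf{TOTO}$ sentence $\varphi$ the limit $\lim_{n\to\infty}\mathbb{P}(\Pi_n\models\varphi)$ exists; but the zero--one law fails, i.e. there is a $\mathsf{TOTO}$ sentence $\varphi$ for which this limit is not in $\{0,1\}$. (2) If $q=q(n)>0$ is a sequence satisfying $1-\frac{1}{\log^* n}<q(n)<1+\frac{1}{\log^* n}$ and $\Pi_n\sim\mathrm{Mallows}(n,q(n))$, then the convergence law fails: there is a $\mathsf{TOTO}$ sentence $\varphi$ such that $\mathbb{P}(\Pi_n\models\varphi)$ does not converge as $n\to\infty$.
   Context: $S_n$ is the set of permutations of $[n]=\{1,\dots,n\}$. For $\pi\in S_n$, $\mathrm{inv}(\pi)=|\{(i,j): i<j,\ \pi(i)>\pi(j)\}|$. For $q>0$, $\Pi_n\sim\mathrm{Mallows}(n,q)$ means $\mathbb{P}(\Pi_n=\pi)=q^{\mathrm{inv}(\pi)}/\sum_{\sigma\in S_n}q^{\mathrm{inv}(\sigma)}$ for all $\pi\in S_n$. $\mathsf{TOTO}$ (Theory of Two Orders) is the first-order language (with equality) having two binary relation symbols $<_1,<_2$. A permutation $\pi\in S_n$ is regarded as the structure with domain $[n]$ in which $i<_1 j$ iff $i<j$, and $i<_2 j$ iff $\pi(i)<\pi(j)$; $\pi\models\varphi$ means that this structure satisfies the sentence $\varphi$. The tower function is $T(0)=1$, $T(i)=2^{T(i-1)}$,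 and $\log^* n=\min\{k\in\mathbb{Z}_{\geq 0}: T(k)\geq n\}$. *)

theory Defs
  imports "HOL-Combinatorics.Permutations" "HOL-Probability.Probability_Mass_Function"
begin

section \<open>The Mallows distribution\<close>

definition inv_count :: "nat \<Rightarrow> (nat \<Rightarrow> nat) \<Rightarrow> nat" where
  "inv_count n \<pi> = card {(i, j). i \<in> {1..n} \<and> j \<in> {1..n} \<and> i < j \<and> \<pi> i > \<pi> j}"

definition mallows :: "nat \<Rightarrow> real \<Rightarrow> (nat \<Rightarrow> nat) pmf" where
  "mallows n q = embed_pmf (\<lambda>\<pi>. if \<pi> permutes {1..n}
     then q ^ inv_count n \<pi> / (\<Sum>\<sigma> | \<sigma> permutes {1..n}. q ^ inv_count n \<sigma>) else 0)"

lemma mallows_normaliser_pos: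
  fixes q :: real
  assumes "q > 0"
  shows "(\<Sum>\<sigma> | \<sigma> permutes {1..n}. q ^ inv_count n \<sigma>) > 0"
proof (rule sum_pos)
  show "finite {\<sigma>. \<sigma> permutes {1..n}}"
    by (simp add: finite_permutations)
  show "{\<sigma>. \<sigma> permutes {1..n}} \<noteq> {}"
    using permutes_id by blast
qed (use assms in simp)

text \<open>The function passed to \<^const>\<open>embed_pmf\<close> is a probability mass function
  whenever \<open>q > 0\<close>; only such \<open>q\<close> are meaningful.\<close>

lemma pmf_mallows:
  assumes "q > 0"
  shows "pmf (mallows n q) \<pi> = (if \<pi> permutes {1..n}
     then q ^ inv_count n \<pi> / (\<Sum>\<sigma> | \<sigma> permutes {1..n}. q ^ inv_count n \<sigma>) else 0)"
proof -
  define Z where "Z = (\<Sum>\<sigma> | \<sigma> permutes {1..n}. q ^ inv_count n \<sigma>)"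
  define f where "f = (\<lambda>\<pi>. if \<pi> permutes {1..n} then q ^ inv_count n \<pi> / Z else 0)"
  have Z: "Z > 0"
    unfolding Z_def using assms by (rule mallows_normaliser_pos)
  have nonneg: "f \<rho> \<ge> 0" for \<rho>
    using Z assms by (simp add: f_def)
  have fin: "finite {\<sigma>. \<sigma> permutes {1..n}}"
    by (simp add: finite_permutations)
  have "(\<integral>\<^sup>+\<rho>. ennreal (f \<rho>) \<partial>count_space UNIV) =
        (\<Sum>\<rho> | \<rho> permutes {1..n}. ennreal (f \<rho>))"
    by (rule nn_integral_count_space'[OF fin]) (auto simp: f_def)
  also have "\<dots> = ennreal (\<Sum>\<rho> | \<rho> permutes {1..n}. f \<rho>)"
    by (rule sum_ennreal) (rule nonneg)
  also have "(\<Sum>\<rho> | \<rho> permutes {1..n}. f \<rho>) = Z / Z"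
    unfolding Z_def sum_divide_distrib by (intro sum.cong) (auto simp: f_def Z_def)
  also have "Z / Z = 1"
    using Z by simp
  finally have "(\<integral>\<^sup>+\<rho>. ennreal (f \<rho>) \<partial>count_space UNIV) = 1"
    by simp
  hence "pmf (embed_pmf f) \<pi> = f \<pi>"
    by (intro pmf_embed_pmf nonneg)
  thus ?thesis
    unfolding mallows_def f_def Z_def .
qed


section \<open>The Theory of Two Orders\<close>

text \<open>Variables are named by natural numbers; the remaining connectives and the
  universal quantifier are definable from those below.\<close>

datatype toto =
    Eq nat nat
  | Less1 nat nat
  | Less2 nat nat
  | Neg toto
  | Conj toto toto
  | Exists nat toto

primrec free_vars :: "toto \<Rightarrow> nat set" where
  "free_vars (Eq x y) = {x, y}"
| "free_vars (Less1 x y) = {x, y}"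
| "free_vars (Less2 x y) = {x, y}"
| "free_vars (Neg \<phi>) = free_vars \<phi>"
| "free_vars (Conj \<phi> \<psi>) = free_vars \<phi> \<union> free_vars \<psi>"
| "free_vars (Exists x \<phi>) = free_vars \<phi> - {x}"

definition sentence :: "toto \<Rightarrow> bool" where
  "sentence \<phi> \<longleftrightarrow> free_vars \<phi> = {}"

primrec sat :: "'a set \<Rightarrow> ('a \<Rightarrow> 'a \<Rightarrow> bool) \<Rightarrow> ('a \<Rightarrow> 'a \<Rightarrow> bool) \<Rightarrow> (nat \<Rightarrow> 'a) \<Rightarrow> toto \<Rightarrow> bool" where
  "sat D R1 R2 e (Eq x y) \<longleftrightarrow> e x = e y"
| "sat D R1 R2 e (Less1 x y) \<longleftrightarrow> R1 (e x) (e y)"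
| "sat D R1 R2 e (Less2 x y) \<longleftrightarrow> R2 (e x) (e y)"
| "sat D R1 R2 e (Neg \<phi>) \<longleftrightarrow> \<not> sat D R1 R2 e \<phi>"
| "sat D R1 R2 e (Conj \<phi> \<psi>) \<longleftrightarrow> sat D R1 R2 e \<phi> \<and> sat D R1 R2 e \<psi>"
| "sat D R1 R2 e (Exists x \<phi>) \<longleftrightarrow> (\<exists>a\<in>D. sat D R1 R2 (e(x := a)) \<phi>)"

text \<open>The assignment \<open>e\<close> is irrelevant for sentences, see \<open>perm_models_iff\<close> below.
  It is not required to take values in \<open>{1..n}\<close>, so that the definition
  is also right for the empty structure (\<open>n = 0\<close>).\<close>

definition perm_models :: "nat \<Rightarrow> (nat \<Rightarrow> nat) \<Rightarrow> toto \<Rightarrow> bool" where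
  "perm_models n \<pi> \<phi> \<longleftrightarrow> (\<forall>e. sat {1..n} (\<lambda>i j. i < j) (\<lambda>i j. \<pi> i < \<pi> j) e \<phi>)"

lemma sat_cong:
  assumes "\<And>x. x \<in> free_vars \<phi> \<Longrightarrow> e x = e' x"
  shows "sat D R1 R2 e \<phi> \<longleftrightarrow> sat D R1 R2 e' \<phi>"
  using assms
proof (induction \<phi> arbitrary: e e')
  case (Neg \<phi>)
  have "sat D R1 R2 e \<phi> \<longleftrightarrow> sat D R1 R2 e' \<phi>"
    by (rule Neg.IH) (simp add: Neg.prems)
  thus ?case
    by simp
next
  case (Conj \<phi> \<psi>)
  have "sat D R1 R2 e \<phi> \<longleftrightarrow> sat D R1 R2 e' \<phi>"
    by (rule Conj.IH(1)) (simp add: Conj.prems)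
  moreover have "sat D R1 R2 e \<psi> \<longleftrightarrow> sat D R1 R2 e' \<psi>"
    by (rule Conj.IH(2)) (simp add: Conj.prems)
  ultimately show ?case
    by simp
next
  case (Exists x \<phi>)
  have "sat D R1 R2 (e(x := a)) \<phi> \<longleftrightarrow> sat D R1 R2 (e'(x := a)) \<phi>" for a
    by (rule Exists.IH) (simp add: Exists.prems)
  thus ?case
    by simp
qed simp_all

lemma perm_models_iff:
  assumes "sentence \<phi>"
  shows "perm_models n \<pi> \<phi> \<longleftrightarrow> sat {1..n} (\<lambda>i j. i < j) (\<lambda>i j. \<pi> i < \<pi> j) e \<phi>"
proof -
  have "sat {1..n} (\<lambda>i j. i < j) (\<lambda>i j. \<pi> i < \<pi> j) e' \<phi> \<longleftrightarrow>
        sat {1..n} (\<lambda>i j. i < j) (\<lambda>i j. \<pi> i < \<pi> j) e \<phi>" for e'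
    by (rule sat_cong) (use assms in \<open>simp add: sentence_def\<close>)
  thus ?thesis
    unfolding perm_models_def by blast
qed

definition mallows_prob :: "nat \<Rightarrow> real \<Rightarrow> toto \<Rightarrow> real" where
  "mallows_prob n q \<phi> = measure_pmf.prob (mallows n q) {\<pi>. perm_models n \<pi> \<phi>}"


section \<open>The iterated logarithm\<close>

primrec tower :: "nat \<Rightarrow> nat" where
  "tower 0 = 1"
| "tower (Suc i) = 2 ^ tower i"

definition log_star :: "nat \<Rightarrow> nat" where
  "log_star n = (LEAST k. tower k \<ge> n)"

lemma le_tower: "n \<le> tower n"
proof (induction n)
  case (Suc n)
  have "n < 2 ^ n" by simp
  also have "(2::nat) ^ n \<le> 2 ^ tower n"
    using Suc by simp
  finally show ?case by simp
qed simp

lemma tower_log_star: "n \<le> tower (log_star n)"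
  unfolding log_star_def by (rule LeastI[of "\<lambda>k. n \<le> tower k"]) (rule le_tower)

text \<open>The value \<open>log_star 1 = 0\<close> makes \<open>1 / log_star n\<close> meaningless for \<open>n \<le> 1\<close>.\<close>

lemma log_star_pos: "n \<ge> 2 \<Longrightarrow> log_star n > 0"
  using tower_log_star[of n] by (cases "log_star n") auto

end

theory Submission
  imports Defs "HOL-Library.FuncSet" "HOL-Library.Nat_Bijection" "HOL-Real_Asymp.Real_Asymp"
begin

text \<open>
  For fixed \<open>q < 1\<close> (the case \<open>q > 1\<close> follows by reversing the second order), the \<open>k\<close>-types of
  permutations under direct sums form a finite aperiodic monoid, so there is a permutation \<open>\<kappa>\<close> such
  that \<open>\<kappa> \<oplus> \<beta> \<oplus> \<kappa>\<close> always has the same type as \<open>\<kappa>\<close>. With high probability \<open>\<Pi>\<^sub>n\<close> has \<open>\<kappa>\<close> as a block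
  both near its beginning and near its end; its type is then determined by the part up to the first
  and the part from the last occurrence, and by renewal theory these are asymptotically
  independent with limit laws.

  For \<open>q\<close> near \<open>1\<close> the pattern of the first few positions is almost uniform. The values at the positions
  \<open>1, \<dots>, r\<close> cut the range into gaps, hence an interval of positions spells a word over
  \<open>{1, \<dots>, r}\<close> and so codes a binary relation on \<open>{1, \<dots>, r}\<close>. A sentence can check that such
  relations are the graphs of doubling, exponentiation, the tower function and two further iterates.
  Such codes exist, with high probability, for all \<open>r\<close> up to a number that is so close to \<open>n\<close> on the scale
  of the last iterate \<open>F\<close> that, for suitable \<open>n\<close>, the largest \<open>j\<close> with \<open>F j \<le> r\<close> does not
  depend on the choice of a maximal such \<open>r\<close>. The parity of \<open>j\<close> then oscillates with \<open>n\<close>.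
\<close>

section \<open>Weights of permutations\<close>

text \<open>Divergence only has to be seen along sparse \<open>n\<close>. For
  \<open>n = T(T(v))\<close> with \<open>v = hyp 5 j\<close> one has
  \<open>log_star n = T(v)\<close>, and rearranging the first \<open>N\<close> positions, which
  changes the inversion number by at most \<open>N\<^sup>2\<close>, alters weights by a factor of at
  most 3 as long as \<open>2 * N\<^sup>2 \<le> T(v)\<close>. Averaging over such rearrangements
  replaces any comparison with the uniform law on all positions. The window is tiny, so a number
  \<open>r\<close> at which coding stops is only known to lie between \<open>v\<close> and
  \<open>n\<close>. The step of the function that measures levels must therefore outgrow two
  applications of \<open>T\<close>; \<open>hyp 4\<close>, the iterate of the tower function, does
  so, and this is why the hierarchy is climbed up to \<open>hyp 5\<close>.

  For fixed \<open>q\<close> the factor \<open>(1 - q) ^ n\<close> makes weights multiplicative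
  under direct sums while the totals stay away from 0, so occurrences of a block form a renewal
  process. Aperiodicity is essential: a nontrivial group among the types could make truth depend on
  a length modulo a period. It holds because a sentence of depth \<open>k\<close> cannot count
  copies of a summand beyond \<open>2 ^ k\<close>.\<close>

definition perms :: "nat \<Rightarrow> (nat \<Rightarrow> nat) set" where
  "perms n = {\<pi>. \<pi> permutes {1..n}}"

definition mweight :: "real \<Rightarrow> nat \<Rightarrow> ((nat \<Rightarrow> nat) \<Rightarrow> bool) \<Rightarrow> real" where
  "mweight q n P = (\<Sum>\<pi> | \<pi> \<in> perms n \<and> P \<pi>. q ^ inv_count n \<pi>)"

lemma finite_perms [simp]: "finite (perms n)"
  unfolding perms_def by (simp add: finite_permutations)

lemma finite_perms_Collect [simp]: "finite {\<pi>. \<pi> \<in> perms n \<and> P \<pi>}"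
  by (rule finite_subset[OF _ finite_perms[of n]]) auto

lemma mweight_total: "mweight q n (\<lambda>_. True) = (\<Sum>\<sigma> | \<sigma> permutes {1..n}. q ^ inv_count n \<sigma>)"
  by (simp add: mweight_def perms_def)

lemma mweight_total_pos: "q > 0 \<Longrightarrow> mweight q n (\<lambda>_. True) > 0"
  unfolding mweight_total by (rule mallows_normaliser_pos)

lemma mweight_nonneg: "q > 0 \<Longrightarrow> mweight q n P \<ge> 0"
  unfolding mweight_def by (intro sum_nonneg) simp

lemma mweight_mono:
  assumes "q > 0" "\<And>\<pi>. \<pi> \<in> perms n \<Longrightarrow> P \<pi> \<Longrightarrow> Q \<pi>"
  shows "mweight q n P \<le> mweight q n Q"
  unfolding mweight_def using assms by (intro sum_mono2) auto

lemma mweight_cong: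
  assumes "\<And>\<pi>. \<pi> \<in> perms n \<Longrightarrow> P \<pi> \<longleftrightarrow> Q \<pi>"
  shows "mweight q n P = mweight q n Q"
  unfolding mweight_def using assms by (intro sum.cong) auto

lemma mweight_alt: "mweight q n P = (\<Sum>\<pi>\<in>perms n. if P \<pi> then q ^ inv_count n \<pi> else 0)"
  unfolding mweight_def by (rule sum.mono_neutral_cong_left) auto

lemma mweight_disj:
  assumes "\<And>\<pi>. \<pi> \<in> perms n \<Longrightarrow> \<not> (P \<pi> \<and> Q \<pi>)"
  shows "mweight q n (\<lambda>\<pi>. P \<pi> \<or> Q \<pi>) = mweight q n P + mweight q n Q"
  unfolding mweight_alt sum.distrib[symmetric] using assms by (intro sum.cong) auto

lemma mallows_prob_eq:
  assumes "q > 0"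
  shows "mallows_prob n q \<phi> =
           mweight q n (\<lambda>\<pi>. perm_models n \<pi> \<phi>) / mweight q n (\<lambda>_. True)"
proof -
  let ?S = "{\<pi>. \<pi> \<in> perms n \<and> perm_models n \<pi> \<phi>}"
  have "mallows_prob n q \<phi> = measure_pmf.prob (mallows n q) ?S"
    unfolding mallows_prob_def using assms
    by (intro measure_prob_cong_0) (auto simp: pmf_mallows perms_def)
  also have "\<dots> = (\<Sum>\<pi>\<in>?S. pmf (mallows n q) \<pi>)"
    by (rule measure_measure_pmf_finite) simp
  also have "\<dots> = (\<Sum>\<pi>\<in>?S. q ^ inv_count n \<pi> / mweight q n (\<lambda>_. True))"
    using assms by (intro sum.cong) (auto simp: pmf_mallows perms_def mweight_total)
  finally show ?thesis
    by (simp add: mweight_def sum_divide_distrib)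
qed

subsection \<open>Rearranging the first positions\<close>

text \<open>If a pair inverted by \<open>\<pi> \<circ> \<rho>\<close> has its later position
  \<open>j\<close> beyond \<open>N\<close>, then \<open>\<rho>\<close> fixes \<open>j\<close> and
  keeps the other position before it, so \<open>(\<rho> i, j)\<close> is an inversion of
  \<open>\<pi>\<close>. All other pairs lie in the square
  \<open>{1..N} \<times> {1..N}\<close>.\<close>

lemma inv_count_comp_le:
  assumes "\<pi> permutes {1..n}" "\<rho> permutes {1..N}" "N \<le> n"
  shows "inv_count n (\<pi> \<circ> \<rho>) \<le> inv_count n \<pi> + N\<^sup>2"
proof -
  define I where "I \<pi> = {(i, j). i \<in> {1..n} \<and> j \<in> {1..n} \<and> i < j \<and> \<pi> i > \<pi> j}" for \<pi> :: "nat \<Rightarrow> nat"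
  have fin: "finite (I \<pi>)" for \<pi>
    by (rule finite_subset[of _ "{1..n} \<times> {1..n}"]) (auto simp: I_def)
  have in\<rho>: "\<rho> i \<in> {1..N}" if "i \<in> {1..N}" for i
    using permutes_in_image[OF assms(2), of i] that by simp
  have out\<rho>: "\<rho> i = i" if "i > N" for i
    using permutes_not_in[OF assms(2), of i] that by simp
  define H where "H = I (\<pi> \<circ> \<rho>) - {1..N} \<times> {1..N}"
  have "card H \<le> card (I \<pi>)"
  proof (rule card_inj_on_le[where f = "\<lambda>(i, j). (\<rho> i, j)"])
    show "inj_on (\<lambda>(i, j). (\<rho> i, j)) H"
      using permutes_inj[OF assms(2)] by (auto simp: inj_on_def dest: injD)
    show "(\<lambda>(i, j). (\<rho> i, j)) ` H \<subseteq> I \<pi>"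
    proof clarify
      fix i j assume "(i, j) \<in> H"
      hence ij: "i \<in> {1..n}" "j \<in> {1..n}" "i < j" "\<pi> (\<rho> i) > \<pi> (\<rho> j)" "j > N"
        unfolding H_def I_def by auto
      have "\<rho> i \<in> {1..n} \<and> \<rho> i < j"
        using in\<rho>[of i] out\<rho>[of i] ij assms(3) by (cases "i \<le> N") auto
      with ij show "(\<rho> i, j) \<in> I \<pi>"
        by (auto simp: I_def out\<rho>)
    qed
  qed (rule fin)
  moreover have "I (\<pi> \<circ> \<rho>) \<subseteq> H \<union> {1..N} \<times> {1..N}"
    by (auto simp: H_def)
  hence "card (I (\<pi> \<circ> \<rho>)) \<le> card (H \<union> {1..N} \<times> {1..N})"
    by (intro card_mono) (auto simp: H_def fin)
  moreover have "card (H \<union> {1..N} \<times> {1..N}) \<le> card H + card ({1..N} \<times> {1..N})"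
    by (rule card_Un_le)
  ultimately show ?thesis
    by (simp add: inv_count_def I_def power2_eq_square)
qed

lemma permutes_subset_Icc: "\<rho> permutes {1..N} \<Longrightarrow> N \<le> n \<Longrightarrow> \<rho> permutes {1..n::nat}"
  by (erule permutes_subset) auto

lemma inv_count_comp_ge:
  assumes "\<pi> permutes {1..n}" "\<rho> permutes {1..N}" "N \<le> n"
  shows "inv_count n \<pi> \<le> inv_count n (\<pi> \<circ> \<rho>) + N\<^sup>2"
proof -
  have "inv_count n ((\<pi> \<circ> \<rho>) \<circ> inv \<rho>) \<le> inv_count n (\<pi> \<circ> \<rho>) + N\<^sup>2"
    using assms permutes_subset_Icc[of \<rho> N n]
    by (intro inv_count_comp_le permutes_compose permutes_inv) auto
  thus ?thesis
    using permutes_inv_o(1)[OF assms(2)] by (simp add: comp_assoc)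
qed

text \<open>Each rearrangement is a bijection on permutations which changes weights by a factor of at
  most \<open>\<kappa>\<close>.\<close>

lemma mweight_average:
  fixes \<rho> :: "'w \<Rightarrow> nat \<Rightarrow> nat"
  assumes q: "q > 0" and N: "N \<le> n" and fin: "finite W" and ne: "W \<noteq> {}"
    and \<rho>: "\<And>w. w \<in> W \<Longrightarrow> \<rho> w permutes {1..N}"
    and \<kappa>: "\<And>a b. a \<le> b + N\<^sup>2 \<Longrightarrow> b \<le> a + N\<^sup>2 \<Longrightarrow> q ^ a \<le> \<kappa> * q ^ b" "\<kappa> \<ge> 0"
    and c: "\<And>\<pi>. \<pi> \<in> perms n \<Longrightarrow> real (card {w \<in> W. B (\<pi> \<circ> \<rho> w)}) \<le> c * real (card W)"
  shows "mweight q n B \<le> \<kappa> * c * mweight q n (\<lambda>_. True)"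
proof -
  have bij: "bij_betw (\<lambda>\<pi>. \<pi> \<circ> \<rho> w) (perms n) (perms n)" if "w \<in> W" for w
  proof (rule bij_betw_byWitness[where f' = "\<lambda>\<pi>. \<pi> \<circ> inv (\<rho> w)"])
    note r = permutes_subset_Icc[OF \<rho>[OF that] N]
    show "\<forall>a\<in>perms n. a \<circ> \<rho> w \<circ> inv (\<rho> w) = a" "\<forall>a\<in>perms n. a \<circ> inv (\<rho> w) \<circ> \<rho> w = a"
      using permutes_inv_o[OF r] by (auto simp: comp_assoc)
    show "(\<lambda>\<pi>. \<pi> \<circ> \<rho> w) ` perms n \<subseteq> perms n" "(\<lambda>\<pi>. \<pi> \<circ> inv (\<rho> w)) ` perms n \<subseteq> perms n"
      using r permutes_inv[OF r] by (auto simp: perms_def intro: permutes_compose)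
  qed
  \<comment> \<open>Double counting: every \<open>w\<close> sees the same total, since composing
    with \<open>\<rho> w\<close> only permutes the summands; after the swap, each
    \<open>\<pi>\<close> is charged for its bad \<open>w\<close>.\<close>
  have "real (card W) * mweight q n B =
          (\<Sum>w\<in>W. \<Sum>\<pi>\<in>perms n. if B \<pi> then q ^ inv_count n \<pi> else 0)"
    by (simp add: mweight_alt)
  also have "\<dots> = (\<Sum>w\<in>W. \<Sum>\<pi>\<in>perms n. if B (\<pi> \<circ> \<rho> w) then q ^ inv_count n (\<pi> \<circ> \<rho> w) else 0)"
    by (intro sum.cong refl sum.reindex_bij_betw[OF bij, symmetric])
  also have "\<dots> \<le> (\<Sum>w\<in>W. \<Sum>\<pi>\<in>perms n. if B (\<pi> \<circ> \<rho> w) then \<kappa> * q ^ inv_count n \<pi> else 0)"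
  proof (intro sum_mono)
    fix w \<pi> assume "w \<in> W" "\<pi> \<in> perms n"
    hence "q ^ inv_count n (\<pi> \<circ> \<rho> w) \<le> \<kappa> * q ^ inv_count n \<pi>"
      using \<rho> N by (intro \<kappa> inv_count_comp_le inv_count_comp_ge) (auto simp: perms_def)
    thus "(if B (\<pi> \<circ> \<rho> w) then q ^ inv_count n (\<pi> \<circ> \<rho> w) else 0)
          \<le> (if B (\<pi> \<circ> \<rho> w) then \<kappa> * q ^ inv_count n \<pi> else 0)"
      by simp
  qed
  also have "\<dots> = (\<Sum>\<pi>\<in>perms n. \<Sum>w\<in>W. if B (\<pi> \<circ> \<rho> w) then \<kappa> * q ^ inv_count n \<pi> else 0)"
    by (rule sum.swap)
  also have "\<dots> = (\<Sum>\<pi>\<in>perms n. real (card {w \<in> W. B (\<pi> \<circ> \<rho> w)}) * (\<kappa> * q ^ inv_count n \<pi>))"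
    using fin by (intro sum.cong refl) (simp add: sum.If_cases Int_def)
  also have "\<dots> \<le> (\<Sum>\<pi>\<in>perms n. (c * real (card W)) * (\<kappa> * q ^ inv_count n \<pi>))"
    using q \<kappa>(2) c by (intro sum_mono mult_right_mono) auto
  also have "\<dots> = real (card W) * (\<kappa> * c * mweight q n (\<lambda>_. True))"
    by (simp add: mweight_alt sum_distrib_left algebra_simps)
  finally show ?thesis
    using fin ne by (simp add: card_gt_0_iff)
qed

subsection \<open>Counting functions\<close>

lemma card_PiE_split:
  assumes "finite A" "finite B" "A \<inter> B = {}"
  shows "card {f \<in> A \<union> B \<rightarrow>\<^sub>E Y. P (restrict f A) \<and> Q (restrict f B)} =
         card {f \<in> A \<rightarrow>\<^sub>E Y. P f} * card {f \<in> B \<rightarrow>\<^sub>E Y. Q f}"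
proof -
  have "bij_betw (\<lambda>f. (restrict f A, restrict f B))
      {f \<in> A \<union> B \<rightarrow>\<^sub>E Y. P (restrict f A) \<and> Q (restrict f B)}
      ({f \<in> A \<rightarrow>\<^sub>E Y. P f} \<times> {f \<in> B \<rightarrow>\<^sub>E Y. Q f})"
  proof (rule bij_betw_byWitness[where f' = "\<lambda>(f, g) x. if x \<in> A then f x else g x"], goal_cases)
    case 1
    show ?case
      by (auto simp: fun_eq_iff PiE_def extensional_def)
  next
    case 2
    have "restrict (\<lambda>x. if x \<in> A then f x else g x) A = f"
      "restrict (\<lambda>x. if x \<in> A then f x else g x) B = g"
      if "f \<in> A \<rightarrow>\<^sub>E Y" "g \<in> B \<rightarrow>\<^sub>E Y" for f g
      using that assms(3) by (auto simp: fun_eq_iff PiE_def extensional_def)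
    thus ?case by auto
  next
    case 3
    show ?case by (auto simp: PiE_def Pi_def)
  next
    case 4
    have "restrict (\<lambda>x. if x \<in> A then f x else g x) A = f"
      "restrict (\<lambda>x. if x \<in> A then f x else g x) B = g"
      if "f \<in> A \<rightarrow>\<^sub>E Y" "g \<in> B \<rightarrow>\<^sub>E Y" for f g
      using that assms(3) by (auto simp: fun_eq_iff PiE_def extensional_def)
    thus ?case by (auto simp: PiE_def Pi_def extensional_def)
  qed
  hence "card {f \<in> A \<union> B \<rightarrow>\<^sub>E Y. P (restrict f A) \<and> Q (restrict f B)} =
      card ({f \<in> A \<rightarrow>\<^sub>E Y. P f} \<times> {f \<in> B \<rightarrow>\<^sub>E Y. Q f})"
    by (rule bij_betw_same_card)
  thus ?thesis by (simp add: card_cartesian_product)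
qed

lemma card_PiE_on:
  assumes "finite I" "A \<subseteq> I" "finite Y" "\<And>f. P f \<longleftrightarrow> P (restrict f A)"
  shows "card {f \<in> I \<rightarrow>\<^sub>E Y. P f} = card {f \<in> A \<rightarrow>\<^sub>E Y. P f} * card Y ^ card (I - A)"
proof -
  have I: "A \<union> (I - A) = I"
    using assms(2) by auto
  have "card {f \<in> A \<union> (I - A) \<rightarrow>\<^sub>E Y. P (restrict f A) \<and> True} =
        card {f \<in> A \<rightarrow>\<^sub>E Y. P f} * card {f \<in> I - A \<rightarrow>\<^sub>E Y. True}"
    using assms(1,2) by (intro card_PiE_split) (auto intro: finite_subset)
  moreover have "card {f \<in> I - A \<rightarrow>\<^sub>E Y. True} = card Y ^ card (I - A)"
    using assms(1) by (simp add: card_PiE)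
  ultimately show ?thesis
    unfolding I assms(4)[symmetric] by simp
qed

text \<open>In terms of probability: a uniformly random function has a bad value at \<open>i\<close>
  with probability at most \<open>b / card Y\<close>. Multiplying by \<open>card Y\<close> keeps the
  estimate in the natural numbers.\<close>

lemma card_PiE_1:
  assumes "finite I" "i \<in> I" "finite Y" "card {y \<in> Y. P y} \<le> b"
  shows "card {f \<in> I \<rightarrow>\<^sub>E Y. P (f i)} * card Y \<le> b * card Y ^ card I"
proof -
  have "card {f \<in> I \<rightarrow>\<^sub>E Y. P (f i)} = card {f \<in> {i} \<rightarrow>\<^sub>E Y. P (f i)} * card Y ^ card (I - {i})"
    using assms by (intro card_PiE_on) auto
  also have "card {f \<in> {i} \<rightarrow>\<^sub>E Y. P (f i)} \<le> card {y \<in> Y. P y}"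
    by (rule card_inj_on_le[where f = "\<lambda>f. f i"])
       (use assms in \<open>auto simp: inj_on_def PiE_def extensional_def fun_eq_iff, metis\<close>)
  finally have "card {f \<in> I \<rightarrow>\<^sub>E Y. P (f i)} \<le> card {y \<in> Y. P y} * card Y ^ card (I - {i})"
    by (simp add: mult_le_mono1)
  also have "\<dots> \<le> b * card Y ^ card (I - {i})"
    using assms(4) by (rule mult_le_mono1)
  finally have "card {f \<in> I \<rightarrow>\<^sub>E Y. P (f i)} \<le> b * card Y ^ card (I - {i})" .
  hence "card {f \<in> I \<rightarrow>\<^sub>E Y. P (f i)} * card Y \<le> b * card Y ^ card (I - {i}) * card Y"
    by (rule mult_le_mono1)
  also have "card I = Suc (card (I - {i}))"
    using assms by (intro card.remove)
  hence "b * card Y ^ card (I - {i}) * card Y = b * card Y ^ card I"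
    by simp
  finally show ?thesis .
qed

text \<open>The same estimate for two coordinates: whatever the first value is, at most
  \<open>b\<close> values of the second are bad.\<close>

lemma card_PiE_2:
  assumes "finite I" "i \<in> I" "j \<in> I" "i \<noteq> j" "finite Y"
    and "\<And>x. x \<in> Y \<Longrightarrow> card {y \<in> Y. P x y} \<le> b"
  shows "card {f \<in> I \<rightarrow>\<^sub>E Y. P (f i) (f j)} * card Y \<le> b * card Y ^ card I"
proof -
  let ?S = "{f \<in> {i, j} \<rightarrow>\<^sub>E Y. P (f i) (f j)}"
  have "card {f \<in> I \<rightarrow>\<^sub>E Y. P (f i) (f j)} = card ?S * card Y ^ card (I - {i, j})"
    using assms by (intro card_PiE_on) auto
  moreover have "card ?S \<le> card (SIGMA x:Y. {y \<in> Y. P x y})"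
    by (rule card_inj_on_le[where f = "\<lambda>f. (f i, f j)"])
       (use assms in \<open>auto simp: inj_on_def PiE_def extensional_def fun_eq_iff, metis\<close>)
  moreover have "card (SIGMA x:Y. {y \<in> Y. P x y}) \<le> (\<Sum>x\<in>Y. b)"
    using assms by (subst card_SigmaI) (auto simp: sum_bounded_above simp del: sum_constant intro!: sum_mono)
  ultimately have "card {f \<in> I \<rightarrow>\<^sub>E Y. P (f i) (f j)} \<le> card Y * b * card Y ^ card (I - {i, j})"
    by simp
  hence "card {f \<in> I \<rightarrow>\<^sub>E Y. P (f i) (f j)} * card Y \<le> b * (card Y * card Y * card Y ^ card (I - {i, j}))"
    by (drule_tac mult_le_mono1[of _ _ "card Y"]) (simp add: mult_ac)
  also have "card I = card (I - {i, j}) + card {i, j}"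
    using assms card_Diff_subset[of "{i, j}" I] card_mono[of I "{i, j}"] by simp
  hence "card I = Suc (Suc (card (I - {i, j})))"
    using assms by simp
  hence "card Y * card Y * card Y ^ card (I - {i, j}) = card Y ^ card I"
    by simp
  finally show ?thesis .
qed

section \<open>The first positions of a nearly uniform permutation\<close>

text \<open>\<open>g\<close> assigns to positions one of \<open>D\<close> buckets of values. The
  first \<open>R\<close> positions act as markers; their buckets are so far apart, and so far from
  both ends, that the bucket just below a marker meets no other marker and the top bucket lies above
  all of them. Every word of \<open>m\<close> buckets is spelled somewhere after the
  markers.\<close>

definition universal :: "nat \<Rightarrow> nat \<Rightarrow> nat \<Rightarrow> nat \<Rightarrow> (nat \<Rightarrow> nat) \<Rightarrow> bool" where
  "universal R m k D g \<longleftrightarrow>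
     (\<forall>i\<in>{1..R}. g i \<ge> 1 \<and> g i + 2 \<le> D) \<and>
     (\<forall>i\<in>{1..R}. \<forall>j\<in>{1..R}. i \<noteq> j \<longrightarrow> g i + 2 \<le> g j \<or> g j + 2 \<le> g i) \<and>
     (\<forall>u\<in>{..<m} \<rightarrow>\<^sub>E {..<D}. \<exists>b\<ge>R. b + m \<le> k \<and> (\<forall>t<m. g (b + t + 1) = u t))"

text \<open>The positions after \<open>R\<close> are cut into \<open>M\<close> disjoint blocks,
  which are independent for a random function; each spells \<open>u\<close> in exactly
  \<open>s ^ m\<close> of its \<open>card Y ^ m\<close> fillings. Other places where
  \<open>u\<close> might occur are ignored.\<close>

lemma card_blocks_miss:
  fixes \<beta> :: "nat \<Rightarrow> nat"
  assumes Y: "finite Y" and fib: "\<And>b. b < D \<Longrightarrow> card {y \<in> Y. \<beta> y = b} = s"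
    and u: "\<And>t. t < m \<Longrightarrow> u t < D"
  shows "card {f \<in> {1..R + M * m} \<rightarrow>\<^sub>E Y. \<forall>b<M. \<exists>t<m. \<beta> (f (R + b * m + t + 1)) \<noteq> u t} =
         card Y ^ R * (card Y ^ m - s ^ m) ^ M"
proof (induction M)
  case 0
  have "{f \<in> {1..R + 0 * m} \<rightarrow>\<^sub>E Y. \<forall>b<0. \<exists>t<m. \<beta> (f (R + b * m + t + 1)) \<noteq> u t} =
        {1..R} \<rightarrow>\<^sub>E Y" by auto
  thus ?case by (simp only: card_PiE finite_atLeastAtMost) simp
next
  case (Suc M)
  define A where "A = {1..R + M * m}"
  define B where "B = {R + M * m + 1..R + M * m + m}"
  define P where "P f \<longleftrightarrow> (\<forall>b<M. \<exists>t<m. \<beta> (f (R + b * m + t + 1)) \<noteq> u t)" for f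
  define Q where "Q f \<longleftrightarrow> (\<exists>t<m. \<beta> (f (R + M * m + t + 1)) \<noteq> u t)" for f
  have AB: "{1..R + Suc M * m} = A \<union> B" "A \<inter> B = {}" "finite A" "finite B"
    by (auto simp: A_def B_def)
  have "R + b * m + t + 1 \<in> A" if "b < M" "t < m" for b t
  proof -
    have "Suc b * m \<le> M * m"
      using that by (intro mult_le_mono1) simp
    thus ?thesis
      using that by (simp add: A_def)
  qed
  hence P: "P (restrict f A) \<longleftrightarrow> P f" for f
    unfolding P_def by (intro all_cong ex_cong1 conj_cong refl) simp
  have Q: "Q (restrict f B) \<longleftrightarrow> Q f" for f
    unfolding Q_def B_def by (intro ex_cong1 conj_cong refl) simp
  have "{f \<in> {1..R + Suc M * m} \<rightarrow>\<^sub>E Y. \<forall>b<Suc M. \<exists>t<m. \<beta> (f (R + b * m + t + 1)) \<noteq> u t} =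
        {f \<in> A \<union> B \<rightarrow>\<^sub>E Y. P (restrict f A) \<and> Q (restrict f B)}"
    unfolding P Q AB(1) unfolding P_def Q_def by (auto simp: less_Suc_eq)
  also have "card \<dots> = card {f \<in> A \<rightarrow>\<^sub>E Y. P f} * card {f \<in> B \<rightarrow>\<^sub>E Y. Q f}"
    by (rule card_PiE_split) (use AB in auto)
  also have "card {f \<in> A \<rightarrow>\<^sub>E Y. P f} = card Y ^ R * (card Y ^ m - s ^ m) ^ M"
    using Suc.IH by (simp add: A_def P_def)
  also have "card {f \<in> B \<rightarrow>\<^sub>E Y. Q f} = card Y ^ m - s ^ m"
  proof -
    define C where "C = PiE B (\<lambda>x. {y \<in> Y. \<beta> y = u (x - (R + M * m) - 1)})"
    have "{f \<in> B \<rightarrow>\<^sub>E Y. Q f} = (B \<rightarrow>\<^sub>E Y) - C"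
    proof -
      have "f \<in> C \<longleftrightarrow> \<not> Q f" if "f \<in> B \<rightarrow>\<^sub>E Y" for f
      proof
        assume "f \<in> C"
        thus "\<not> Q f"
          by (fastforce simp: C_def Q_def B_def PiE_def Pi_def)
      next
        assume nQ: "\<not> Q f"
        have "\<beta> (f x) = u (x - (R + M * m) - 1)" if "x \<in> B" for x
        proof -
          from that obtain t where "x = R + M * m + t + 1" "t < m"
            by (auto simp: B_def intro: that[of "x - (R + M * m) - 1"])
          thus ?thesis using nQ by (auto simp: Q_def)
        qed
        thus "f \<in> C" using that by (auto simp: C_def)
      qed
      moreover have "C \<subseteq> B \<rightarrow>\<^sub>E Y"
        by (auto simp: C_def PiE_def)
      ultimately show ?thesis by auto
    qed
    moreover have "card C = (\<Prod>x\<in>B. s)"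
      unfolding C_def using AB(4)
      by (subst card_PiE, simp, intro prod.cong refl fib u) (auto simp: B_def)
    moreover have "C \<subseteq> B \<rightarrow>\<^sub>E Y"
      by (auto simp: C_def PiE_def)
    moreover have "finite (B \<rightarrow>\<^sub>E Y)"
      using AB(4) Y by (intro finite_PiE)
    ultimately show ?thesis
      using AB(4) by (simp add: card_Diff_subset finite_subset[of C] card_PiE B_def)
  qed
  finally show ?case by simp
qed

lemma sum_distinct_pairs_le:
  fixes h :: "'j \<Rightarrow> 'j \<Rightarrow> real" and c :: real
  assumes "finite J" "c \<ge> 0" "\<And>i j. i \<in> J \<Longrightarrow> j \<in> J \<Longrightarrow> i \<noteq> j \<Longrightarrow> h i j \<le> c"
  shows "(\<Sum>z\<in>{z \<in> J \<times> J. fst z \<noteq> snd z}. h (fst z) (snd z)) \<le> (card J)\<^sup>2 * c"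
proof -
  let ?S = "{z \<in> J \<times> J. fst z \<noteq> snd z}"
  have "(\<Sum>z\<in>?S. h (fst z) (snd z)) \<le> of_nat (card ?S) * c"
  proof (rule sum_bounded_above)
    fix z assume "z \<in> ?S"
    thus "h (fst z) (snd z) \<le> c" by (intro assms(3)) auto
  qed
  also have "card ?S \<le> card (J \<times> J)"
    using assms(1) by (intro card_mono) auto
  hence "of_nat (card ?S) * c \<le> of_nat (card (J \<times> J)) * c"
    using assms(2) by (intro mult_right_mono) auto
  finally show ?thesis
    by (simp add: card_cartesian_product power2_eq_square)
qed

text \<open>Union bound over four kinds of failure: a collision \<open>E1\<close>, a marker in an
  extreme bucket \<open>E2\<close>, two markers in equal or adjacent buckets \<open>E3\<close>, and
  one of the \<open>D ^ m\<close> words missing from all blocks \<open>E4\<close>. Random functions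
  are used instead of injections to have independent coordinates; the price is the collision
  term.\<close>

lemma card_few_not_universal:
  fixes \<beta> :: "nat \<Rightarrow> nat" and k s D R M m :: nat
  assumes Y: "finite Y" and fib: "\<And>b. b < D \<Longrightarrow> card {y \<in> Y. \<beta> y = b} = s"
    and \<beta>: "\<And>y. y \<in> Y \<Longrightarrow> \<beta> y < D" and cY: "card Y = D * s" and s: "s > 0" and D: "D > 0"
    and k: "k = R + M * m"
  shows "real (card {f \<in> {1..k} \<rightarrow>\<^sub>E Y. \<not> (inj_on f {1..k} \<and> universal R m k D (\<beta> \<circ> f))})
     \<le> (k\<^sup>2 / (D * s) + (2 * R + 3 * R\<^sup>2) / D + D ^ m * (1 - 1 / D ^ m) ^ M) * real (card Y) ^ k"
proof -
  define I where "I = {1..k}"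
  define N where "N = card Y"
  define \<Omega> where "\<Omega> = (I \<rightarrow>\<^sub>E Y)"
  have N: "N > 0" using s D cY by (simp add: N_def)
  have fin: "finite I" "finite \<Omega>" "card I = k"
    by (auto simp: I_def \<Omega>_def Y intro!: finite_PiE)
  define E1 where "E1 i j = {f \<in> \<Omega>. f i = f j}" for i j
  define E2 where "E2 i = {f \<in> \<Omega>. \<beta> (f i) = 0 \<or> \<beta> (f i) = D - 1}" for i
  \<comment> \<open>For bucket 0 the truncated \<open>0 - 1\<close> is 0 again, so the set only
    repeats an element.\<close>
  define E3 where "E3 i j = {f \<in> \<Omega>. \<beta> (f j) \<in> {\<beta> (f i) - 1, \<beta> (f i), \<beta> (f i) + 1}}" for i j
  define E4 where "E4 u = {f \<in> \<Omega>. \<forall>b<M. \<exists>t<m. \<beta> (f (R + b * m + t + 1)) \<noteq> u t}" for u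
  define U where "U = {..<m} \<rightarrow>\<^sub>E {..<D}"
  define p where "p A = real (card A) / real N ^ k" for A :: "(nat \<Rightarrow> nat) set"
  have finE: "finite (E1 i j)" "finite (E2 i)" "finite (E3 i j)" "finite (E4 u)" for i j u
    using fin by (auto simp: E1_def E2_def E3_def E4_def)
  have pmono: "p A \<le> p B" if "A \<subseteq> B" "finite B" for A B
    unfolding p_def using that by (intro divide_right_mono) (auto intro: card_mono)
  have pUn: "p (\<Union>i\<in>J. A i) \<le> (\<Sum>i\<in>J. p (A i))" if "finite J" for J :: "'j set" and A
  proof -
    have "real (card (\<Union>i\<in>J. A i)) \<le> (\<Sum>i\<in>J. real (card (A i)))"
      using of_nat_mono[OF card_UN_le[OF that, of A], where 'a = real] by simp
    thus ?thesis
      by (simp add: p_def sum_divide_distrib[symmetric] divide_right_mono)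
  qed
  have pUn2: "p (A \<union> B) \<le> p A + p B" for A B
    using card_Un_le[of A B] by (simp add: p_def add_divide_distrib[symmetric] divide_right_mono
        of_nat_add[symmetric] del: of_nat_add)
  have pI: "p A \<le> b / N" if "card A * N \<le> b * N ^ k" for A b
  proof -
    have "real (card A) * real N \<le> real b * real N ^ k"
      using of_nat_mono[OF that, where 'a = real] by simp
    thus ?thesis using N by (simp add: p_def field_simps)
  qed
  have fib': "card {y \<in> Y. \<beta> y = b} \<le> s" for b
  proof (cases "b < D")
    case False
    hence *: "{y \<in> Y. \<beta> y = b} = {}" using \<beta> by auto
    show ?thesis by (subst *) simp
  qed (simp add: fib)
  have c1: "p (E1 i j) \<le> 1 / N" if "i \<in> I" "j \<in> I" "i \<noteq> j" for i j
  proof -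
    have "card {y \<in> Y. x = y} \<le> 1" if "x \<in> Y" for x
    proof -
      have "{y \<in> Y. x = y} = {x}" using that by auto
      thus ?thesis by simp
    qed
    hence "card (E1 i j) * N \<le> 1 * N ^ k"
      using that fin Y card_PiE_2[of I i j Y "\<lambda>x y. x = y" 1] by (simp add: E1_def \<Omega>_def N_def)
    from pI[OF this] show ?thesis by simp
  qed
  have c2: "p (E2 i) \<le> 2 / D" if "i \<in> I" for i
  proof -
    have "{y \<in> Y. \<beta> y = 0 \<or> \<beta> y = D - 1} = {y \<in> Y. \<beta> y = 0} \<union> {y \<in> Y. \<beta> y = D - 1}"
      by auto
    hence "card {y \<in> Y. \<beta> y = 0 \<or> \<beta> y = D - 1} \<le> card {y \<in> Y. \<beta> y = 0} + card {y \<in> Y. \<beta> y = D - 1}"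
      by (simp only: card_Un_le)
    also have "\<dots> \<le> 2 * s" using fib'[of 0] fib'[of "D - 1"] by simp
    finally have "card (E2 i) * N \<le> (2 * s) * N ^ k"
      using that fin Y card_PiE_1[of I i Y "\<lambda>y. \<beta> y = 0 \<or> \<beta> y = D - 1" "2 * s"]
      by (simp add: E2_def \<Omega>_def N_def)
    from pI[OF this] show ?thesis using cY s by (simp add: N_def)
  qed
  have c3: "p (E3 i j) \<le> 3 / D" if "i \<in> I" "j \<in> I" "i \<noteq> j" for i j
  proof -
    have "card {y \<in> Y. \<beta> y \<in> {\<beta> x - 1, \<beta> x, \<beta> x + 1}} \<le> 3 * s" for x
    proof -
      have "{y \<in> Y. \<beta> y \<in> {\<beta> x - 1, \<beta> x, \<beta> x + 1}} \<subseteq> {y \<in> Y. \<beta> y = \<beta> x - 1} \<union>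
          ({y \<in> Y. \<beta> y = \<beta> x} \<union> {y \<in> Y. \<beta> y = \<beta> x + 1})" by auto
      hence "card {y \<in> Y. \<beta> y \<in> {\<beta> x - 1, \<beta> x, \<beta> x + 1}} \<le> card ({y \<in> Y. \<beta> y = \<beta> x - 1} \<union>
          ({y \<in> Y. \<beta> y = \<beta> x} \<union> {y \<in> Y. \<beta> y = \<beta> x + 1}))"
        by (intro card_mono) (auto simp: Y)
      also have "\<dots> \<le> card {y \<in> Y. \<beta> y = \<beta> x - 1} +
          (card {y \<in> Y. \<beta> y = \<beta> x} + card {y \<in> Y. \<beta> y = \<beta> x + 1})"
        by (intro order.trans[OF card_Un_le] add_left_mono card_Un_le)
      also have "\<dots> \<le> 3 * s"
        using fib'[of "\<beta> x - 1"] fib'[of "\<beta> x"] fib'[of "\<beta> x + 1"] by simp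
      finally show ?thesis .
    qed
    hence "card (E3 i j) * N \<le> (3 * s) * N ^ k"
      using that fin Y card_PiE_2[of I i j Y "\<lambda>x y. \<beta> y \<in> {\<beta> x - 1, \<beta> x, \<beta> x + 1}" "3 * s"]
      by (simp add: E3_def \<Omega>_def N_def)
    from pI[OF this] show ?thesis using cY s by (simp add: N_def)
  qed
  have c4: "p (E4 u) = (1 - 1 / D ^ m) ^ M" if "u \<in> U" for u
  proof -
    have "card (E4 u) = N ^ R * (N ^ m - s ^ m) ^ M"
      unfolding E4_def \<Omega>_def I_def N_def k using that
      by (intro card_blocks_miss[OF Y fib]) (auto simp: U_def)
    moreover have "s ^ m \<le> N ^ m"
      using cY D by (intro power_mono) (auto simp: N_def)
    ultimately have "real (card (E4 u)) = real N ^ R * (real N ^ m - real s ^ m) ^ M"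
      by (simp add: of_nat_diff)
    hence "p (E4 u) = ((real N ^ m - real s ^ m) / real N ^ m) ^ M"
      using N by (simp add: p_def k power_add power_mult power_divide mult.commute[of M m])
    also have "(real N ^ m - real s ^ m) / real N ^ m = 1 - (real s / real N) ^ m"
      using N by (simp add: diff_divide_distrib power_divide)
    also have "real s / real N = 1 / D"
      using cY s by (simp add: N_def)
    finally show ?thesis by (simp add: power_divide)
  qed
  define S where "S J = {z \<in> J \<times> J. fst z \<noteq> snd z}" for J :: "nat set"
  have finS: "finite (S J)" if "finite J" for J
    unfolding S_def using that by simp
  define F where "F = (\<Union>z\<in>S I. E1 (fst z) (snd z)) \<union>
     ((\<Union>i\<in>{1..R}. E2 i) \<union> ((\<Union>z\<in>S {1..R}. E3 (fst z) (snd z)) \<union>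
     (\<Union>u\<in>U. E4 u)))"
  have RI: "{1..R} \<subseteq> I" by (auto simp: I_def k)
  have finU: "finite U" "card U = D ^ m" by (auto simp: U_def card_PiE intro!: finite_PiE)
  have "p F \<le> (\<Sum>z\<in>S I. p (E1 (fst z) (snd z))) +
     ((\<Sum>i\<in>{1..R}. p (E2 i)) + ((\<Sum>z\<in>S {1..R}. p (E3 (fst z) (snd z))) + (\<Sum>u\<in>U. p (E4 u))))"
  proof -
    have "p F \<le> p (\<Union>z\<in>S I. E1 (fst z) (snd z)) + (p (\<Union>i\<in>{1..R}. E2 i) +
        (p (\<Union>z\<in>S {1..R}. E3 (fst z) (snd z)) + p (\<Union>u\<in>U. E4 u)))"
      unfolding F_def by (intro order.trans[OF pUn2] add_left_mono order.refl pUn2)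
    also have "\<dots> \<le> (\<Sum>z\<in>S I. p (E1 (fst z) (snd z))) +
     ((\<Sum>i\<in>{1..R}. p (E2 i)) + ((\<Sum>z\<in>S {1..R}. p (E3 (fst z) (snd z))) + (\<Sum>u\<in>U. p (E4 u))))"
      using finU fin finS by (intro add_mono pUn) auto
    finally show ?thesis .
  qed
  also have "\<dots> \<le> (card I)\<^sup>2 * (1 / N) + (R * (2 / D) + ((card {1..R})\<^sup>2 * (3 / D) + D ^ m * (1 - 1 / D ^ m) ^ M))"
  proof (intro add_mono)
    show "(\<Sum>z\<in>S I. p (E1 (fst z) (snd z))) \<le> (card I)\<^sup>2 * (1 / N)"
      unfolding S_def using fin c1 by (intro sum_distinct_pairs_le) auto
    show "(\<Sum>z\<in>S {1..R}. p (E3 (fst z) (snd z))) \<le> (card {1..R})\<^sup>2 * (3 / D)"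
      unfolding S_def by (rule sum_distinct_pairs_le, simp, simp) (intro c3 subsetD[OF RI]; assumption)
    have "(\<Sum>i\<in>{1..R}. p (E2 i)) \<le> (\<Sum>i\<in>{1..R}. 2 / D)"
      by (intro sum_mono c2 subsetD[OF RI])
    thus "(\<Sum>i\<in>{1..R}. p (E2 i)) \<le> R * (2 / D)" by simp
    show "(\<Sum>u\<in>U. p (E4 u)) \<le> D ^ m * (1 - 1 / D ^ m) ^ M"
      using c4 finU by simp
  qed
  also have "\<dots> = k\<^sup>2 / (D * s) + (2 * R + 3 * R\<^sup>2) / D + D ^ m * (1 - 1 / D ^ m) ^ M"
    using cY fin by (simp add: N_def add_divide_distrib mult.commute)
  finally have pF: "p F \<le> k\<^sup>2 / (D * s) + (2 * R + 3 * R\<^sup>2) / D + D ^ m * (1 - 1 / D ^ m) ^ M" .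
  have "{f \<in> \<Omega>. \<not> (inj_on f I \<and> universal R m k D (\<beta> \<circ> f))} \<subseteq> F"
  proof
    fix f assume f: "f \<in> {f \<in> \<Omega>. \<not> (inj_on f I \<and> universal R m k D (\<beta> \<circ> f))}"
    show "f \<in> F"
    proof (rule ccontr)
      assume nF: "f \<notin> F"
      have "inj_on f I"
        using nF f by (force simp: F_def E1_def inj_on_def S_def)
      moreover have "universal R m k D (\<beta> \<circ> f)"
        unfolding universal_def
      proof (intro conjI ballI impI)
        fix i assume i: "i \<in> {1..R}"
        hence "f i \<in> Y" using f RI by (auto simp: \<Omega>_def PiE_def Pi_def)
        hence "\<beta> (f i) < D" by (rule \<beta>)
        moreover have "\<beta> (f i) \<noteq> 0" "\<beta> (f i) \<noteq> D - 1"
          using nF f i by (auto simp: F_def E2_def)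
        ultimately show "(\<beta> \<circ> f) i \<ge> 1" "(\<beta> \<circ> f) i + 2 \<le> D" by auto
      next
        fix i j assume ij: "i \<in> {1..R}" "j \<in> {1..R}" "i \<noteq> j"
        hence "(i, j) \<in> S {1..R}" by (simp add: S_def)
        hence "f \<notin> E3 i j" using nF by (fastforce simp: F_def)
        thus "(\<beta> \<circ> f) i + 2 \<le> (\<beta> \<circ> f) j \<or> (\<beta> \<circ> f) j + 2 \<le> (\<beta> \<circ> f) i"
          using f by (auto simp: E3_def)
      next
        fix u assume "u \<in> {..<m} \<rightarrow>\<^sub>E {..<D}"
        hence "f \<notin> E4 u" using nF by (auto simp: F_def U_def)
        then obtain b where b: "b < M" "\<And>t. t < m \<Longrightarrow> \<beta> (f (R + b * m + t + 1)) = u t"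
          using f by (auto simp: E4_def)
        have "Suc b * m \<le> M * m" using b by (intro mult_le_mono1) simp
        thus "\<exists>b\<ge>R. b + m \<le> k \<and> (\<forall>t<m. (\<beta> \<circ> f) (b + t + 1) = u t)"
          using b by (intro exI[of _ "R + b * m"]) (auto simp: k)
      qed
      ultimately show False using f by simp
    qed
  qed
  moreover have "finite F" unfolding F_def
    using finE finU fin finS by auto
  ultimately have "p {f \<in> \<Omega>. \<not> (inj_on f I \<and> universal R m k D (\<beta> \<circ> f))} \<le>
       k\<^sup>2 / (D * s) + (2 * R + 3 * R\<^sup>2) / D + D ^ m * (1 - 1 / D ^ m) ^ M"
    using pmono pF order.trans by blast
  thus ?thesis
    using N unfolding p_def \<Omega>_def I_def N_def by (simp add: field_simps)
qed

section \<open>From random functions to rearranged permutations\<close>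

lemma extend_injection_permutes:
  assumes "inj_on f {1..k}" "f ` {1..k} \<subseteq> {1..N}"
  shows "\<exists>\<rho>. \<rho> permutes {1..N::nat} \<and> (\<forall>i\<in>{1..k}. \<rho> i = f i)"
proof -
  have k: "k \<le> N"
    using card_inj_on_le[OF assms] by simp
  have c: "card ({1..N} - {1..k}) = card ({1..N} - f ` {1..k})"
    using assms k by (subst (1 2) card_Diff_subset) (auto simp: card_image)
  obtain h where h: "bij_betw h ({1..N} - {1..k}) ({1..N} - f ` {1..k})"
    using finite_same_card_bij[OF _ _ c] by blast
  define \<rho> where "\<rho> i = (if i \<in> {1..k} then f i else if i \<in> {1..N} then h i else i)" for i
  have "bij_betw \<rho> {1..k} (f ` {1..k})"
    using inj_on_imp_bij_betw[OF assms(1)] by (subst bij_betw_cong[where g = f]) (simp_all add: \<rho>_def)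
  moreover have "bij_betw \<rho> ({1..N} - {1..k}) ({1..N} - f ` {1..k})"
    using h by (subst bij_betw_cong[where g = h]) (simp_all add: \<rho>_def)
  ultimately have "bij_betw \<rho> ({1..k} \<union> ({1..N} - {1..k})) (f ` {1..k} \<union> ({1..N} - f ` {1..k}))"
    by (rule bij_betw_combine) auto
  moreover have "{1..k} \<union> ({1..N} - {1..k}) = {1..N}" "f ` {1..k} \<union> ({1..N} - f ` {1..k}) = {1..N}"
    using assms k by auto
  ultimately have "\<rho> permutes {1..N}"
    using k by (intro bij_imp_permutes) (auto simp: \<rho>_def)
  thus ?thesis by (auto simp: \<rho>_def)
qed

lemma rank_bij:
  assumes "inj_on \<pi> {1..N::nat}"
  shows "bij_betw (\<lambda>i. card {j \<in> {1..N}. \<pi> j < (\<pi> i :: nat)}) {1..N} {..<N}"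
proof -
  let ?r = "\<lambda>i. card {j \<in> {1..N}. \<pi> j < \<pi> i}"
  have mono: "?r i < ?r j" if "i \<in> {1..N}" "\<pi> i < \<pi> j" for i j
  proof (rule psubset_card_mono)
    have "{k \<in> {1..N}. \<pi> k < \<pi> i} \<subseteq> {k \<in> {1..N}. \<pi> k < \<pi> j}"
      using that by auto
    moreover have "i \<in> {k \<in> {1..N}. \<pi> k < \<pi> j}" "i \<notin> {k \<in> {1..N}. \<pi> k < \<pi> i}"
      using that by simp_all
    ultimately show "{k \<in> {1..N}. \<pi> k < \<pi> i} \<subset> {k \<in> {1..N}. \<pi> k < \<pi> j}" by blast
  qed simp
  have inj: "inj_on ?r {1..N}"
  proof (rule inj_onI)
    fix i j assume ij: "i \<in> {1..N}" "j \<in> {1..N}" "?r i = ?r j"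
    have "\<not> \<pi> i < \<pi> j" "\<not> \<pi> j < \<pi> i"
      using mono[OF ij(1), of j] mono[OF ij(2), of i] ij(3) by linarith+
    hence "\<pi> i = \<pi> j" by simp
    thus "i = j" using assms ij by (auto dest: inj_onD)
  qed
  have sub: "?r ` {1..N} \<subseteq> {..<N}"
  proof (rule image_subsetI)
    fix i assume i: "i \<in> {1..N}"
    have "?r i < card {1..N}"
    proof (rule psubset_card_mono)
      have "i \<notin> {j \<in> {1..N}. \<pi> j < \<pi> i}" by simp
      thus "{j \<in> {1..N}. \<pi> j < \<pi> i} \<subset> {1..N}" using i by blast
    qed simp
    thus "?r i \<in> {..<N}" by simp
  qed
  have "?r ` {1..N} = {..<N}"
    by (rule card_subset_eq[OF _ sub]) (simp, subst card_image[OF inj], simp)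
  with inj show ?thesis
    by (simp add: bij_betw_def)
qed

text \<open>The coarsening \<open>g\<close> is existentially quantified and tied to
  \<open>\<pi>\<close> only through comparisons, since the sentence to be built sees nothing but the
  two orders.\<close>

definition well_mixed :: "nat \<Rightarrow> nat \<Rightarrow> nat \<Rightarrow> nat \<Rightarrow> (nat \<Rightarrow> nat) \<Rightarrow> bool" where
  "well_mixed R m k D \<pi> \<longleftrightarrow>
     (\<exists>g. (\<forall>x\<in>{1..k}. \<forall>y\<in>{1..k}. g x < g y \<longrightarrow> \<pi> x < \<pi> y) \<and> universal R m k D g)"

text \<open>Composing \<open>\<pi>\<close> with an extension of an injection \<open>f\<close> puts
  the values of \<open>\<pi>\<close> at the sampled positions \<open>f 1, ..., f k\<close> in front.
  For a fixed \<open>\<pi>\<close>, the average over all \<open>f\<close> is thus the counting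
  problem already solved.\<close>

lemma mweight_not_well_mixed:
  fixes k s D R M m n :: nat and q \<kappa> :: real
  assumes q: "q > 0" and k: "k = R + M * m" and D: "D > 0" and s: "s > 0" and N: "D * s \<le> n"
    and \<kappa>: "\<And>a b. a \<le> b + (D * s)\<^sup>2 \<Longrightarrow> b \<le> a + (D * s)\<^sup>2 \<Longrightarrow> q ^ a \<le> \<kappa> * q ^ b" "\<kappa> \<ge> 0"
  shows "mweight q n (\<lambda>\<pi>. \<not> well_mixed R m k D \<pi>) \<le>
    \<kappa> * (k\<^sup>2 / (D * s) + (2 * R + 3 * R\<^sup>2) / D + D ^ m * (1 - 1 / D ^ m) ^ M) * mweight q n (\<lambda>_. True)"
proof -
  define N where "N = D * s"
  define W where "W = {1..k} \<rightarrow>\<^sub>E {1..N}"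
  \<comment> \<open>A non-injective \<open>f\<close> has no extension; it gets the identity and is
    counted among the bad ones.\<close>
  define \<rho> where "\<rho> f = (if inj_on f {1..k} then SOME \<rho>. \<rho> permutes {1..N} \<and> (\<forall>i\<in>{1..k}. \<rho> i = f i) else id)"
    for f :: "nat \<Rightarrow> nat"
  have \<rho>: "\<rho> f permutes {1..N} \<and> (inj_on f {1..k} \<longrightarrow> (\<forall>i\<in>{1..k}. \<rho> f i = f i))" if "f \<in> W" for f
  proof (cases "inj_on f {1..k}")
    case True
    have "\<exists>\<rho>. \<rho> permutes {1..N} \<and> (\<forall>i\<in>{1..k}. \<rho> i = f i)"
      using that by (intro extend_injection_permutes True) (auto simp: W_def)
    from someI_ex[OF this] show ?thesis using True by (simp add: \<rho>_def)
  qed (simp add: \<rho>_def permutes_id)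
  have N0: "N > 0" using D s by (simp add: N_def)
  show ?thesis
  proof (rule mweight_average[OF q, of N n W \<rho>])
    fix \<pi> assume \<pi>: "\<pi> \<in> perms n"
    define r where "r i = card {j \<in> {1..N}. \<pi> j < \<pi> i}" for i
    \<comment> \<open>The ranks of the first \<open>N = D * s\<close> positions fill
      \<open>{..<N}\<close>; cutting this range into intervals of length \<open>s\<close> gives
      \<open>D\<close> buckets of equal size, and a smaller bucket forces a smaller value of
      \<open>\<pi>\<close>.\<close>
    define \<beta> where "\<beta> i = r i div s" for i
    have bij: "bij_betw r {1..N} {..<N}"
      unfolding r_def using \<pi> by (intro rank_bij) (auto simp: perms_def dest: permutes_inj intro: inj_on_subset)
    have rmono: "\<pi> i < \<pi> j" if "r i < r j" for i j
    proof (rule ccontr)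
      assume "\<not> \<pi> i < \<pi> j"
      hence "r j \<le> r i" unfolding r_def by (intro card_mono) auto
      thus False using that by simp
    qed
    have mono: "\<pi> i < \<pi> j" if "\<beta> i < \<beta> j" for i j
    proof (rule rmono, rule ccontr)
      assume "\<not> r i < r j"
      hence "\<beta> j \<le> \<beta> i" unfolding \<beta>_def by (intro div_le_mono) simp
      thus False using that by simp
    qed
    have fib: "card {i \<in> {1..N}. \<beta> i = b} = s" if "b < D" for b
    proof -
      have im: "r ` {i \<in> {1..N}. \<beta> i = b} = {x \<in> {..<N}. x div s = b}"
      proof -
        have "x \<in> r ` {i \<in> {1..N}. \<beta> i = b}" if "x < N" "x div s = b" for x
        proof -
          have "x \<in> r ` {1..N}" using bij that(1) by (simp add: bij_betw_def)
          thus ?thesis using that(2) by (auto simp: \<beta>_def)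
        qed
        thus ?thesis using bij by (auto simp: bij_betw_def \<beta>_def)
      qed
      have inj: "inj_on r {i \<in> {1..N}. \<beta> i = b}"
        using bij by (auto simp: bij_betw_def intro: inj_on_subset)
      have "card {i \<in> {1..N}. \<beta> i = b} = card {x \<in> {..<N}. x div s = b}"
        unfolding im[symmetric] by (rule card_image[OF inj, symmetric])
      also have "{x \<in> {..<N}. x div s = b} = {b * s..<b * s + s}"
      proof (intro equalityI subsetI)
        fix x assume "x \<in> {x \<in> {..<N}. x div s = b}"
        hence "b * s + x mod s = x"
          using div_mult_mod_eq[of x s] by simp
        moreover have "x mod s < s" using s by simp
        ultimately show "x \<in> {b * s..<b * s + s}"
          unfolding atLeastLessThan_iff by linarith
      next
        fix x assume x: "x \<in> {b * s..<b * s + s}"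
        have "Suc b * s \<le> D * s" using that by (intro mult_le_mono1) simp
        hence "x < N" using x by (simp add: N_def)
        moreover have "x div s = b" using x by (intro div_nat_eqI) (auto simp: algebra_simps)
        ultimately show "x \<in> {x \<in> {..<N}. x div s = b}" by simp
      qed
      finally show ?thesis by simp
    qed
    have \<beta>: "\<beta> i < D" if "i \<in> {1..N}" for i
    proof -
      have "r i < N" using bij that by (auto simp: bij_betw_def)
      thus ?thesis by (simp add: \<beta>_def N_def less_mult_imp_div_less)
    qed
    have "real (card {f \<in> {1..k} \<rightarrow>\<^sub>E {1..N}. \<not> (inj_on f {1..k} \<and> universal R m k D (\<beta> \<circ> f))})
      \<le> (k\<^sup>2 / (D * s) + (2 * R + 3 * R\<^sup>2) / D + D ^ m * (1 - 1 / D ^ m) ^ M) * real (card {1..N}) ^ k"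
      by (rule card_few_not_universal, simp, erule fib, erule \<beta>, simp add: N_def, rule s, rule D, rule k)
    moreover have "card {f \<in> W. \<not> well_mixed R m k D (\<pi> \<circ> \<rho> f)} \<le>
       card {f \<in> {1..k} \<rightarrow>\<^sub>E {1..N}. \<not> (inj_on f {1..k} \<and> universal R m k D (\<beta> \<circ> f))}"
    proof (rule card_mono)
      have "well_mixed R m k D (\<pi> \<circ> \<rho> f)" if "f \<in> W" "inj_on f {1..k}" "universal R m k D (\<beta> \<circ> f)" for f
        unfolding well_mixed_def
      proof (intro exI[of _ "\<beta> \<circ> f"] conjI ballI impI)
        fix x y assume "x \<in> {1..k}" "y \<in> {1..k}" "(\<beta> \<circ> f) x < (\<beta> \<circ> f) y"
        thus "(\<pi> \<circ> \<rho> f) x < (\<pi> \<circ> \<rho> f) y"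
          using \<rho>[OF that(1)] that(2) mono by simp
      qed (rule that(3))
      thus "{f \<in> W. \<not> well_mixed R m k D (\<pi> \<circ> \<rho> f)} \<subseteq>
        {f \<in> {1..k} \<rightarrow>\<^sub>E {1..N}. \<not> (inj_on f {1..k} \<and> universal R m k D (\<beta> \<circ> f))}"
        unfolding W_def by blast
      have "finite ({1..k} \<rightarrow>\<^sub>E {1..N})" by (intro finite_PiE) auto
      thus "finite {f \<in> {1..k} \<rightarrow>\<^sub>E {1..N}. \<not> (inj_on f {1..k} \<and> universal R m k D (\<beta> \<circ> f))}"
        by (rule rev_finite_subset) blast
    qed
    ultimately show "real (card {f \<in> W. \<not> well_mixed R m k D (\<pi> \<circ> \<rho> f)}) \<le>
       (k\<^sup>2 / (D * s) + (2 * R + 3 * R\<^sup>2) / D + D ^ m * (1 - 1 / D ^ m) ^ M) * real (card W)"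
      by (simp add: W_def card_PiE)
  next
    show "\<kappa> \<ge> 0" by (rule \<kappa>(2))
    fix a b assume "a \<le> b + N\<^sup>2" "b \<le> a + N\<^sup>2"
    thus "q ^ a \<le> \<kappa> * q ^ b" unfolding N_def by (rule \<kappa>(1))
  next
    show "finite W" unfolding W_def by (intro finite_PiE) auto
    show "W \<noteq> {}" using N0 by (simp add: W_def PiE_eq_empty_iff)
    show "N \<le> n" using N by (simp add: N_def)
    show "\<And>w. w \<in> W \<Longrightarrow> \<rho> w permutes {1..N}" using \<rho> by blast
  qed
qed

section \<open>Definable relations\<close>

text \<open>Semantic definability with free variables in \<open>V\<close>. The closure rules below
  let a formula be assembled from the shape of a HOL predicate, so that no formula has to be written
  out. Only genuine permutations and assignments into the domain matter.\<close>

definition dfn :: "nat set \<Rightarrow> (nat \<Rightarrow> (nat \<Rightarrow> nat) \<Rightarrow> (nat \<Rightarrow> nat) \<Rightarrow> bool) \<Rightarrow> bool" where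
  "dfn V P \<longleftrightarrow> (\<exists>\<phi>. free_vars \<phi> \<subseteq> V \<and>
     (\<forall>n \<pi> e. \<pi> permutes {1..n} \<longrightarrow> e ` V \<subseteq> {1..n} \<longrightarrow>
        sat {1..n} (\<lambda>i j. i < j) (\<lambda>i j. \<pi> i < \<pi> j) e \<phi> = P n \<pi> e))"

lemma dfnI:
  assumes "free_vars \<phi> \<subseteq> V"
    and "\<And>n \<pi> e. \<pi> permutes {1..n} \<Longrightarrow> e ` V \<subseteq> {1..n} \<Longrightarrow>
        sat {1..n} (\<lambda>i j. i < j) (\<lambda>i j. \<pi> i < \<pi> j) e \<phi> = P n \<pi> e"
  shows "dfn V P"
  unfolding dfn_def using assms by blast

lemma dfn_cong:
  assumes "dfn V P"
    and "\<And>n \<pi> e. \<pi> permutes {1..n} \<Longrightarrow> e ` V \<subseteq> {1..n} \<Longrightarrow> P n \<pi> e = P' n \<pi> e"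
  shows "dfn V P'"
proof -
  obtain \<phi> where "free_vars \<phi> \<subseteq> V" "\<And>n \<pi> e. \<pi> permutes {1..n} \<Longrightarrow> e ` V \<subseteq> {1..n} \<Longrightarrow>
        sat {1..n} (\<lambda>i j. i < j) (\<lambda>i j. \<pi> i < \<pi> j) e \<phi> = P n \<pi> e"
    using assms(1) unfolding dfn_def by blast
  with assms(2) show ?thesis by (intro dfnI[of \<phi>]) auto
qed

lemma dfn_less: "x \<in> V \<Longrightarrow> y \<in> V \<Longrightarrow> dfn V (\<lambda>n \<pi> e. e x < e y)"
  by (rule dfnI[of "Less1 x y"]) auto

lemma dfn_less_perm: "x \<in> V \<Longrightarrow> y \<in> V \<Longrightarrow> dfn V (\<lambda>n \<pi> e. \<pi> (e x) < \<pi> (e y))"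
  by (rule dfnI[of "Less2 x y"]) auto

lemma dfn_not: "dfn V P \<Longrightarrow> dfn V (\<lambda>n \<pi> e. \<not> P n \<pi> e)"
proof -
  assume "dfn V P"
  then obtain \<phi> where "free_vars \<phi> \<subseteq> V" "\<And>n \<pi> e. \<pi> permutes {1..n} \<Longrightarrow> e ` V \<subseteq> {1..n} \<Longrightarrow>
        sat {1..n} (\<lambda>i j. i < j) (\<lambda>i j. \<pi> i < \<pi> j) e \<phi> = P n \<pi> e"
    unfolding dfn_def by blast
  thus ?thesis by (intro dfnI[of "Neg \<phi>"]) auto
qed

lemma dfn_conj: "dfn V P \<Longrightarrow> dfn V Q \<Longrightarrow> dfn V (\<lambda>n \<pi> e. P n \<pi> e \<and> Q n \<pi> e)"
proof -
  assume "dfn V P" "dfn V Q"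
  then obtain \<phi> \<psi> where "free_vars \<phi> \<subseteq> V" "\<And>n \<pi> e. \<pi> permutes {1..n} \<Longrightarrow> e ` V \<subseteq> {1..n} \<Longrightarrow>
        sat {1..n} (\<lambda>i j. i < j) (\<lambda>i j. \<pi> i < \<pi> j) e \<phi> = P n \<pi> e"
     "free_vars \<psi> \<subseteq> V" "\<And>n \<pi> e. \<pi> permutes {1..n} \<Longrightarrow> e ` V \<subseteq> {1..n} \<Longrightarrow>
        sat {1..n} (\<lambda>i j. i < j) (\<lambda>i j. \<pi> i < \<pi> j) e \<psi> = Q n \<pi> e"
    unfolding dfn_def by blast
  thus ?thesis by (intro dfnI[of "Conj \<phi> \<psi>"]) auto
qed

lemma dfn_disj: "dfn V P \<Longrightarrow> dfn V Q \<Longrightarrow> dfn V (\<lambda>n \<pi> e. P n \<pi> e \<or> Q n \<pi> e)"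
  by (rule dfn_cong[OF dfn_not[OF dfn_conj[OF dfn_not dfn_not]]]) auto

lemma dfn_imp: "dfn V P \<Longrightarrow> dfn V Q \<Longrightarrow> dfn V (\<lambda>n \<pi> e. P n \<pi> e \<longrightarrow> Q n \<pi> e)"
  by (rule dfn_cong[OF dfn_not[OF dfn_conj[OF _ dfn_not]]]) auto

lemma dfn_iff: "dfn V P \<Longrightarrow> dfn V Q \<Longrightarrow> dfn V (\<lambda>n \<pi> e. P n \<pi> e \<longleftrightarrow> Q n \<pi> e)"
  by (rule dfn_cong[OF dfn_conj[OF dfn_imp[of V P Q] dfn_imp[of V Q P]]]) auto

lemma dfn_le: "x \<in> V \<Longrightarrow> y \<in> V \<Longrightarrow> dfn V (\<lambda>n \<pi> e. e x \<le> e y)"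
  by (rule dfn_cong[OF dfn_not[OF dfn_less[of y V x]]]) auto

text \<open>The bound variable is a fresh \<open>x\<close> outside \<open>V\<close>, whose value in
  \<open>e\<close> gets overwritten; the last assumption ensures that the predicate does not notice
  this.\<close>

lemma dfn_ex:
  assumes "finite V" "\<And>x. x \<notin> V \<Longrightarrow> dfn (insert x V) (\<lambda>n \<pi> e. P n \<pi> e (e x))"
    and "\<And>n \<pi> e e' a. (\<And>v. v \<in> V \<Longrightarrow> e v = e' v) \<Longrightarrow> P n \<pi> e a = P n \<pi> e' a"
  shows "dfn V (\<lambda>n \<pi> e. \<exists>a\<in>{1..n}. P n \<pi> e a)"
proof -
  obtain x where x: "x \<notin> V"
    using assms(1) ex_new_if_finite infinite_UNIV_nat by blast
  from assms(2)[OF this] obtain \<phi> where \<phi>: "free_vars \<phi> \<subseteq> insert x V"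
    "\<And>n \<pi> e. \<pi> permutes {1..n} \<Longrightarrow> e ` insert x V \<subseteq> {1..n} \<Longrightarrow>
        sat {1..n} (\<lambda>i j. i < j) (\<lambda>i j. \<pi> i < \<pi> j) e \<phi> = P n \<pi> e (e x)"
    unfolding dfn_def by blast
  show ?thesis
  proof (rule dfnI[of "Exists x \<phi>"])
    fix n and \<pi> e :: "nat \<Rightarrow> nat" assume 1: "\<pi> permutes {1..n}" "e ` V \<subseteq> {1..n}"
    have "sat {1..n} (\<lambda>i j. i < j) (\<lambda>i j. \<pi> i < \<pi> j) (e(x := a)) \<phi> = P n \<pi> e a" if "a \<in> {1..n}" for a
    proof -
      have "sat {1..n} (\<lambda>i j. i < j) (\<lambda>i j. \<pi> i < \<pi> j) (e(x := a)) \<phi> = P n \<pi> (e(x := a)) ((e(x := a)) x)"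
        using 1 that x by (intro \<phi>(2)) auto
      also have "\<dots> = P n \<pi> e a"
        unfolding fun_upd_same using x by (intro assms(3)) auto
      finally show ?thesis .
    qed
    thus "sat {1..n} (\<lambda>i j. i < j) (\<lambda>i j. \<pi> i < \<pi> j) e (Exists x \<phi>) = (\<exists>a\<in>{1..n}. P n \<pi> e a)"
      by auto
  qed (use \<phi>(1) in auto)
qed

lemma dfn_all:
  assumes "finite V" "\<And>x. x \<notin> V \<Longrightarrow> dfn (insert x V) (\<lambda>n \<pi> e. P n \<pi> e (e x))"
    and "\<And>n \<pi> e e' a. (\<And>v. v \<in> V \<Longrightarrow> e v = e' v) \<Longrightarrow> P n \<pi> e a = P n \<pi> e' a"
  shows "dfn V (\<lambda>n \<pi> e. \<forall>a\<in>{1..n}. P n \<pi> e a)"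
proof -
  have "dfn V (\<lambda>n \<pi> e. \<not> (\<exists>a\<in>{1..n}. \<not> P n \<pi> e a))"
    by (rule dfn_not, rule dfn_ex[OF assms(1)], rule dfn_not, erule assms(2),
        rule arg_cong[where f = Not], erule assms(3))
  thus ?thesis by simp
qed

lemma dfn_sentence:
  assumes "dfn {} P"
  shows "\<exists>\<phi>. sentence \<phi> \<and> (\<forall>n \<pi> e. \<pi> permutes {1..n} \<longrightarrow> perm_models n \<pi> \<phi> = P n \<pi> e)"
proof -
  obtain \<phi> where \<phi>: "free_vars \<phi> \<subseteq> {}" "\<And>n \<pi> e. \<pi> permutes {1..n} \<Longrightarrow> e ` {} \<subseteq> {1..n} \<Longrightarrow>
        sat {1..n} (\<lambda>i j. i < j) (\<lambda>i j. \<pi> i < \<pi> j) e \<phi> = P n \<pi> e"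
    using assms unfolding dfn_def by blast
  hence "sentence \<phi>" by (simp add: sentence_def)
  with \<phi>(2) perm_models_iff[OF this] show ?thesis
    by (intro exI[of _ \<phi>]) auto
qed

subsection \<open>Definable arithmetic\<close>

lemma dfn_Suc:
  assumes "finite V" "x \<in> V" "y \<in> V"
  shows "dfn V (\<lambda>n \<pi> e. e y = Suc (e x))"
proof -
  have "dfn V (\<lambda>n \<pi> e. e x < e y \<and> \<not> (\<exists>z\<in>{1..n}. e x < z \<and> z < e y))"
    using assms by (intro dfn_conj dfn_not dfn_ex dfn_less) auto
  thus ?thesis
  proof (rule dfn_cong)
    fix n \<pi> and e :: "nat \<Rightarrow> nat" assume "e ` V \<subseteq> {1..n}"
    hence xy: "e x \<in> {1..n}" "e y \<in> {1..n}" using assms by auto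
    have "\<exists>z\<in>{1..n}. e x < z \<and> z < e y" if "Suc (e x) < e y"
      using that xy by (intro bexI[of _ "Suc (e x)"]) auto
    thus "(e x < e y \<and> \<not> (\<exists>z\<in>{1..n}. e x < z \<and> z < e y)) = (e y = Suc (e x))"
      by (cases "Suc (e x) < e y") auto
  qed
qed

lemma dfn_one:
  assumes "finite V" "x \<in> V"
  shows "dfn V (\<lambda>n \<pi> e. e x = 1)"
proof -
  have "dfn V (\<lambda>n \<pi> e. \<not> (\<exists>z\<in>{1..n}. z < e x))"
    using assms by (intro dfn_conj dfn_not dfn_ex dfn_less) auto
  thus ?thesis
  proof (rule dfn_cong)
    fix n \<pi> and e :: "nat \<Rightarrow> nat" assume "e ` V \<subseteq> {1..n}"
    hence "e x \<in> {1..n}" using assms by auto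
    thus "(\<not> (\<exists>z\<in>{1..n}. z < e x)) = (e x = 1)"
      by (cases "e x = 1") (auto intro!: bexI[of _ "Suc 0"])
  qed
qed

lemma dfn_add2:
  assumes "finite V" "x \<in> V" "y \<in> V"
  shows "dfn V (\<lambda>n \<pi> e. e y = e x + 2)"
proof -
  have "dfn V (\<lambda>n \<pi> e. \<exists>z\<in>{1..n}. z = Suc (e x) \<and> e y = Suc z)"
    using assms by (intro dfn_ex dfn_conj dfn_Suc) auto
  thus ?thesis
    by (rule dfn_cong) (use assms in \<open>auto simp: image_subset_iff\<close>)
qed

lemma dfn_two:
  assumes "finite V" "x \<in> V"
  shows "dfn V (\<lambda>n \<pi> e. e x = 2)"
proof -
  have "dfn V (\<lambda>n \<pi> e. \<exists>z\<in>{1..n}. z = 1 \<and> e x = Suc z)"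
    using assms by (intro dfn_ex dfn_conj dfn_Suc dfn_one) auto
  thus ?thesis
    by (rule dfn_cong) (use assms in \<open>auto simp: image_subset_iff\<close>)
qed

subsection \<open>Relations coded by intervals\<close>

text \<open>The letters of the code: a later position \<open>x\<close> spells \<open>a\<close> if
  the value at \<open>a\<close> is the next one above that of \<open>x\<close> among the values at
  \<open>1, ..., r\<close>. A value above all of these spells no letter and serves as a
  blank.\<close>

definition gap :: "nat \<Rightarrow> (nat \<Rightarrow> nat) \<Rightarrow> nat \<Rightarrow> nat \<Rightarrow> nat \<Rightarrow> bool" where
  "gap n \<pi> r x a \<longleftrightarrow> r < x \<and> a \<le> r \<and> \<pi> x < \<pi> a \<and> \<not> (\<exists>c\<in>{1..n}. c \<le> r \<and> \<pi> x < \<pi> c \<and> \<pi> c < \<pi> a)"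

text \<open>An interval of positions is a pair of first-order variables, yet through its adjacent
  letters it stands for a whole binary relation; this simulates second-order quantification over
  \<open>{1..r}\<close>.\<close>

definition coded :: "nat \<Rightarrow> (nat \<Rightarrow> nat) \<Rightarrow> nat \<Rightarrow> nat \<Rightarrow> nat \<Rightarrow> nat \<Rightarrow> nat \<Rightarrow> bool" where
  "coded n \<pi> r u v a b \<longleftrightarrow>
     (\<exists>x\<in>{1..n}. \<exists>y\<in>{1..n}. y = Suc x \<and> u \<le> x \<and> y \<le> v \<and> gap n \<pi> r x a \<and> gap n \<pi> r y b)"

text \<open>The recursion \<open>f 1 = 2\<close>, \<open>f (a + 1) = h (f a)\<close> expressed for
  graphs, with \<open>R\<close> the graph of \<open>h\<close> and \<open>R'\<close> that of
  \<open>f\<close>, both truncated at \<open>r\<close>.\<close>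

definition rec_step :: "nat \<Rightarrow> nat \<Rightarrow> (nat \<Rightarrow> nat \<Rightarrow> bool) \<Rightarrow> (nat \<Rightarrow> nat \<Rightarrow> bool) \<Rightarrow> bool" where
  "rec_step n r R R' \<longleftrightarrow> (\<forall>a\<in>{1..n}. \<forall>b\<in>{1..n}. a \<le> r \<longrightarrow> b \<le> r \<longrightarrow>
     (R' a b \<longleftrightarrow> (a = 1 \<and> b = 2) \<or>
        (\<exists>a'\<in>{1..n}. \<exists>b'\<in>{1..n}. b' \<le> r \<and> a = Suc a' \<and> R' a' b' \<and> R b' b)))"

primrec tower_code :: "nat \<Rightarrow> nat \<Rightarrow> (nat \<Rightarrow> nat) \<Rightarrow> nat \<Rightarrow> nat \<Rightarrow> nat \<Rightarrow> bool" where
  "tower_code 0 n \<pi> r u v \<longleftrightarrow> rec_step n r (\<lambda>a b. b = a + 2) (coded n \<pi> r u v)"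
| "tower_code (Suc i) n \<pi> r u v \<longleftrightarrow>
     (\<exists>u'\<in>{1..n}. \<exists>v'\<in>{1..n}. tower_code i n \<pi> r u' v' \<and> rec_step n r (coded n \<pi> r u' v') (coded n \<pi> r u v))"

text \<open>\<open>tower_code 4\<close> codes the graph of \<open>hyp 5\<close>, so \<open>j\<close>
  is the largest argument with \<open>hyp 5 j \<le> r\<close>; \<open>tower_code 0\<close> codes
  doubling, so the last line says that \<open>j\<close> is even.\<close>

definition even_level :: "nat \<Rightarrow> (nat \<Rightarrow> nat) \<Rightarrow> nat \<Rightarrow> bool" where
  "even_level n \<pi> r \<longleftrightarrow>
     (\<exists>u\<in>{1..n}. \<exists>v\<in>{1..n}. \<exists>u'\<in>{1..n}. \<exists>v'\<in>{1..n}. tower_code 4 n \<pi> r u v \<and> tower_code 0 n \<pi> r u' v' \<and>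
        (\<exists>j\<in>{1..n}. j \<le> r \<and> (\<exists>b\<in>{1..n}. b \<le> r \<and> coded n \<pi> r u v j b) \<and>
          \<not> (\<exists>j'\<in>{1..n}. j' \<le> r \<and> j < j' \<and> (\<exists>b\<in>{1..n}. b \<le> r \<and> coded n \<pi> r u v j' b)) \<and>
          (\<exists>x\<in>{1..n}. x \<le> r \<and> coded n \<pi> r u' v' x j)))"

text \<open>Beyond the guaranteed range nothing is known about which \<open>r\<close> admit codes.
  The sentence therefore accepts any \<open>r\<close> after which coding stops, either by lack of a
  code or because \<open>r = n\<close>.\<close>

definition oscillating :: "nat \<Rightarrow> (nat \<Rightarrow> nat) \<Rightarrow> bool" where
  "oscillating n \<pi> \<longleftrightarrow> (\<exists>r\<in>{1..n}. even_level n \<pi> r \<and>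
     \<not> (\<exists>r'\<in>{1..n}. r' = Suc r \<and> (\<exists>u\<in>{1..n}. \<exists>v\<in>{1..n}. tower_code 4 n \<pi> r' u v)))"

lemma dfn_gap:
  assumes "finite V" "r \<in> V" "x \<in> V" "a \<in> V"
  shows "dfn V (\<lambda>n \<pi> e. gap n \<pi> (e r) (e x) (e a))"
  unfolding gap_def using assms by (intro dfn_ex dfn_conj dfn_not dfn_less dfn_less_perm dfn_le) auto

lemma dfn_coded:
  assumes "finite V" "r \<in> V" "u \<in> V" "v \<in> V" "a \<in> V" "b \<in> V"
  shows "dfn V (\<lambda>n \<pi> e. coded n \<pi> (e r) (e u) (e v) (e a) (e b))"
  unfolding coded_def using assms by (intro dfn_ex dfn_conj dfn_gap dfn_Suc dfn_le) auto

lemma dfn_rec_step_base: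
  assumes "finite V" "r \<in> V" "u \<in> V" "v \<in> V"
  shows "dfn V (\<lambda>n \<pi> e. rec_step n (e r) (\<lambda>a b. b = a + 2) (coded n \<pi> (e r) (e u) (e v)))"
  unfolding rec_step_def using assms
  by (intro dfn_all dfn_imp dfn_iff dfn_disj dfn_conj dfn_ex dfn_le dfn_Suc dfn_one dfn_two
      dfn_add2 dfn_coded) simp_all

lemma dfn_rec_step:
  assumes "finite V" "r \<in> V" "u \<in> V" "v \<in> V" "u' \<in> V" "v' \<in> V"
  shows "dfn V (\<lambda>n \<pi> e. rec_step n (e r) (coded n \<pi> (e r) (e u') (e v')) (coded n \<pi> (e r) (e u) (e v)))"
  unfolding rec_step_def using assms
  by (intro dfn_all dfn_imp dfn_iff dfn_disj dfn_conj dfn_ex dfn_le dfn_Suc dfn_one dfn_two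
      dfn_coded) simp_all

lemma dfn_tower_code:
  assumes "finite V" "r \<in> V" "u \<in> V" "v \<in> V"
  shows "dfn V (\<lambda>n \<pi> e. tower_code i n \<pi> (e r) (e u) (e v))"
  using assms
proof (induction i arbitrary: V u v)
  case 0
  show ?case
    unfolding tower_code.simps by (rule dfn_rec_step_base[OF 0])
next
  case (Suc i)
  show ?case
    unfolding tower_code.simps
    by (intro dfn_ex dfn_conj Suc.IH dfn_rec_step) (use Suc.prems in simp_all)
qed

lemma dfn_even_level:
  assumes "finite V" "r \<in> V"
  shows "dfn V (\<lambda>n \<pi> e. even_level n \<pi> (e r))"
  unfolding even_level_def
  by (intro dfn_ex dfn_conj dfn_not dfn_le dfn_less dfn_coded dfn_tower_code) (use assms in simp_all)

lemma oscillating_sentence: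
  "\<exists>\<phi>. sentence \<phi> \<and> (\<forall>n \<pi>. \<pi> permutes {1..n} \<longrightarrow> perm_models n \<pi> \<phi> = oscillating n \<pi>)"
proof -
  have "dfn {} (\<lambda>n \<pi> e. oscillating n \<pi>)"
    unfolding oscillating_def
    by (intro dfn_ex dfn_conj dfn_not dfn_Suc dfn_tower_code dfn_even_level) simp_all
  from dfn_sentence[OF this] show ?thesis by blast
qed

subsection \<open>A hierarchy of fast-growing functions\<close>

text \<open>A hyperoperation hierarchy with base 2: after \<open>x + 2\<close> come doubling,
  \<open>2 ^ x\<close>, the tower function, and two further iterates. Arguments start at 1, as
  positions do, with \<open>hyp (Suc i) 1 = 2\<close>.\<close>

primrec hyp :: "nat \<Rightarrow> nat \<Rightarrow> nat" where
  "hyp 0 = (\<lambda>x. x + 2)"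
| "hyp (Suc i) = (\<lambda>x. (hyp i ^^ (x - 1)) 2)"

declare hyp.simps(2) [simp del]

lemma hyp_one [simp]: "hyp (Suc i) (Suc 0) = 2"
  by (simp add: hyp.simps)

lemma hyp_Suc: "x \<ge> 1 \<Longrightarrow> hyp (Suc i) (Suc x) = hyp i (hyp (Suc i) x)"
  by (cases x) (simp_all add: hyp.simps)

lemma hyp_gt: "x \<ge> 1 \<Longrightarrow> x < hyp i x"
proof (induction i arbitrary: x)
  case (Suc i)
  show ?case using Suc.prems
  proof (induction x rule: dec_induct)
    case (step x)
    have "hyp (Suc i) x < hyp i (hyp (Suc i) x)"
      using step by (intro Suc.IH) simp
    with step show ?case by (simp add: hyp_Suc)
  qed simp
qed simp


lemma hyp_less:
  assumes "1 \<le> x" "x < y"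
  shows "hyp (Suc i) x < hyp (Suc i) y"
proof -
  have step: "hyp (Suc i) z < hyp (Suc i) (Suc z)" if "1 \<le> z" for z
  proof -
    have "1 \<le> hyp (Suc i) z" using hyp_gt[OF that, of "Suc i"] by simp
    thus ?thesis using that by (simp add: hyp_Suc hyp_gt)
  qed
  from assms(2) have "Suc x \<le> y" by simp
  thus ?thesis
  proof (induction y rule: dec_induct)
    case base
    show ?case by (rule step[OF assms(1)])
  next
    case (step y)
    thus ?case using \<open>\<And>z. 1 \<le> z \<Longrightarrow> hyp (Suc i) z < hyp (Suc i) (Suc z)\<close>[of y] assms(1) by simp
  qed
qed

lemma hyp_1: "x \<ge> 1 \<Longrightarrow> hyp 1 x = 2 * x"
  by (induction x rule: dec_induct) (simp_all add: hyp_Suc)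

lemma hyp_2: "x \<ge> 1 \<Longrightarrow> hyp 2 x = 2 ^ x"
  by (induction x rule: dec_induct) (simp_all add: hyp_Suc numeral_2_eq_2 hyp_1[unfolded One_nat_def])

lemma hyp_3: "x \<ge> 1 \<Longrightarrow> hyp 3 x = tower x"
proof (induction x rule: dec_induct)
  case (step x)
  have "tower x \<ge> 1" using le_tower[of x] step by simp
  moreover have "hyp 3 (Suc x) = hyp 2 (hyp 3 x)"
    using hyp_Suc[of x 2] step by simp
  ultimately show ?case using step by (simp add: hyp_2)
qed (simp add: numeral_3_eq_3)

text \<open>The recursion determines the relation by induction on the argument. Truncation at
  \<open>r\<close> loses nothing: the functions are strictly increasing along the recursion, so a
  value up to \<open>r\<close> has all intermediate values up to \<open>r\<close> as well.\<close>

lemma rec_step_graph: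
  assumes r: "r \<le> n" and R: "\<And>a b. a \<in> {1..r} \<Longrightarrow> b \<in> {1..r} \<Longrightarrow> R a b \<longleftrightarrow> b = hyp i a"
  shows "rec_step n r R R' \<longleftrightarrow> (\<forall>a\<in>{1..r}. \<forall>b\<in>{1..r}. R' a b \<longleftrightarrow> b = hyp (Suc i) a)"
proof -
  have key: "(\<exists>b'\<in>{1..n}. b' \<le> r \<and> b' = hyp (Suc i) a \<and> R b' b) \<longleftrightarrow> b = hyp (Suc i) (Suc a)"
    if "a \<ge> 1" "b \<in> {1..r}" for a b
  proof
    assume "\<exists>b'\<in>{1..n}. b' \<le> r \<and> b' = hyp (Suc i) a \<and> R b' b"
    thus "b = hyp (Suc i) (Suc a)"
      using R that by (auto simp: hyp_Suc)
  next
    assume b: "b = hyp (Suc i) (Suc a)"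
    have "1 \<le> hyp (Suc i) a" using hyp_gt[of a "Suc i"] that by simp
    moreover from this have "hyp (Suc i) a < b"
      unfolding b using that by (simp add: hyp_Suc hyp_gt)
    ultimately show "\<exists>b'\<in>{1..n}. b' \<le> r \<and> b' = hyp (Suc i) a \<and> R b' b"
      using that r b by (auto simp: R hyp_Suc)
  qed
  show ?thesis
  proof
    assume *: "rec_step n r R R'"
    have "\<forall>b\<in>{1..r}. R' a b \<longleftrightarrow> b = hyp (Suc i) a" if "1 \<le> a" "a \<le> r" for a
      using that
    proof (induction a rule: dec_induct)
      case base
      show ?case
      proof
        fix b assume b: "b \<in> {1..r}"
        hence "R' 1 b \<longleftrightarrow> b = 2"
          using *[unfolded rec_step_def, rule_format, of 1 b] r base by auto
        thus "R' 1 b \<longleftrightarrow> b = hyp (Suc i) 1" by simp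
      qed
    next
      case (step a)
      show ?case
      proof
        fix b assume b: "b \<in> {1..r}"
        have "R' (Suc a) b \<longleftrightarrow> (\<exists>b'\<in>{1..n}. b' \<le> r \<and> R' a b' \<and> R b' b)"
          using *[unfolded rec_step_def, rule_format, of "Suc a" b] r step b by auto
        also have "\<dots> \<longleftrightarrow> (\<exists>b'\<in>{1..n}. b' \<le> r \<and> b' = hyp (Suc i) a \<and> R b' b)"
          using step by (intro bex_cong) auto
        finally show "R' (Suc a) b \<longleftrightarrow> b = hyp (Suc i) (Suc a)"
          using key[of a b] step b by simp
      qed
    qed
    thus "\<forall>a\<in>{1..r}. \<forall>b\<in>{1..r}. R' a b \<longleftrightarrow> b = hyp (Suc i) a" by auto
  next
    assume *: "\<forall>a\<in>{1..r}. \<forall>b\<in>{1..r}. R' a b \<longleftrightarrow> b = hyp (Suc i) a"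
    show "rec_step n r R R'"
      unfolding rec_step_def
    proof (intro ballI impI)
      fix a b assume ab: "a \<in> {1..n}" "b \<in> {1..n}" "a \<le> r" "b \<le> r"
      show "R' a b \<longleftrightarrow> (a = 1 \<and> b = 2) \<or>
        (\<exists>a'\<in>{1..n}. \<exists>b'\<in>{1..n}. b' \<le> r \<and> a = Suc a' \<and> R' a' b' \<and> R b' b)"
      proof (cases "a = 1")
        case True
        thus ?thesis using * ab by auto
      next
        case False
        then obtain a' where a: "a = Suc a'" "a' \<ge> 1"
          using ab by (cases a) auto
        have "(\<exists>b'\<in>{1..n}. b' \<le> r \<and> R' a' b' \<and> R b' b) \<longleftrightarrow>
              (\<exists>b'\<in>{1..n}. b' \<le> r \<and> b' = hyp (Suc i) a' \<and> R b' b)"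
          using * ab a by (intro bex_cong) auto
        also have "\<dots> \<longleftrightarrow> b = hyp (Suc i) a"
          using key[of a' b] ab a by simp
        also have "\<dots> \<longleftrightarrow> R' a b" using * ab by auto
        finally show ?thesis using a ab by auto
      qed
    qed
  qed
qed

lemma tower_code_iff:
  assumes "tower_code i n \<pi> r u v" "r \<le> n" "a \<in> {1..r}" "b \<in> {1..r}"
  shows "coded n \<pi> r u v a b \<longleftrightarrow> b = hyp (Suc i) a"
  using assms
proof (induction i arbitrary: u v a b)
  case 0
  thus ?case using rec_step_graph[of r n "\<lambda>a b. b = a + 2" 0 "coded n \<pi> r u v"] by simp
next
  case (Suc i)
  then obtain u' v' where *: "tower_code i n \<pi> r u' v'"
    "rec_step n r (coded n \<pi> r u' v') (coded n \<pi> r u v)" by auto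
  have "\<forall>a\<in>{1..r}. \<forall>b\<in>{1..r}. coded n \<pi> r u v a b \<longleftrightarrow> b = hyp (Suc (Suc i)) a"
    using *(2) by (subst (asm) rec_step_graph) (use Suc.IH[OF *(1)] Suc.prems in auto)
  thus ?case using Suc.prems by blast
qed

section \<open>Existence of codes and the meaning of the sentence\<close>

lemma tower_code_0:
  assumes "tower_code i n \<pi> r u v" "u \<in> {1..n}" "v \<in> {1..n}"
  shows "\<exists>u\<in>{1..n}. \<exists>v\<in>{1..n}. tower_code 0 n \<pi> r u v"
  using assms by (induction i arbitrary: u v) fastforce+

text \<open>The word consists of triples \<open>a\<close>, \<open>f a\<close>, blank. A letter
  \<open>c\<close> is realised by the bucket \<open>g c - 1\<close>, directly below the marker
  \<open>c\<close> and away from the others, and the blank by the top bucket \<open>D - 1\<close>.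
  Universality supplies an interval that spells this word.\<close>

lemma coded_exists:
  assumes mix: "well_mixed R (3 * R) k D \<pi>" and k: "k \<le> n" and r: "1 \<le> r" "r \<le> R"
  shows "\<exists>u\<in>{1..n}. \<exists>v\<in>{1..n}. \<forall>a\<in>{1..r}. \<forall>b\<in>{1..r}. coded n \<pi> r u v a b \<longleftrightarrow> b = f a"
proof -
  obtain g where g: "\<And>x y. x \<in> {1..k} \<Longrightarrow> y \<in> {1..k} \<Longrightarrow> g x < g y \<Longrightarrow> \<pi> x < \<pi> y"
    "universal R (3 * R) k D g"
    using mix unfolding well_mixed_def by blast
  have g1: "g i \<ge> 1 \<and> g i + 2 \<le> D" if "i \<in> {1..R}" for i
    using g(2) that by (auto simp: universal_def)
  have g2: "g i + 2 \<le> g j \<or> g j + 2 \<le> g i" if "i \<in> {1..R}" "j \<in> {1..R}" "i \<noteq> j" for i j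
    using g(2) that by (auto simp: universal_def)
  \<comment> \<open>\<open>None\<close> is the blank. The whole triple is blank when
    \<open>f a\<close> exceeds \<open>r\<close>, because such a value has no letter.\<close>
  define L where "L t = (let a = t div 3 + 1 in if a \<in> {1..r} \<and> f a \<in> {1..r} then
       (if t mod 3 = 0 then Some a else if t mod 3 = 1 then Some (f a) else None) else None)" for t
  define w where "w = (\<lambda>t\<in>{..<3 * R}. case L t of Some a \<Rightarrow> g a - 1 | None \<Rightarrow> D - 1)"
  have Lr: "c \<in> {1..r}" if "L t = Some c" for t c
    using that by (auto simp: L_def Let_def split: if_splits)
  have D: "D > 0" using g1[of 1] r by auto
  have gD: "g c - 1 < D" if "c \<in> {1..r}" for c using g1[of c] r that by auto
  have "w \<in> {..<3 * R} \<rightarrow>\<^sub>E {..<D}"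
    unfolding w_def using D gD Lr by (intro restrict_PiE_iff[THEN iffD2] ballI) (simp split: option.splits)
  then obtain s where s: "s \<ge> R" "s + 3 * R \<le> k" "\<And>t. t < 3 * R \<Longrightarrow> g (s + t + 1) = w t"
    using g(2) unfolding universal_def by blast
  have Rk: "c \<in> {1..k}" "c \<in> {1..R}" "c \<in> {1..n}" if "c \<in> {1..r}" for c
    using that r s k by auto
  have gap: "gap n \<pi> r (s + t + 1) a \<longleftrightarrow> L t = Some a" if t: "t < 3 * R" and a: "a \<in> {1..r}" for t a
  proof -
    define x where "x = s + t + 1"
    have x: "x \<in> {1..k}" "r < x" using s t r by (auto simp: x_def)
    have gx: "g x = (case L t of Some a \<Rightarrow> g a - 1 | None \<Rightarrow> D - 1)"
      using s(3)[OF t] t by (simp add: x_def w_def)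
    show ?thesis
    proof (cases "L t")
      case None
      hence "g a < g x" using gx g1[of a] Rk[OF a] by auto
      hence "\<pi> a < \<pi> x" using g(1) x Rk[OF a] by blast
      thus ?thesis using None by (simp add: gap_def x_def)
    next
      case (Some c)
      hence c: "c \<in> {1..r}" by (rule Lr)
      have gx: "g x = g c - 1" using gx Some by simp
      have xc: "\<pi> x < \<pi> c"
        using g(1)[of x c] g1[of c] gx x Rk[OF c] by auto
      show ?thesis
      proof (cases "a = c")
        case True
        have "\<not> (\<pi> x < \<pi> d \<and> \<pi> d < \<pi> c)" if d: "d \<in> {1..n}" "d \<le> r" for d
        proof (cases "d = c")
          case False
          have dr: "d \<in> {1..r}" using d by simp
          from g2[of d c] Rk[OF dr] Rk[OF c] False gx have "g d < g x \<or> g c < g d" by auto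
          hence "\<pi> d < \<pi> x \<or> \<pi> c < \<pi> d" using g(1) x Rk[OF dr] Rk[OF c] by blast
          thus ?thesis by auto
        qed auto
        thus ?thesis using True x c xc Some by (auto simp: gap_def x_def)
      next
        case False
        from g2[of a c] Rk[OF a] Rk[OF c] False gx have "g a < g x \<or> g c < g a" by auto
        hence "\<pi> a < \<pi> x \<or> \<pi> c < \<pi> a" using g(1) x Rk[OF a] Rk[OF c] by blast
        hence "\<not> gap n \<pi> r x a"
          using xc Rk(3)[OF c] c by (auto simp: gap_def)
        thus ?thesis using False Some by (simp add: x_def)
      qed
    qed
  qed
  have "coded n \<pi> r (s + 1) (s + 3 * R) a b \<longleftrightarrow> b = f a" if a: "a \<in> {1..r}" and b: "b \<in> {1..r}" for a b
  proof
    assume "coded n \<pi> r (s + 1) (s + 3 * R) a b"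
    then obtain x where x: "s + 1 \<le> x" "Suc x \<le> s + 3 * R" "gap n \<pi> r x a" "gap n \<pi> r (Suc x) b"
      by (auto simp: coded_def)
    define t where "t = x - s - 1"
    have xt: "x = s + t + 1" "Suc x = s + Suc t + 1" "t < 3 * R" "Suc t < 3 * R"
      using x by (auto simp: t_def)
    have L: "L t = Some a" "L (Suc t) = Some b"
      using gap[OF xt(3) a] gap[OF xt(4) b] x xt by simp_all
    \<comment> \<open>Only offset 0 of a triple can begin a coded pair: offset 1 is followed by a
      blank and offset 2 is a blank.\<close>
    have "t mod 3 = 0 \<or> t mod 3 = 1 \<or> t mod 3 = 2" by linarith
    thus "b = f a"
    proof (elim disjE)
      assume t: "t mod 3 = 0"
      hence "Suc t mod 3 = 1" "Suc t div 3 = t div 3" by presburger+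
      thus ?thesis using L t by (auto simp: L_def Let_def split: if_splits)
    next
      assume t: "t mod 3 = 1"
      hence "Suc t mod 3 = 2" by presburger
      thus ?thesis using L by (auto simp: L_def Let_def split: if_splits)
    next
      assume t: "t mod 3 = 2"
      thus ?thesis using L by (auto simp: L_def Let_def split: if_splits)
    qed
  next
    assume "b = f a"
    define t where "t = 3 * (a - 1)"
    have t: "t < 3 * R" "Suc t < 3 * R" using a r by (auto simp: t_def)
    have "t mod 3 = 0" "Suc t mod 3 = 1" "t div 3 + 1 = a" "Suc t div 3 + 1 = a"
      using a by (auto simp: t_def)
    hence "L t = Some a" "L (Suc t) = Some b"
      using a b \<open>b = f a\<close> by (simp_all add: L_def)
    hence "gap n \<pi> r (s + t + 1) a" "gap n \<pi> r (s + Suc t + 1) b"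
      using gap t a b by blast+
    thus "coded n \<pi> r (s + 1) (s + 3 * R) a b"
      unfolding coded_def using t s k
      by (intro bexI[of _ "s + t + 1"] bexI[of _ "s + Suc t + 1"]) auto
  qed
  thus ?thesis
    using s k r by (intro bexI[of _ "s + 1"] bexI[of _ "s + 3 * R"]) auto
qed

lemma tower_code_exists:
  assumes mix: "well_mixed R (3 * R) k D \<pi>" and k: "k \<le> n" and r: "1 \<le> r" "r \<le> R" "r \<le> n"
  shows "\<exists>u\<in>{1..n}. \<exists>v\<in>{1..n}. tower_code i n \<pi> r u v"
proof (induction i)
  case 0
  obtain u v where "u \<in> {1..n}" "v \<in> {1..n}"
    "\<forall>a\<in>{1..r}. \<forall>b\<in>{1..r}. coded n \<pi> r u v a b \<longleftrightarrow> b = hyp (Suc 0) a"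
    using coded_exists[OF mix k r(1,2), of "hyp (Suc 0)"] by blast
  moreover from this have "tower_code 0 n \<pi> r u v"
    using rec_step_graph[of r n "\<lambda>a b. b = a + 2" 0 "coded n \<pi> r u v"] r by simp
  ultimately show ?case by blast
next
  case (Suc i)
  then obtain u' v' where *: "u' \<in> {1..n}" "v' \<in> {1..n}" "tower_code i n \<pi> r u' v'" by blast
  obtain u v where uv: "u \<in> {1..n}" "v \<in> {1..n}"
    "\<forall>a\<in>{1..r}. \<forall>b\<in>{1..r}. coded n \<pi> r u v a b \<longleftrightarrow> b = hyp (Suc (Suc i)) a"
    using coded_exists[OF mix k r(1,2), of "hyp (Suc (Suc i))"] by blast
  have "rec_step n r (coded n \<pi> r u' v') (coded n \<pi> r u v)"
    using uv(3) tower_code_iff[OF *(3) r(3)] r(3) by (subst rec_step_graph) auto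
  hence "tower_code (Suc i) n \<pi> r u v"
    unfolding tower_code.simps using * by blast
  thus ?case using uv by blast
qed

text \<open>All \<open>r\<close> between \<open>R\<close> and \<open>n\<close> have the same level
  \<open>j\<close>, since \<open>hyp 5 j \<le> R\<close> and \<open>n < hyp 5 (Suc j)\<close>. Thus
  it does not matter where coding stops, as long as this happens at \<open>R\<close> or
  later.\<close>

lemma oscillating_iff:
  assumes mix: "well_mixed R (3 * R) k D \<pi>" and k: "k \<le> n" "R \<le> n" and R: "1 \<le> R"
    and j: "1 \<le> j" "hyp 5 j \<le> R" "n < hyp 5 (Suc j)"
  shows "oscillating n \<pi> \<longleftrightarrow> even j"
proof -
  define cod where "cod r \<longleftrightarrow> (\<exists>u\<in>{1..n}. \<exists>v\<in>{1..n}. tower_code 4 n \<pi> r u v)" for r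
  have cod: "cod r" if "1 \<le> r" "r \<le> R" for r
    unfolding cod_def using that k by (intro tower_code_exists[OF mix]) auto
  have hyp5: "hyp 5 x \<le> r \<longleftrightarrow> x \<le> j" if "R \<le> r" "r \<le> n" "1 \<le> x" for x r
  proof
    assume "hyp 5 x \<le> r"
    hence "hyp 5 x < hyp 5 (Suc j)" using that j by simp
    thus "x \<le> j" using hyp_less[of "Suc j" x 4] by (cases "x > Suc j"; cases "x = Suc j") auto
  next
    assume "x \<le> j"
    hence "hyp 5 x \<le> hyp 5 j" using hyp_less[of x j 4] that by (cases "x = j") auto
    thus "hyp 5 x \<le> r" using that j by simp
  qed
  have top: "(i \<le> r \<and> (\<exists>b\<in>{1..n}. b \<le> r \<and> coded n \<pi> r u v i b)) \<longleftrightarrow> i \<le> j"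
    if "R \<le> r" "r \<le> n" "tower_code 4 n \<pi> r u v" "1 \<le> i" for r u v i
  proof -
    have "i < hyp 5 i" using that by (intro hyp_gt)
    moreover have "coded n \<pi> r u v i b \<longleftrightarrow> b = hyp 5 i" if "i \<le> r" "b \<in> {1..n}" "b \<le> r" for b
      using tower_code_iff[OF \<open>tower_code 4 n \<pi> r u v\<close>, of i b] that \<open>1 \<le> i\<close> \<open>r \<le> n\<close> by simp
    ultimately have "(i \<le> r \<and> (\<exists>b\<in>{1..n}. b \<le> r \<and> coded n \<pi> r u v i b)) \<longleftrightarrow> hyp 5 i \<le> r"
      using that by (auto intro!: bexI[of _ "hyp 5 i"])
    with hyp5[OF that(1,2,4)] show ?thesis by simp
  qed
  have jr: "j \<le> r" if "R \<le> r" for r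
    using hyp_gt[of j 5] j that by simp
  have two: "(\<exists>x\<in>{1..n}. x \<le> r \<and> coded n \<pi> r u v x j) \<longleftrightarrow> even j"
    if "R \<le> r" "r \<le> n" "tower_code 0 n \<pi> r u v" for r u v
  proof -
    have *: "coded n \<pi> r u v x j \<longleftrightarrow> j = 2 * x" if "x \<le> r" "x \<in> {1..n}" for x
      using tower_code_iff[OF \<open>tower_code 0 n \<pi> r u v\<close>, of x j] that \<open>r \<le> n\<close> \<open>R \<le> r\<close> jr j
      by (simp add: hyp_1[unfolded One_nat_def])
    show ?thesis
    proof
      assume "even j"
      then obtain x where "j = 2 * x" by (elim evenE)
      thus "\<exists>x\<in>{1..n}. x \<le> r \<and> coded n \<pi> r u v x j"
        using *[of x] jr[OF that(1)] that(2) j by (intro bexI[of _ x]) auto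
    qed (use * in auto)
  qed
  have lev: "even_level n \<pi> r \<Longrightarrow> even j" if r: "R \<le> r" "r \<le> n" for r
  proof -
    assume "even_level n \<pi> r"
    then obtain u v u' v' i where *: "tower_code 4 n \<pi> r u v" "tower_code 0 n \<pi> r u' v'"
      "i \<in> {1..n}" "i \<le> r" "\<exists>b\<in>{1..n}. b \<le> r \<and> coded n \<pi> r u v i b"
      "\<not> (\<exists>j'\<in>{1..n}. j' \<le> r \<and> i < j' \<and> (\<exists>b\<in>{1..n}. b \<le> r \<and> coded n \<pi> r u v j' b))"
      "\<exists>x\<in>{1..n}. x \<le> r \<and> coded n \<pi> r u' v' x i"
      unfolding even_level_def by blast
    have "i \<le> j" using top[OF r *(1), of i] * by auto
    moreover have "\<not> i < j"
      using top[OF r *(1), of j] *(6) j jr[OF r(1)] r(2) by auto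
    ultimately have "i = j" by simp
    thus "even j" using two[OF r *(2)] *(7) by simp
  qed
  have lev': "even_level n \<pi> r" if r: "R \<le> r" "r \<le> n" and "cod r" "even j" for r
  proof -
    obtain u v where uv: "u \<in> {1..n}" "v \<in> {1..n}" "tower_code 4 n \<pi> r u v"
      using \<open>cod r\<close> cod_def by blast
    obtain u' v' where uv': "u' \<in> {1..n}" "v' \<in> {1..n}" "tower_code 0 n \<pi> r u' v'"
      using tower_code_0[OF uv(3,1,2)] by blast
    have "j \<in> {1..n}" using jr[OF r(1)] j r by simp
    moreover have "j \<le> r \<and> (\<exists>b\<in>{1..n}. b \<le> r \<and> coded n \<pi> r u v j b)"
      using top[OF r uv(3) j(1)] by simp
    moreover have "\<not> (\<exists>j'\<in>{1..n}. j' \<le> r \<and> j < j' \<and> (\<exists>b\<in>{1..n}. b \<le> r \<and> coded n \<pi> r u v j' b))"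
    proof
      assume "\<exists>j'\<in>{1..n}. j' \<le> r \<and> j < j' \<and> (\<exists>b\<in>{1..n}. b \<le> r \<and> coded n \<pi> r u v j' b)"
      then obtain j' where j': "j' \<in> {1..n}" "j < j'"
        "j' \<le> r \<and> (\<exists>b\<in>{1..n}. b \<le> r \<and> coded n \<pi> r u v j' b)" by blast
      hence "j' \<le> j" using top[OF r uv(3), of j'] by simp
      thus False using j'(2) by simp
    qed
    moreover have "\<exists>x\<in>{1..n}. x \<le> r \<and> coded n \<pi> r u' v' x j"
      using two[OF r uv'(3)] \<open>even j\<close> by simp
    ultimately show ?thesis
      unfolding even_level_def using uv uv' by blast
  qed
  have osc: "oscillating n \<pi> \<longleftrightarrow> (\<exists>r\<in>{1..n}. even_level n \<pi> r \<and> \<not> (Suc r \<le> n \<and> cod (Suc r)))"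
    unfolding oscillating_def cod_def by (intro bex_cong) auto
  show ?thesis
  proof
    assume "oscillating n \<pi>"
    then obtain r where r: "r \<in> {1..n}" "even_level n \<pi> r" "\<not> (Suc r \<le> n \<and> cod (Suc r))"
      using osc by blast
    \<comment> \<open>If \<open>r < R\<close>, then \<open>Suc r \<le> R\<close> still has a code,
      so coding cannot stop at \<open>r\<close>.\<close>
    have "R \<le> r" using r(1,3) cod[of "Suc r"] k by (cases "R \<le> r") auto
    thus "even j" using lev r by auto
  next
    assume "even j"
    \<comment> \<open>The largest \<open>r\<close> with a code is a place where coding
      stops.\<close>
    define S where "S = {r \<in> {1..n}. cod r}"
    have mem_S: "x \<in> S \<longleftrightarrow> 1 \<le> x \<and> x \<le> n \<and> cod x" for x by (auto simp: S_def)
    have S: "finite S" "R \<in> S" using cod R k by (auto simp: S_def)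
    hence "S \<noteq> {}" by blast
    with S have M: "Max S \<in> S" "R \<le> Max S" "\<And>x. x \<in> S \<Longrightarrow> x \<le> Max S"
      by simp_all
    have "\<not> (Suc (Max S) \<le> n \<and> cod (Suc (Max S)))"
      using M(3)[of "Suc (Max S)"] mem_S by auto
    moreover have "even_level n \<pi> (Max S)"
      using lev'[of "Max S"] M(1,2) \<open>even j\<close> mem_S by blast
    ultimately show "oscillating n \<pi>"
      unfolding osc using M(1) mem_S[of "Max S"] by auto
  qed
qed

subsection \<open>Choosing the scales\<close>

lemma tower_strict_mono: "strict_mono tower"
  by (rule strict_mono_Suc_iff[THEN iffD2]) simp

lemma log_star_tower: "log_star (tower i) = i"
  unfolding log_star_def
  by (rule Least_equality) (auto simp: strict_mono_less_eq[OF tower_strict_mono])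

text \<open>The length \<open>k = R + M * m\<close> of the inspected prefix for \<open>R = v\<close>
  markers, words of length \<open>m = 3 * v\<close> and \<open>D = 5 * v ^ 3\<close> buckets; the
  number of blocks is \<open>M = (D ^ m) ^ 3\<close>, the cube of the number of words.\<close>

definition block_scale :: "nat \<Rightarrow> nat" where
  "block_scale v = v + (5 * v ^ 3) ^ (9 * v) * (3 * v)"

text \<open>The number \<open>D * s\<close> of rearranged positions. The bucket size
  \<open>s = k\<^sup>2 * v\<close> makes the collision term \<open>k\<^sup>2 / (D * s)\<close> equal
  to \<open>1 / (D * v)\<close>.\<close>

definition window_scale :: "nat \<Rightarrow> nat" where
  "window_scale v = 5 * v ^ 3 * ((block_scale v)\<^sup>2 * v)"

lemma window_scale_le_tower: "eventually (\<lambda>v. 2 * (window_scale v)\<^sup>2 \<le> tower v) at_top"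
proof -
  have "eventually (\<lambda>x::real. 2 * (5 * x ^ 3 * ((x + (5 * x ^ 3) powr (9 * x) * (3 * x))\<^sup>2 * x))\<^sup>2
          \<le> 2 powr (2 powr x)) at_top"
    by real_asymp
  hence "eventually (\<lambda>v. 2 * (5 * real v ^ 3 * ((real v + (5 * real v ^ 3) powr (9 * real v) * (3 * real v))\<^sup>2 * real v))\<^sup>2
          \<le> 2 powr (2 powr real v)) at_top"
    by (rule eventually_compose_filterlim) (rule filterlim_real_sequentially)
  thus ?thesis
    using eventually_ge_at_top[of 4]
  proof eventually_elim
    case (elim v)
    have "(5 * real v ^ 3) powr (9 * real v) = (5 * real v ^ 3) ^ (9 * v)"
      using elim(2) by (subst powr_realpow[symmetric]) auto
    moreover have "2 powr (2 powr real v) = (2::real) ^ (2 ^ v)"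
      by (simp add: powr_realpow[symmetric])
    ultimately have "real (2 * (window_scale v)\<^sup>2) \<le> real (2 ^ (2 ^ v))"
      using elim(1) by (simp add: window_scale_def block_scale_def)
    hence "2 * (window_scale v)\<^sup>2 \<le> 2 ^ (2 ^ v)"
      by (simp only: of_nat_le_iff)
    \<comment> \<open>Since \<open>tower v\<close> is \<open>2 ^ (2 ^ tower (v - 2))\<close>, the
      doubly exponential bound just obtained is enough.\<close>
    also have "v \<le> tower (v - 2)"
      using elim(2)
    proof (induction v rule: dec_induct)
      case (step v)
      have "Suc v \<le> 2 ^ v" by (induction v) auto
      also have "\<dots> \<le> 2 ^ tower (v - 2)" using step by (intro power_increasing) auto
      also have "\<dots> = tower (Suc (v - 2))" by simp
      also have "Suc (v - 2) = Suc v - 2" using step by simp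
      finally show ?case .
    qed (simp add: eval_nat_numeral)
    hence "(2::nat) ^ (2 ^ v) \<le> 2 ^ (2 ^ tower (v - 2))"
      by (intro power_increasing) auto
    also have "\<dots> = tower v"
      using elim(2) by (simp flip: tower.simps(2)) (simp add: Suc_diff_Suc numeral_2_eq_2)
    finally show ?case .
  qed
qed

text \<open>With \<open>X\<close> words, each missed by a block with probability
  \<open>1 - 1 / X\<close>, the cube gives
  \<open>(1 - 1 / X) ^ (X ^ 3) \<le> exp (- (X ^ 2)) \<le> 1 / X ^ 2\<close>, which survives the
  union bound over all words.\<close>

lemma power_decay_bound:
  fixes X :: nat
  assumes "X \<ge> 1"
  shows "real X * (1 - 1 / real X) ^ (X ^ 3) \<le> 1 / real X"
proof -
  have X: "real X \<ge> 1" using assms by simp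
  have "(1 - 1 / real X) ^ (X ^ 3) \<le> exp (- (1 / real X)) ^ (X ^ 3)"
    using X exp_ge_add_one_self[of "- (1 / real X)"] by (intro power_mono) auto
  also have "\<dots> = exp (- (real X)\<^sup>2)"
    using X by (simp add: exp_of_nat_mult[symmetric] power2_eq_square power3_eq_cube)
  also have "\<dots> = 1 / exp ((real X)\<^sup>2)"
    by (simp add: exp_minus field_simps)
  also have "(real X)\<^sup>2 \<le> exp ((real X)\<^sup>2)"
    using exp_ge_add_one_self[of "(real X)\<^sup>2"] by linarith
  hence "1 / exp ((real X)\<^sup>2) \<le> 1 / (real X)\<^sup>2"
    using X by (intro divide_left_mono) auto
  finally have "real X * (1 - 1 / real X) ^ (X ^ 3) \<le> real X * (1 / (real X)\<^sup>2)"
    using X by (intro mult_left_mono) auto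
  thus ?thesis using X by (simp add: power2_eq_square)
qed

text \<open>Because \<open>K / w \<le> 1 / 2\<close>, the power \<open>q ^ K\<close> is at most
  \<open>exp 1 \<le> 3\<close> if \<open>q \<ge> 1\<close>, and at least \<open>1 / 2\<close> by
  Bernoulli's inequality if \<open>q < 1\<close>.\<close>

lemma power_ratio_bound:
  fixes q w :: real and K :: nat
  assumes q: "1 - 1 / w < q" "q < 1 + 1 / w" and w: "w \<ge> 2 * real K" "w \<ge> 1"
    and ab: "a \<le> b + K" "b \<le> a + K"
  shows "q ^ a \<le> 3 * q ^ b"
proof (cases "q \<ge> 1")
  case True
  have "q ^ K \<le> exp (1 / w) ^ K"
    using True q exp_ge_add_one_self[of "1 / w"] by (intro power_mono) linarith+
  also have "\<dots> = exp (real K / w)"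
    by (simp add: exp_of_nat_mult[symmetric])
  also have "\<dots> \<le> exp 1"
    using w by (simp add: field_simps)
  also have "\<dots> \<le> 3" by (rule exp_le)
  finally have "q ^ b * q ^ K \<le> q ^ b * 3"
    using True by (intro mult_left_mono) auto
  moreover have "q ^ a \<le> q ^ (b + K)"
    using True ab by (intro power_increasing)
  ultimately show ?thesis by (simp add: power_add)
next
  case False
  have q0: "q > 0" using q w by (smt (verit) divide_le_eq_1_pos)
  have "1 / 2 \<le> 1 + real K * (- (1 / w))"
    using w by (simp add: field_simps)
  also have "\<dots> \<le> (1 + (- (1 / w))) ^ K"
    using w by (intro Bernoulli_inequality) auto
  also have "\<dots> \<le> q ^ K"
    using q w by (intro power_mono) auto
  finally have "q ^ a * (1 / 2) \<le> q ^ a * q ^ K"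
    using q0 by (intro mult_left_mono) auto
  also have "\<dots> = q ^ (a + K)" by (simp add: power_add)
  also have "\<dots> \<le> q ^ b"
    using False q0 ab by (intro power_decreasing) auto
  finally have "q ^ a \<le> 2 * q ^ b" by simp
  thus ?thesis using zero_less_power[OF q0, of b] by linarith
qed

text \<open>The margin 2 pays for the two applications of \<open>tower\<close> that are split off
  from \<open>hyp 4\<close> in the next lemma. The induction starts with
  \<open>hyp 4 3 = tower 4\<close>.\<close>

lemma hyp_4_gt: "3 \<le> x \<Longrightarrow> x + 2 < hyp 4 x"
proof (induction x rule: dec_induct)
  case base
  have "hyp 4 3 = hyp 3 (hyp 3 (hyp 4 1))"
    using hyp_Suc[of 1 3] hyp_Suc[of 2 3] by (simp add: numeral_2_eq_2[symmetric])
  also have "hyp 4 1 = 2" using hyp_one[of 3] by simp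
  also have "hyp 3 2 = tower 2" by (simp add: hyp_3)
  also have "tower 2 = 4" by (simp add: numeral_2_eq_2)
  also have "hyp 3 4 = tower 4" by (simp add: hyp_3)
  also have "3 + 2 < tower 4"
    using strict_monoD[OF tower_strict_mono, of 3 4] le_tower[of 3] strict_monoD[OF tower_strict_mono, of 2 3]
      \<open>tower 2 = 4\<close> by simp
  finally show ?case .
next
  case (step x)
  have "hyp 4 x < hyp 4 (Suc x)" using hyp_less[of x "Suc x" 3] step by simp
  thus ?case using step by simp
qed

text \<open>Unfolding two steps, \<open>hyp 4 v = tower (tower (hyp 4 (v - 2)))\<close>, and
  \<open>hyp 4 (v - 2)\<close> already exceeds \<open>v\<close>.\<close>

lemma tower_tower_less_hyp:
  assumes "v \<ge> 5"
  shows "tower (tower v) < hyp 4 v"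
proof -
  define x where "x = v - 2"
  have x: "v = Suc (Suc x)" "x \<ge> 3" using assms by (auto simp: x_def)
  have g: "v < hyp 4 x" using hyp_4_gt[of x] x by simp
  have "hyp 4 v = hyp 3 (hyp 3 (hyp 4 x))"
    using hyp_Suc[of x 3] hyp_Suc[of "Suc x" 3] x by simp
  also have "\<dots> = tower (tower (hyp 4 x))"
    using g le_tower[of "hyp 4 x"] by (simp add: hyp_3)
  also have "\<dots> > tower (tower v)"
    using g by (simp add: strict_mono_less[OF tower_strict_mono])
  finally show ?thesis .
qed

text \<open>The parameters are chosen so that each of the three error terms is at most
  \<open>1 / v\<close>; the change of weights contributes the factor 3.\<close>

lemma mweight_not_well_mixed_tower:
  fixes q :: real
  assumes v: "v \<ge> 1" and small: "2 * (window_scale v)\<^sup>2 \<le> tower v" and q0: "q > 0"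
    and q: "1 - 1 / tower v < q" "q < 1 + 1 / tower v"
  shows "mweight q (tower (tower v)) (\<lambda>\<pi>. \<not> well_mixed v (3 * v) (block_scale v) (5 * v ^ 3) \<pi>)
           \<le> 9 / v * mweight q (tower (tower v)) (\<lambda>_. True)"
proof -
  define D where "D = 5 * v ^ 3"
  define m where "m = 3 * v"
  define M where "M = (D ^ m) ^ 3"
  define k where "k = block_scale v"
  define s where "s = k\<^sup>2 * v"
  define n where "n = tower (tower v)"
  have "M = D ^ (9 * v)"
    by (simp add: M_def m_def mult.commute flip: power_mult)
  hence k: "k = v + M * m"
    by (simp only: k_def block_scale_def D_def m_def)
  have N: "window_scale v = D * s"
    by (simp add: window_scale_def D_def s_def k_def)
  have pos: "D > 0" "s > 0" "k > 0"
    using v by (auto simp: D_def s_def k)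
  have Dv: "v \<le> D" "v \<le> D ^ m"
  proof -
    have "v * 1 \<le> v ^ 3 * 5"
      using self_le_power[of v 3] v by (intro mult_le_mono) auto
    thus "v \<le> D" by (simp add: D_def)
    also have "D \<le> D ^ m" using pos v by (intro self_le_power) (auto simp: m_def)
    finally show "v \<le> D ^ m" .
  qed
  have "D * s \<le> 2 * (D * s)\<^sup>2" by (simp add: power2_eq_square)
  also have "\<dots> \<le> tower v" using small by (simp add: N)
  also have "\<dots> \<le> n" unfolding n_def by (rule le_tower)
  finally have Nn: "D * s \<le> n" .
  have "mweight q n (\<lambda>\<pi>. \<not> well_mixed v m k D \<pi>) \<le>
    3 * (k\<^sup>2 / (D * s) + (2 * v + 3 * v\<^sup>2) / D + D ^ m * (1 - 1 / D ^ m) ^ M) * mweight q n (\<lambda>_. True)"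
  proof (rule mweight_not_well_mixed[OF q0 k pos(1,2) Nn])
    fix a b assume ab: "a \<le> b + (D * s)\<^sup>2" "b \<le> a + (D * s)\<^sup>2"
    have "2 * real ((D * s)\<^sup>2) \<le> real (tower v)"
      using small unfolding N by (metis of_nat_le_iff of_nat_mult of_nat_numeral)
    moreover have "real (tower v) \<ge> 1" using le_tower[of v] v by simp
    ultimately show "q ^ a \<le> 3 * q ^ b"
      using q ab by (intro power_ratio_bound[where w = "real (tower v)" and K = "(D * s)\<^sup>2"])
  qed simp
  also have "\<dots> \<le> 3 * (1 / v + 1 / v + 1 / v) * mweight q n (\<lambda>_. True)"
  proof (intro mult_right_mono mult_left_mono add_mono)
    have "real (k\<^sup>2) / real (D * s) = 1 / (real D * real v)"
      using pos by (simp add: s_def)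
    also have "\<dots> \<le> 1 / real v"
      using pos v by (simp add: field_simps)
    finally show "real (k\<^sup>2) / real (D * s) \<le> 1 / real v" .
    have "2 * v + 3 * v\<^sup>2 \<le> 5 * v\<^sup>2"
      using v by (simp add: power2_eq_square)
    hence "real (2 * v + 3 * v\<^sup>2) / real D \<le> real (5 * v\<^sup>2) / real D"
      by (intro divide_right_mono) (simp_all only: of_nat_le_iff of_nat_0_le_iff)
    also have "\<dots> = 1 / real v"
      using v by (simp add: D_def power2_eq_square power3_eq_cube)
    finally show "real (2 * v + 3 * v\<^sup>2) / real D \<le> 1 / real v" .
    have "real (D ^ m) * (1 - 1 / real (D ^ m)) ^ M \<le> 1 / real (D ^ m)"
      unfolding M_def using pos by (intro power_decay_bound) (simp add: Suc_le_eq)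
    also have "\<dots> \<le> 1 / real v"
      using Dv v by (intro divide_left_mono) (simp_all only: of_nat_le_iff, auto)
    finally show "real (D ^ m) * (1 - 1 / real (D ^ m)) ^ M \<le> 1 / real v" .
  qed (use mweight_nonneg[OF q0] in auto)
  finally show ?thesis
    by (simp add: n_def k_def m_def D_def)
qed

lemma oscillating_level:
  assumes j: "j \<ge> 1" and v: "v = hyp 5 j" "v \<ge> 5" and small: "2 * (window_scale v)\<^sup>2 \<le> tower v"
    and mix: "well_mixed v (3 * v) (block_scale v) (5 * v ^ 3) \<pi>"
  shows "oscillating (tower (tower v)) \<pi> \<longleftrightarrow> even j"
proof (rule oscillating_iff[OF mix])
  have vn: "v \<le> tower v" "tower v \<le> tower (tower v)" by (rule le_tower)+
  thus "v \<le> tower (tower v)" by simp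
  define k where "k = block_scale v"
  have "k \<le> k\<^sup>2 * 1" by (simp add: power2_eq_square)
  also have "\<dots> \<le> k\<^sup>2 * (5 * v ^ 3 * v)" using v(2) by (intro mult_le_mono2) simp
  also have "\<dots> = window_scale v" by (simp add: window_scale_def k_def)
  also have "\<dots> \<le> 2 * (window_scale v)\<^sup>2" by (simp add: power2_eq_square)
  finally show "block_scale v \<le> tower (tower v)"
    using small vn by (simp add: k_def)
  have "hyp 5 (Suc j) = hyp 4 v" using hyp_Suc[of j 4] j v by simp
  thus "tower (tower v) < hyp 5 (Suc j)" using tower_tower_less_hyp[OF v(2)] by simp
qed (use j v in auto)

section \<open>Divergence along a sparse subsequence\<close>

lemma alternating_not_convergent:
  assumes "(\<lambda>j. if even j then 1 else 0 :: real) \<longlonglongrightarrow> L"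
  shows False
proof -
  have "(\<lambda>i. if even (2 * i) then 1 else 0 :: real) \<longlonglongrightarrow> L"
    using LIMSEQ_subseq_LIMSEQ[OF assms, of "\<lambda>i. 2 * i"] by (simp add: strict_mono_def o_def)
  moreover have "(\<lambda>i. if even (2 * i + 1) then 1 else 0 :: real) \<longlonglongrightarrow> L"
    using LIMSEQ_subseq_LIMSEQ[OF assms, of "\<lambda>i. 2 * i + 1"] by (simp add: strict_mono_def o_def)
  ultimately have "L = 1" "L = 0" by (simp_all add: LIMSEQ_const_iff)
  thus False by simp
qed

theorem convergence_law_fails_near_uniform:
  fixes q :: "nat \<Rightarrow> real"
  assumes q0: "\<And>n. n \<ge> 1 \<Longrightarrow> q n > 0"
    and q: "\<And>n. n \<ge> 2 \<Longrightarrow> 1 - 1 / real (log_star n) < q n \<and> q n < 1 + 1 / real (log_star n)"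
  shows "\<exists>\<phi>. sentence \<phi> \<and> \<not> convergent (\<lambda>n. mallows_prob n (q n) \<phi>)"
proof -
  obtain \<phi> where \<phi>: "sentence \<phi>"
    "\<And>n \<pi>. \<pi> permutes {1..n} \<Longrightarrow> perm_models n \<pi> \<phi> = oscillating n \<pi>"
    using oscillating_sentence by blast
  define nn where "nn j = tower (tower (hyp 5 j))" for j
  define f where "f n = mallows_prob n (q n) \<phi>" for n
  \<comment> \<open>Outside the badly mixed permutations, which carry a share of at most
    \<open>9 / v\<close>, the truth value of the sentence is the parity of \<open>j\<close>.\<close>
  have bound: "\<bar>f (nn j) - (if even j then 1 else 0)\<bar> \<le> 9 / real (hyp 5 j)"
    if j: "j \<ge> 1" "hyp 5 j \<ge> 5" and small: "2 * (window_scale (hyp 5 j))\<^sup>2 \<le> tower (hyp 5 j)" for j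
  proof -
    define v where "v = hyp 5 j"
    define n where "n = nn j"
    define Z where "Z = mweight (q n) n (\<lambda>_. True)"
    define B where "B \<pi> \<longleftrightarrow> \<not> well_mixed v (3 * v) (block_scale v) (5 * v ^ 3) \<pi>" for \<pi>
    have n: "n = tower (tower v)" by (simp add: n_def nn_def v_def)
    have v5: "v \<ge> 5" using j by (simp add: v_def)
    have n2: "n \<ge> 2"
      using le_tower[of v] le_tower[of "tower v"] v5 unfolding n by linarith
    have ls: "log_star n = tower v" unfolding n by (rule log_star_tower)
    have qn: "q n > 0" using q0 n2 by simp
    have Z: "Z > 0" unfolding Z_def by (rule mweight_total_pos[OF qn])
    have B: "mweight (q n) n B \<le> 9 / v * Z"
      using mweight_not_well_mixed_tower[of v "q n"] q[OF n2, unfolded ls] qn v5 small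
      unfolding B_def Z_def v_def[symmetric] n[symmetric] by simp
    have osc: "oscillating n \<pi> \<longleftrightarrow> even j" if "\<not> B \<pi>" for \<pi>
      unfolding n using that small j v5 by (intro oscillating_level) (auto simp: B_def v_def)
    have fn: "f n = mweight (q n) n (oscillating n) / Z"
      unfolding f_def Z_def mallows_prob_eq[OF qn]
      by (intro arg_cong2[where f = "(/)"] mweight_cong refl \<phi>(2)) (simp add: perms_def)
    have "\<bar>f n - (if even j then 1 else 0)\<bar> \<le> 9 / v"
    proof (cases "even j")
      case True
      have "Z = mweight (q n) n (\<lambda>\<pi>. oscillating n \<pi> \<or> \<not> oscillating n \<pi>)"
        unfolding Z_def by (rule mweight_cong) simp
      also have "\<dots> = mweight (q n) n (oscillating n) + mweight (q n) n (\<lambda>\<pi>. \<not> oscillating n \<pi>)"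
        by (rule mweight_disj) simp
      finally have *: "Z = mweight (q n) n (oscillating n) + mweight (q n) n (\<lambda>\<pi>. \<not> oscillating n \<pi>)" .
      have "mweight (q n) n (\<lambda>\<pi>. \<not> oscillating n \<pi>) \<le> mweight (q n) n B"
        using osc True by (intro mweight_mono qn) blast
      with B have "mweight (q n) n (\<lambda>\<pi>. \<not> oscillating n \<pi>) \<le> 9 / v * Z" by linarith
      moreover have "mweight (q n) n (\<lambda>\<pi>. \<not> oscillating n \<pi>) \<ge> 0"
        by (rule mweight_nonneg[OF qn])
      moreover have "f n = 1 - mweight (q n) n (\<lambda>\<pi>. \<not> oscillating n \<pi>) / Z"
        using * Z unfolding fn by (simp add: field_simps)
      ultimately show ?thesis
        using True Z by (simp add: divide_le_eq)
    next
      case False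
      have "mweight (q n) n (oscillating n) \<le> mweight (q n) n B"
        using osc False by (intro mweight_mono qn) blast
      with B have "mweight (q n) n (oscillating n) \<le> 9 / v * Z" by linarith
      moreover have "mweight (q n) n (oscillating n) \<ge> 0"
        by (rule mweight_nonneg[OF qn])
      ultimately show ?thesis
        using False Z unfolding fn by (simp add: divide_le_eq)
    qed
    thus ?thesis by (simp add: n_def v_def)
  qed
  have hyp5: "filterlim (hyp 5) at_top at_top"
    by (rule filterlim_at_top_mono[OF filterlim_ident])
       (use eventually_ge_at_top[of 1] in \<open>eventually_elim, auto intro!: less_imp_le[OF hyp_gt]\<close>)
  have "\<not> convergent f"
  proof
    assume "convergent f"
    then obtain L where L: "f \<longlonglongrightarrow> L" by (auto simp: convergent_def)
    have "filterlim nn at_top at_top"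
      by (rule filterlim_at_top_mono[OF hyp5])
         (unfold nn_def, intro always_eventually allI order.trans[OF le_tower le_tower])
    with L have 1: "(\<lambda>j. f (nn j)) \<longlonglongrightarrow> L"
      by (rule filterlim_compose)
    have "(\<lambda>j. f (nn j) - (if even j then 1 else 0)) \<longlonglongrightarrow> 0"
    proof (rule Lim_null_comparison)
      have "eventually (\<lambda>j. hyp 5 j \<ge> 5) at_top"
        using hyp5 by (simp add: filterlim_at_top)
      moreover have "eventually (\<lambda>j. 2 * (window_scale (hyp 5 j))\<^sup>2 \<le> tower (hyp 5 j)) at_top"
        by (rule eventually_compose_filterlim[OF window_scale_le_tower hyp5])
      ultimately show "eventually (\<lambda>j. norm (f (nn j) - (if even j then 1 else 0)) \<le> 9 / real (hyp 5 j)) at_top"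
        using eventually_ge_at_top[of 1] by eventually_elim (use bound in auto)
      have "filterlim (\<lambda>j. real (hyp 5 j)) at_top at_top"
        by (rule filterlim_compose[OF filterlim_real_sequentially hyp5])
      thus "(\<lambda>j. 9 / real (hyp 5 j)) \<longlonglongrightarrow> 0"
        by (rule real_tendsto_divide_at_top[OF tendsto_const])
    qed
    from tendsto_diff[OF 1 this] have "(\<lambda>j. if even j then 1 else 0 :: real) \<longlonglongrightarrow> L"
      by simp
    thus False by (rule alternating_not_convergent)
  qed
  thus ?thesis using \<phi>(1) unfolding f_def by blast
qed

section \<open>Types of direct sums\<close>

subsection \<open>Direct sums\<close>

definition dsum :: "nat \<Rightarrow> (nat \<Rightarrow> nat) \<Rightarrow> (nat \<Rightarrow> nat) \<Rightarrow> nat \<Rightarrow> nat" where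
  "dsum n \<pi> \<sigma> i = (if i \<le> n then \<pi> i else n + \<sigma> (i - n))"

lemma perms_0: "\<pi> \<in> perms n \<Longrightarrow> \<pi> 0 = 0"
  unfolding perms_def by (auto dest: permutes_not_in[where x = 0])

lemma perms_in: "\<pi> \<in> perms n \<Longrightarrow> 0 < i \<Longrightarrow> i \<le> n \<Longrightarrow> 1 \<le> \<pi> i \<and> \<pi> i \<le> n"
  unfolding perms_def using permutes_in_image[of \<pi> "{1..n}" i] by auto

lemma perms_out: "\<pi> \<in> perms n \<Longrightarrow> n < i \<Longrightarrow> \<pi> i = i"
  unfolding perms_def by (auto dest: permutes_not_in[where x = i])

lemma perms_le: "\<pi> \<in> perms n \<Longrightarrow> i \<le> n \<Longrightarrow> \<pi> i \<le> n"
  using perms_in[of \<pi> n i] perms_0[of \<pi> n] by (cases "i = 0") auto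

lemma perms_inj: "\<pi> \<in> perms n \<Longrightarrow> \<pi> i = \<pi> j \<longleftrightarrow> i = j"
  unfolding perms_def by (auto dest: permutes_inj injD)

lemma permsI:
  assumes "inj_on \<pi> {1..n}" "\<And>i. i \<in> {1..n} \<Longrightarrow> \<pi> i \<in> {1..n}" "\<And>i. i \<notin> {1..n} \<Longrightarrow> \<pi> i = i"
  shows "\<pi> \<in> perms n"
proof -
  have "\<pi> ` {1..n} = {1..n}"
    using assms by (intro card_subset_eq) (auto simp: card_image)
  thus ?thesis
    unfolding perms_def using assms by (auto intro!: bij_imp_permutes simp: bij_betw_def)
qed

lemma id_perms [simp]: "id \<in> perms n"
  by (simp add: perms_def permutes_id)

lemma perms_zero [simp]: "perms 0 = {id}"
  by (simp add: perms_def)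

lemma dsum_perms:
  assumes "\<pi> \<in> perms n" "\<sigma> \<in> perms m"
  shows "dsum n \<pi> \<sigma> \<in> perms (n + m)"
proof (rule permsI)
  show "inj_on (dsum n \<pi> \<sigma>) {1..n + m}"
  proof (rule inj_onI)
    fix i j assume ij: "i \<in> {1..n + m}" "j \<in> {1..n + m}" "dsum n \<pi> \<sigma> i = dsum n \<pi> \<sigma> j"
    have *: "dsum n \<pi> \<sigma> l \<le> n \<longleftrightarrow> l \<le> n" if "l \<in> {1..n + m}" for l
    proof -
      have "l - n \<le> m" using that by auto
      thus ?thesis
        using that perms_le[OF assms(1), of l] perms_in[OF assms(2), of "l - n"] by (auto simp: dsum_def)
    qed
    show "i = j"
    proof (cases "i \<le> n")
      case True
      hence "j \<le> n" using *[OF ij(1)] *[OF ij(2)] ij(3) by simp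
      thus ?thesis using True ij(3) perms_inj[OF assms(1)] by (simp add: dsum_def)
    next
      case False
      hence "\<not> j \<le> n" using *[OF ij(1)] *[OF ij(2)] ij(3) by simp
      hence "i - n = j - n" using False ij(3) perms_inj[OF assms(2)] by (simp add: dsum_def)
      thus ?thesis using False \<open>\<not> j \<le> n\<close> by linarith
    qed
  qed
next
  fix i assume i: "i \<in> {1..n + m}"
  hence "i - n \<le> m" by auto
  thus "dsum n \<pi> \<sigma> i \<in> {1..n + m}"
    using i perms_in[OF assms(1), of i] perms_in[OF assms(2), of "i - n"] by (auto simp: dsum_def)
next
  fix i assume "i \<notin> {1..n + m}"
  thus "dsum n \<pi> \<sigma> i = i"
    using perms_0[OF assms(1)] perms_out[OF assms(2), of "i - n"] by (cases "i = 0") (auto simp: dsum_def)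
qed

lemma dsum_assoc: "dsum n \<pi> (dsum m \<sigma> \<rho>) = dsum (n + m) (dsum n \<pi> \<sigma>) \<rho>"
  by (auto simp: fun_eq_iff dsum_def)

lemma dsum_0_left: "\<sigma> \<in> perms m \<Longrightarrow> dsum 0 id \<sigma> = \<sigma>"
  using perms_0[of \<sigma> m] by (auto simp: fun_eq_iff dsum_def)

lemma dsum_0_right: "\<pi> \<in> perms n \<Longrightarrow> dsum n \<pi> id = \<pi>"
  using perms_out[of \<pi> n] by (auto simp: fun_eq_iff dsum_def)

subsection \<open>Types of permutations\<close>

text \<open>An assignment \<open>e\<close> marks the positions \<open>e v \<noteq> 0\<close>; the value \<open>0\<close> means that \<open>v\<close> is unassigned.
  At level \<open>k\<close> only the marks \<open>v \<ge> k\<close> are in use, so that \<open>k - 1\<close> is always a fresh mark.\<close>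

definition atoms :: "nat \<Rightarrow> (nat \<Rightarrow> nat) \<Rightarrow> (nat \<Rightarrow> nat) \<Rightarrow> nat" where
  "atoms K \<pi> e = prod_encode (set_encode {u. u < K \<and> e u = 0},
     prod_encode (set_encode (prod_encode ` {(u, v). u < K \<and> v < K \<and> e u < e v}),
                  set_encode (prod_encode ` {(u, v). u < K \<and> v < K \<and> \<pi> (e u) < \<pi> (e v)})))"

text \<open>Ehrenfeucht-Fraisse types of rank \<open>k\<close> over \<open>K\<close> marks. Coding
  them as natural numbers lets a finite set of types be a component of a type again, and turns
  equivalence in the game into equality.\<close>

primrec tp :: "nat \<Rightarrow> nat \<Rightarrow> nat \<Rightarrow> (nat \<Rightarrow> nat) \<Rightarrow> (nat \<Rightarrow> nat) \<Rightarrow> nat" where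
  "tp 0 K n \<pi> e = atoms K \<pi> e"
| "tp (Suc k) K n \<pi> e = prod_encode (tp k K n \<pi> e, set_encode ((\<lambda>a. tp k K n \<pi> (e(k := a))) ` {1..n}))"

lemma finite_pairs_less: "finite {(u, v). u < K \<and> v < (K :: nat) \<and> P u v}"
  by (rule finite_subset[of _ "{..<K} \<times> {..<K}"]) auto

lemma atoms_eq_iff:
  "atoms K \<pi> e = atoms K \<pi>' e' \<longleftrightarrow>
     (\<forall>u<K. e u = 0 \<longleftrightarrow> e' u = 0) \<and> (\<forall>u<K. \<forall>v<K. e u < e v \<longleftrightarrow> e' u < e' v) \<and>
     (\<forall>u<K. \<forall>v<K. \<pi> (e u) < \<pi> (e v) \<longleftrightarrow> \<pi>' (e' u) < \<pi>' (e' v))"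
proof -
  have *: "set_encode (prod_encode ` {(u, v). u < K \<and> v < K \<and> P u v}) =
           set_encode (prod_encode ` {(u, v). u < K \<and> v < K \<and> Q u v}) \<longleftrightarrow>
           (\<forall>u<K. \<forall>v<K. P u v = Q u v)" for P Q
    by (subst set_encode_eq, simp add: finite_pairs_less, simp add: finite_pairs_less,
        subst inj_image_eq_iff[OF inj_prod_encode]) auto
  have **: "set_encode {u. u < K \<and> P u} = set_encode {u. u < K \<and> Q u} \<longleftrightarrow> (\<forall>u<K. P u = Q u)" for P Q
    by (subst set_encode_eq) auto
  show ?thesis
    unfolding atoms_def prod_encode_eq prod.inject * ** ..
qed

lemma tp_Suc_eq_iff:
  "tp (Suc k) K n \<pi> e = tp (Suc k) K n' \<pi>' e' \<longleftrightarrow> tp k K n \<pi> e = tp k K n' \<pi>' e' \<and>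
     (\<lambda>a. tp k K n \<pi> (e(k := a))) ` {1..n} = (\<lambda>a. tp k K n' \<pi>' (e'(k := a))) ` {1..n'}"
  by (simp add: set_encode_eq)

declare tp.simps(2) [simp del]

lemma tp_eq_atoms: "tp k K n \<pi> e = tp k K n' \<pi>' e' \<Longrightarrow> atoms K \<pi> e = atoms K \<pi>' e'"
  by (induction k) (auto simp: tp_Suc_eq_iff)

text \<open>Over finitely many marks there are finitely many atomic types, and a type of the next
  rank is a pair of a type and a set of types from a finite set.\<close>

lemma finite_tp: "finite {tp k K n \<pi> e | n \<pi> e. True}"
proof (induction k)
  case 0
  have sub: "atoms K \<pi> e \<in> prod_encode ` (set_encode ` Pow {..<K} \<times>
      prod_encode ` (set_encode ` Pow (prod_encode ` ({..<K} \<times> {..<K})) \<times>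
                     set_encode ` Pow (prod_encode ` ({..<K} \<times> {..<K}))))" for \<pi> e
    unfolding atoms_def by (intro imageI SigmaI PowI image_mono) auto
  show ?case
    by (rule finite_subset[of _ "prod_encode ` (set_encode ` Pow {..<K} \<times>
      prod_encode ` (set_encode ` Pow (prod_encode ` ({..<K} \<times> {..<K})) \<times>
                     set_encode ` Pow (prod_encode ` ({..<K} \<times> {..<K}))))"])
       (use sub in auto)
next
  case (Suc k)
  define T where "T = {tp k K n \<pi> e | n \<pi> e. True}"
  have "{tp (Suc k) K n \<pi> e | n \<pi> e. True} \<subseteq> prod_encode ` (T \<times> set_encode ` Pow T)"
    unfolding tp.simps(2) by (auto simp: T_def intro!: imageI)
  moreover have "finite (prod_encode ` (T \<times> set_encode ` Pow T))"
    using Suc.IH by (simp add: T_def)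
  ultimately show ?case by (rule finite_subset)
qed

section \<open>Types decide sentences\<close>

primrec qdepth :: "toto \<Rightarrow> nat" where
  "qdepth (Eq x y) = 0"
| "qdepth (Less1 x y) = 0"
| "qdepth (Less2 x y) = 0"
| "qdepth (Neg \<phi>) = qdepth \<phi>"
| "qdepth (Conj \<phi> \<psi>) = max (qdepth \<phi>) (qdepth \<psi>)"
| "qdepth (Exists x \<phi>) = Suc (qdepth \<phi>)"

text \<open>The map \<open>h\<close> tells which mark carries the value of each free variable. A
  quantifier redirects its variable to the fresh mark \<open>k - 1\<close>, so formulas that reuse
  or shadow variables cause no trouble.\<close>

lemma tp_sat:
  assumes "tp k K n \<pi> e = tp k K n' \<pi>' e'" "qdepth \<phi> \<le> k" "k \<le> K"
    and "\<And>x. x \<in> free_vars \<phi> \<Longrightarrow> k \<le> h x \<and> h x < K \<and> s x = e (h x) \<and> s' x = e' (h x)"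
  shows "sat {1..n} (\<lambda>i j. i < j) (\<lambda>i j. \<pi> i < \<pi> j) s \<phi> \<longleftrightarrow>
         sat {1..n'} (\<lambda>i j. i < j) (\<lambda>i j. \<pi>' i < \<pi>' j) s' \<phi>"
  using assms
proof (induction \<phi> arbitrary: k h e e' s s')
  case (Eq x y)
  note at = tp_eq_atoms[OF Eq.prems(1), unfolded atoms_eq_iff]
  have "e (h x) < e (h y) \<longleftrightarrow> e' (h x) < e' (h y)" "e (h y) < e (h x) \<longleftrightarrow> e' (h y) < e' (h x)"
    using at Eq.prems(4) by auto
  hence "e (h x) = e (h y) \<longleftrightarrow> e' (h x) = e' (h y)" by (metis linorder_neqE_nat less_irrefl)
  thus ?case using Eq.prems(4) by simp
next
  case (Less1 x y)
  note at = tp_eq_atoms[OF Less1.prems(1), unfolded atoms_eq_iff]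
  show ?case using at Less1.prems(4) by simp
next
  case (Less2 x y)
  note at = tp_eq_atoms[OF Less2.prems(1), unfolded atoms_eq_iff]
  show ?case using at Less2.prems(4) by simp
next
  case (Neg \<phi>)
  show ?case using Neg.IH[OF Neg.prems(1), of h s s'] Neg.prems by simp
next
  case (Conj \<phi> \<psi>)
  show ?case using Conj.IH(1)[OF Conj.prems(1), of h s s'] Conj.IH(2)[OF Conj.prems(1), of h s s'] Conj.prems
    by simp
next
  case (Exists x \<phi>)
  obtain k' where k': "k = Suc k'" using Exists.prems(2) by (cases k) auto
  have im: "(\<lambda>a. tp k' K n \<pi> (e(k' := a))) ` {1..n} = (\<lambda>a. tp k' K n' \<pi>' (e'(k' := a))) ` {1..n'}"
    using Exists.prems(1) unfolding k' tp_Suc_eq_iff by blast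
  have *: "sat {1..n} (\<lambda>i j. i < j) (\<lambda>i j. \<pi> i < \<pi> j) (s(x := a)) \<phi> \<longleftrightarrow>
         sat {1..n'} (\<lambda>i j. i < j) (\<lambda>i j. \<pi>' i < \<pi>' j) (s'(x := a')) \<phi>"
    if "tp k' K n \<pi> (e(k' := a)) = tp k' K n' \<pi>' (e'(k' := a'))" for a a'
  proof (rule Exists.IH[OF that, where h = "h(x := k')"])
    fix y assume "y \<in> free_vars \<phi>"
    thus "k' \<le> (h(x := k')) y \<and> (h(x := k')) y < K \<and>
       (s(x := a)) y = (e(k' := a)) ((h(x := k')) y) \<and> (s'(x := a')) y = (e'(k' := a')) ((h(x := k')) y)"
      using Exists.prems(3) Exists.prems(4)[of y] k' by (cases "y = x") auto
  qed (use Exists.prems k' in auto)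
  have 1: "\<exists>a'\<in>{1..n'}. tp k' K n \<pi> (e(k' := a)) = tp k' K n' \<pi>' (e'(k' := a'))" if "a \<in> {1..n}" for a
    using imageI[OF that, of "\<lambda>a. tp k' K n \<pi> (e(k' := a))"] unfolding im by auto
  have 2: "\<exists>a\<in>{1..n}. tp k' K n \<pi> (e(k' := a)) = tp k' K n' \<pi>' (e'(k' := a'))" if "a' \<in> {1..n'}" for a'
    using imageI[OF that, of "\<lambda>a. tp k' K n' \<pi>' (e'(k' := a))"] unfolding im[symmetric] by force
  show ?case
    unfolding sat.simps using 1 2 * by blast
qed

section \<open>Composition of types under direct sums\<close>

definition msum :: "nat \<Rightarrow> (nat \<Rightarrow> nat) \<Rightarrow> (nat \<Rightarrow> nat) \<Rightarrow> nat \<Rightarrow> nat" where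
  "msum n e f v = (if e v \<noteq> 0 then e v else if f v \<noteq> 0 then n + f v else 0)"

definition marked :: "nat \<Rightarrow> nat \<Rightarrow> (nat \<Rightarrow> nat) \<Rightarrow> (nat \<Rightarrow> nat) \<Rightarrow> bool" where
  "marked k n \<pi> e \<longleftrightarrow> \<pi> \<in> perms n \<and> (\<forall>v. e v \<le> n) \<and> (\<forall>v<k. e v = 0)"

text \<open>Marks in different summands compare in the same way in both orders, the left one being
  smaller, so comparisons are determined by the summand of each mark and the comparisons inside it.
  Unassigned marks fit in because permutations fix 0.\<close>

lemma atoms_dsum:
  assumes "marked k n \<pi> e" "marked k n' \<pi>' e'" "marked k m \<sigma> f" "marked k m' \<sigma>' f'"
    and "atoms K \<pi> e = atoms K \<pi>' e'" "atoms K \<sigma> f = atoms K \<sigma>' f'"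
  shows "atoms K (dsum n \<pi> \<sigma>) (msum n e f) = atoms K (dsum n' \<pi>' \<sigma>') (msum n' e' f')"
proof -
  have less: "msum n e f u < msum n e f v \<longleftrightarrow>
      (if e u \<noteq> 0 then (if e v \<noteq> 0 then e u < e v else f v \<noteq> 0)
       else if f u \<noteq> 0 then e v = 0 \<and> f v \<noteq> 0 \<and> f u < f v else e v \<noteq> 0 \<or> f v \<noteq> 0)"
    "dsum n \<pi> \<sigma> (msum n e f u) < dsum n \<pi> \<sigma> (msum n e f v) \<longleftrightarrow>
      (if e u \<noteq> 0 then (if e v \<noteq> 0 then \<pi> (e u) < \<pi> (e v) else f v \<noteq> 0)
       else if f u \<noteq> 0 then e v = 0 \<and> f v \<noteq> 0 \<and> \<sigma> (f u) < \<sigma> (f v) else e v \<noteq> 0 \<or> f v \<noteq> 0)"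
    if "marked k n \<pi> e" "marked k m \<sigma> f" for n m \<pi> \<sigma> e f u v
  proof -
    have b: "e u \<le> n" "e v \<le> n" "f u \<le> m" "f v \<le> m" "\<pi> \<in> perms n" "\<sigma> \<in> perms m"
      using that by (auto simp: marked_def)
    show "msum n e f u < msum n e f v \<longleftrightarrow>
      (if e u \<noteq> 0 then (if e v \<noteq> 0 then e u < e v else f v \<noteq> 0)
       else if f u \<noteq> 0 then e v = 0 \<and> f v \<noteq> 0 \<and> f u < f v else e v \<noteq> 0 \<or> f v \<noteq> 0)"
      using b by (auto simp: msum_def)
    have p: "\<pi> 0 = 0" "e u \<noteq> 0 \<Longrightarrow> 1 \<le> \<pi> (e u) \<and> \<pi> (e u) \<le> n" "e v \<noteq> 0 \<Longrightarrow> 1 \<le> \<pi> (e v) \<and> \<pi> (e v) \<le> n"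
      "f u \<noteq> 0 \<Longrightarrow> 1 \<le> \<sigma> (f u)" "f v \<noteq> 0 \<Longrightarrow> 1 \<le> \<sigma> (f v)"
      using perms_0[OF b(5)] perms_in[OF b(5), of "e u"] perms_in[OF b(5), of "e v"]
        perms_in[OF b(6), of "f u"] perms_in[OF b(6), of "f v"] b by auto
    have val: "dsum n \<pi> \<sigma> (msum n e f w) =
        (if e w \<noteq> 0 then \<pi> (e w) else if f w \<noteq> 0 then n + \<sigma> (f w) else 0)" if "e w \<le> n" for w
      using that p(1) by (auto simp: msum_def dsum_def)
    show "dsum n \<pi> \<sigma> (msum n e f u) < dsum n \<pi> \<sigma> (msum n e f v) \<longleftrightarrow>
      (if e u \<noteq> 0 then (if e v \<noteq> 0 then \<pi> (e u) < \<pi> (e v) else f v \<noteq> 0)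
       else if f u \<noteq> 0 then e v = 0 \<and> f v \<noteq> 0 \<and> \<sigma> (f u) < \<sigma> (f v) else e v \<noteq> 0 \<or> f v \<noteq> 0)"
      unfolding val[OF b(1)] val[OF b(2)] using p by auto
  qed
  have zero: "msum n e f u = 0 \<longleftrightarrow> e u = 0 \<and> f u = 0" for n e f u
    by (auto simp: msum_def)
  note eqs = assms(5,6)[unfolded atoms_eq_iff]
  have z: "e u = 0 \<longleftrightarrow> e' u = 0" "f u = 0 \<longleftrightarrow> f' u = 0" if "u < K" for u
    by (rule eqs(1)[THEN conjunct1, rule_format, OF that] eqs(2)[THEN conjunct1, rule_format, OF that])+
  have l: "e u < e v \<longleftrightarrow> e' u < e' v" "f u < f v \<longleftrightarrow> f' u < f' v"
    "\<pi> (e u) < \<pi> (e v) \<longleftrightarrow> \<pi>' (e' u) < \<pi>' (e' v)" "\<sigma> (f u) < \<sigma> (f v) \<longleftrightarrow> \<sigma>' (f' u) < \<sigma>' (f' v)"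
    if "u < K" "v < K" for u v
    by (rule eqs(1)[THEN conjunct2, THEN conjunct1, rule_format, OF that]
             eqs(2)[THEN conjunct2, THEN conjunct1, rule_format, OF that]
             eqs(1)[THEN conjunct2, THEN conjunct2, rule_format, OF that]
             eqs(2)[THEN conjunct2, THEN conjunct2, rule_format, OF that])+
  show ?thesis
    unfolding atoms_eq_iff
    by (intro conjI allI impI)
       (simp_all only: zero less[OF assms(1,3)] less[OF assms(2,4)] z l)
qed

text \<open>The standard composition of games: a new mark falls into one summand and is answered
  there, while the other summand just drops to the next lower rank.\<close>

lemma tp_dsum:
  assumes "tp k K n \<pi> e = tp k K n' \<pi>' e'" "tp k K m \<sigma> f = tp k K m' \<sigma>' f'"
    and "marked k n \<pi> e" "marked k n' \<pi>' e'" "marked k m \<sigma> f" "marked k m' \<sigma>' f'"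
  shows "tp k K (n + m) (dsum n \<pi> \<sigma>) (msum n e f) = tp k K (n' + m') (dsum n' \<pi>' \<sigma>') (msum n' e' f')"
  using assms
proof (induction k arbitrary: n n' m m' \<pi> \<pi>' \<sigma> \<sigma>' e e' f f')
  case 0
  show ?case using atoms_dsum[OF 0(3-6)] 0(1,2) by simp
next
  case (Suc k)
  have mk: "marked k n \<pi> e" if "marked (Suc k) n \<pi> e" for n \<pi> e
    using that by (simp add: marked_def)
  have mk': "marked k n \<pi> (e(k := a))" if "marked (Suc k) n \<pi> e" "a \<in> {1..n}" for n \<pi> e a
    using that by (auto simp: marked_def)
  have sub: "(\<lambda>a. tp k K (n + m) (dsum n \<pi> \<sigma>) ((msum n e f)(k := a))) ` {1..n + m} \<subseteq>
        (\<lambda>a. tp k K (n' + m') (dsum n' \<pi>' \<sigma>') ((msum n' e' f')(k := a))) ` {1..n' + m'}"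
    if *: "tp (Suc k) K n \<pi> e = tp (Suc k) K n' \<pi>' e'" "tp (Suc k) K m \<sigma> f = tp (Suc k) K m' \<sigma>' f'"
      "marked (Suc k) n \<pi> e" "marked (Suc k) n' \<pi>' e'" "marked (Suc k) m \<sigma> f" "marked (Suc k) m' \<sigma>' f'"
    for n n' m m' \<pi> \<pi>' \<sigma> \<sigma>' e e' f f'
  proof (rule image_subsetI)
    fix a assume a: "a \<in> {1..n + m}"
    have k0: "e k = 0" "e' k = 0" using *(3,4) by (auto simp: marked_def)
    show "tp k K (n + m) (dsum n \<pi> \<sigma>) ((msum n e f)(k := a)) \<in>
        (\<lambda>a. tp k K (n' + m') (dsum n' \<pi>' \<sigma>') ((msum n' e' f')(k := a))) ` {1..n' + m'}"
    proof (cases "a \<le> n")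
      case True
      hence "tp k K n \<pi> (e(k := a)) \<in> (\<lambda>a. tp k K n' \<pi>' (e'(k := a))) ` {1..n'}"
        using *(1) a unfolding tp_Suc_eq_iff by (metis (no_types, lifting) atLeastAtMost_iff imageI)
      then obtain a' where a': "a' \<in> {1..n'}" "tp k K n \<pi> (e(k := a)) = tp k K n' \<pi>' (e'(k := a'))" by auto
      have "tp k K (n + m) (dsum n \<pi> \<sigma>) (msum n (e(k := a)) f) =
            tp k K (n' + m') (dsum n' \<pi>' \<sigma>') (msum n' (e'(k := a')) f')"
        by (rule Suc.IH[OF a'(2) conjunct1[OF *(2)[unfolded tp_Suc_eq_iff]]
              mk'[OF *(3)] mk'[OF *(4) a'(1)] mk[OF *(5)] mk[OF *(6)]]) (use a True in simp)
      moreover have "msum n (e(k := a)) f = (msum n e f)(k := a)" "msum n' (e'(k := a')) f' = (msum n' e' f')(k := a')"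
        using a a' by (auto simp: msum_def fun_eq_iff)
      ultimately show ?thesis using a' by (intro image_eqI[of _ _ a']) auto
    next
      case False
      define b where "b = a - n"
      have b: "b \<in> {1..m}" "a = n + b" using False a by (auto simp: b_def)
      hence "tp k K m \<sigma> (f(k := b)) \<in> (\<lambda>a. tp k K m' \<sigma>' (f'(k := a))) ` {1..m'}"
        using *(2) unfolding tp_Suc_eq_iff by (metis (no_types, lifting) imageI)
      then obtain b' where b': "b' \<in> {1..m'}" "tp k K m \<sigma> (f(k := b)) = tp k K m' \<sigma>' (f'(k := b'))" by auto
      have "tp k K (n + m) (dsum n \<pi> \<sigma>) (msum n e (f(k := b))) =
            tp k K (n' + m') (dsum n' \<pi>' \<sigma>') (msum n' e' (f'(k := b')))"
        by (rule Suc.IH[OF conjunct1[OF *(1)[unfolded tp_Suc_eq_iff]] b'(2)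
              mk[OF *(3)] mk[OF *(4)] mk'[OF *(5) b(1)] mk'[OF *(6) b'(1)]])
      moreover have "msum n e (f(k := b)) = (msum n e f)(k := a)"
        "msum n' e' (f'(k := b')) = (msum n' e' f')(k := n' + b')"
        using b b' k0 by (auto simp: msum_def fun_eq_iff)
      ultimately show ?thesis using b' by (intro image_eqI[of _ _ "n' + b'"]) auto
    qed
  qed
  have "tp k K (n + m) (dsum n \<pi> \<sigma>) (msum n e f) = tp k K (n' + m') (dsum n' \<pi>' \<sigma>') (msum n' e' f')"
    by (rule Suc.IH[OF conjunct1[OF Suc.prems(1)[unfolded tp_Suc_eq_iff]]
          conjunct1[OF Suc.prems(2)[unfolded tp_Suc_eq_iff]] Suc.prems(3-6)[THEN mk]])
  moreover have "(\<lambda>a. tp k K (n + m) (dsum n \<pi> \<sigma>) ((msum n e f)(k := a))) ` {1..n + m} =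
        (\<lambda>a. tp k K (n' + m') (dsum n' \<pi>' \<sigma>') ((msum n' e' f')(k := a))) ` {1..n' + m'}"
    by (rule equalityI[OF sub[OF Suc.prems]
          sub[OF Suc.prems(1,2)[symmetric] Suc.prems(4,3,6,5)]])
  ultimately show ?case
    unfolding tp_Suc_eq_iff by blast
qed

text \<open>With \<open>K = k\<close> there is exactly one mark per rank, all of them unassigned at
  the start.\<close>

definition ptype :: "nat \<Rightarrow> nat \<times> (nat \<Rightarrow> nat) \<Rightarrow> nat" where
  "ptype k = (\<lambda>(n, \<pi>). tp k k n \<pi> (\<lambda>_. 0))"

definition psum :: "nat \<times> (nat \<Rightarrow> nat) \<Rightarrow> nat \<times> (nat \<Rightarrow> nat) \<Rightarrow> nat \<times> (nat \<Rightarrow> nat)" where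
  "psum = (\<lambda>(n, \<pi>) (m, \<sigma>). (n + m, dsum n \<pi> \<sigma>))"

definition Perms :: "(nat \<times> (nat \<Rightarrow> nat)) set" where
  "Perms = (SIGMA n:UNIV. perms n)"

lemma msum_0 [simp]: "msum n (\<lambda>_. 0) (\<lambda>_. 0) = (\<lambda>_. 0)"
  by (simp add: msum_def fun_eq_iff)

lemma marked_0 [simp]: "marked k n \<pi> (\<lambda>_. 0) \<longleftrightarrow> \<pi> \<in> perms n"
  by (simp add: marked_def)

lemma ptype_psum:
  assumes "x \<in> Perms" "x' \<in> Perms" "y \<in> Perms" "y' \<in> Perms" "ptype k x = ptype k x'" "ptype k y = ptype k y'"
  shows "ptype k (psum x y) = ptype k (psum x' y')"
proof -
  obtain n \<pi> n' \<pi>' m \<sigma> m' \<sigma>' where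
    x: "x = (n, \<pi>)" "x' = (n', \<pi>')" "y = (m, \<sigma>)" "y' = (m', \<sigma>')"
    by (cases x, cases x', cases y, cases y') blast
  have "tp k k (n + m) (dsum n \<pi> \<sigma>) (msum n (\<lambda>_. 0) (\<lambda>_. 0)) =
        tp k k (n' + m') (dsum n' \<pi>' \<sigma>') (msum n' (\<lambda>_. 0) (\<lambda>_. 0))"
    using assms unfolding x by (intro tp_dsum) (simp_all add: ptype_def Perms_def)
  thus ?thesis by (simp add: x ptype_def psum_def)
qed

lemma perm_models_ptype:
  assumes "sentence \<phi>" "ptype (qdepth \<phi>) (n, \<pi>) = ptype (qdepth \<phi>) (n', \<pi>')"
  shows "perm_models n \<pi> \<phi> \<longleftrightarrow> perm_models n' \<pi>' \<phi>"
  unfolding perm_models_iff[OF assms(1), of _ _ "\<lambda>_. 0"]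
  by (rule tp_sat[where h = "\<lambda>_. 0"]) (use assms in \<open>auto simp: ptype_def sentence_def\<close>)

primrec ppow :: "nat \<times> (nat \<Rightarrow> nat) \<Rightarrow> nat \<Rightarrow> nat \<times> (nat \<Rightarrow> nat)" where
  "ppow x 0 = (0, id)"
| "ppow x (Suc i) = psum x (ppow x i)"

lemma psum_Perms: "x \<in> Perms \<Longrightarrow> y \<in> Perms \<Longrightarrow> psum x y \<in> Perms"
  by (auto simp: psum_def Perms_def intro: dsum_perms)

lemma ppow_Perms: "x \<in> Perms \<Longrightarrow> ppow x i \<in> Perms"
  by (induction i) (auto simp: psum_Perms, simp add: Perms_def)

lemma psum_assoc: "psum (psum x y) z = psum x (psum y z)"
  by (auto simp: psum_def dsum_assoc split: prod.splits)

lemma psum_id: "x \<in> Perms \<Longrightarrow> psum (0, id) x = x" "x \<in> Perms \<Longrightarrow> psum x (0, id) = x"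
  by (auto simp: psum_def Perms_def dsum_0_left dsum_0_right split: prod.splits)

lemma ppow_add: "x \<in> Perms \<Longrightarrow> psum (ppow x i) (ppow x j) = ppow x (i + j)"
  by (induction i) (simp_all add: psum_id ppow_Perms psum_assoc)

lemma fst_ppow: "fst (ppow (n, \<pi>) i) = i * n"
  by (induction i) (auto simp: psum_def split: prod.splits)

text \<open>A mark in the \<open>i\<close>-th of \<open>a\<close> copies splits the power into three parts; by counting, the mark can
  be matched in a power with \<open>b\<close> copies if \<open>a\<close> and \<open>b\<close> are large.\<close>

lemma tp_ppow:
  assumes \<pi>: "\<pi> \<in> perms n" and ab: "a = b \<or> 2 ^ k \<le> Suc a \<and> 2 ^ k \<le> Suc b"
  shows "tp k K (a * n) (snd (ppow (n, \<pi>) a)) (\<lambda>_. 0) = tp k K (b * n) (snd (ppow (n, \<pi>) b)) (\<lambda>_. 0)"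
  using ab
proof (induction k arbitrary: a b)
  case 0
  show ?case by (simp add: atoms_eq_iff)
next
  case (Suc k)
  define p where "p i = snd (ppow (n, \<pi>) i)" for i
  have nP: "(n, \<pi>) \<in> Perms" using \<pi> by (simp add: Perms_def)
  have pp: "ppow (n, \<pi>) i = (i * n, p i)" for i
    using fst_ppow[of n \<pi> i] by (simp add: p_def prod_eq_iff)
  have pP: "p i \<in> perms (i * n)" for i
    using ppow_Perms[OF nP, of i] by (simp add: pp Perms_def)
  have split: "p a = dsum (i * n) (p i) (dsum n \<pi> (p (a - Suc i)))" if "i < a" for i a
  proof -
    have "psum (ppow (n, \<pi>) i) (ppow (n, \<pi>) (Suc (a - Suc i))) = ppow (n, \<pi>) (i + Suc (a - Suc i))"
      by (rule ppow_add[OF nP])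
    thus ?thesis using that by (simp add: pp psum_def)
  qed
  have IH: "tp k K (a * n) (p a) (\<lambda>_. 0) = tp k K (b * n) (p b) (\<lambda>_. 0)"
    if "a = b \<or> 2 ^ k \<le> Suc a \<and> 2 ^ k \<le> Suc b" for a b
    using Suc.IH[OF that] by (simp add: p_def)
  have sub: "(\<lambda>x. tp k K (a * n) (p a) ((\<lambda>_. 0)(k := x))) ` {1..a * n} \<subseteq>
             (\<lambda>x. tp k K (b * n) (p b) ((\<lambda>_. 0)(k := x))) ` {1..b * n}"
    if ab: "a = b \<or> 2 ^ Suc k \<le> Suc a \<and> 2 ^ Suc k \<le> Suc b" for a b
  proof (rule image_subsetI)
    fix x assume x: "x \<in> {1..a * n}"
    define i where "i = (x - 1) div n"
    define y where "y = (x - 1) mod n + 1"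
    have n0: "n > 0" using x by (cases n) auto
    have ixy: "x = i * n + y" "y \<in> {1..n}"
      using x n0 by (auto simp: i_def y_def Suc_le_eq)
    have ia: "i < a"
      using x n0 unfolding i_def by (intro less_mult_imp_div_less) (cases x, auto)
    \<comment> \<open>The \<open>i\<close>-th copy among \<open>a\<close> is matched with the
      \<open>j\<close>-th among \<open>b\<close> so that the numbers of copies before them, and
      likewise after them, are equal or both at least \<open>2 ^ k - 1\<close>. A short side is
      copied exactly; if neither is short, \<open>j = 2 ^ k - 1\<close> works.\<close>
    obtain j where j: "j < b" "i = j \<or> 2 ^ k \<le> Suc i \<and> 2 ^ k \<le> Suc j"
      "a - Suc i = b - Suc j \<or> 2 ^ k \<le> Suc (a - Suc i) \<and> 2 ^ k \<le> Suc (b - Suc j)"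
    proof (cases "a = b")
      case True
      thus ?thesis using that[of i] ia by simp
    next
      case False
      define t where "t = (2::nat) ^ k"
      have t: "2 * t \<le> Suc a" "2 * t \<le> Suc b" "t \<ge> 1"
        using ab False by (auto simp: t_def)
      consider "Suc i < t" | "Suc (a - Suc i) < t" | "t \<le> Suc i" "t \<le> Suc (a - Suc i)" by linarith
      thus ?thesis
      proof cases
        case 1
        hence "t \<le> Suc (a - Suc i)" "t \<le> Suc (b - Suc i)" "i < b" using t by linarith+
        thus ?thesis using that[of i] unfolding t_def[symmetric] by blast
      next
        case 2
        define j where "j = b - Suc (a - Suc i)"
        have "j < b" "a - Suc i = b - Suc j" "t \<le> Suc i" "t \<le> Suc j"
          using 2 t ia unfolding j_def by linarith+
        thus ?thesis using that[of j] unfolding t_def[symmetric] by blast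
      next
        case 3
        have "t - 1 < b" "t \<le> Suc (t - 1)" "t \<le> Suc (b - Suc (t - 1))"
          using t by linarith+
        with 3 show ?thesis using that[of "t - 1"] unfolding t_def[symmetric] by blast
      qed
    qed
    have mk: "marked k n \<pi> ((\<lambda>_. 0)(k := y))"
      using ixy \<pi> by (simp add: marked_def)
    have ms: "msum n' (\<lambda>_. 0) (msum n ((\<lambda>_. 0)(k := y)) (\<lambda>_. 0)) = (\<lambda>_. 0)(k := n' + y)" for n'
      using ixy(2) by (auto simp: msum_def fun_eq_iff)
    have mk2: "marked k (n + l * n) (dsum n \<pi> (p l)) (msum n ((\<lambda>_. 0)(k := y)) (\<lambda>_. 0))" for l
      using ixy \<pi> pP[of l] dsum_perms[OF \<pi> pP[of l]] by (auto simp: marked_def msum_def)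
    have "tp k K (i * n + (n + (a - Suc i) * n)) (dsum (i * n) (p i) (dsum n \<pi> (p (a - Suc i))))
            (msum (i * n) (\<lambda>_. 0) (msum n ((\<lambda>_. 0)(k := y)) (\<lambda>_. 0))) =
          tp k K (j * n + (n + (b - Suc j) * n)) (dsum (j * n) (p j) (dsum n \<pi> (p (b - Suc j))))
            (msum (j * n) (\<lambda>_. 0) (msum n ((\<lambda>_. 0)(k := y)) (\<lambda>_. 0)))"
      by (intro tp_dsum IH j(2) j(3) mk mk2 refl) (simp_all add: pP)
    moreover have "i * n + (n + (a - Suc i) * n) = a * n" "j * n + (n + (b - Suc j) * n) = b * n"
      using ia j(1) by (simp_all add: add_mult_distrib[symmetric] flip: mult_Suc)
    ultimately have "tp k K (a * n) (p a) ((\<lambda>_. 0)(k := x)) = tp k K (b * n) (p b) ((\<lambda>_. 0)(k := j * n + y))"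
      unfolding ms using split[OF ia] split[OF j(1)] ixy(1) by simp
    moreover have "j * n + y \<in> {1..b * n}"
    proof -
      have "Suc j * n \<le> b * n" using j(1) by (intro mult_le_mono1) simp
      thus ?thesis using ixy(2) by simp
    qed
    ultimately show "tp k K (a * n) (p a) ((\<lambda>_. 0)(k := x)) \<in>
        (\<lambda>x. tp k K (b * n) (p b) ((\<lambda>_. 0)(k := x))) ` {1..b * n}" by blast
  qed
  show ?case
    unfolding tp_Suc_eq_iff p_def[symmetric]
    using Suc.prems by (intro conjI IH equalityI sub) auto
qed

subsection \<open>An absorbing block\<close>

text \<open>In a finite aperiodic monoid, an idempotent \<open>e\<close> generating a minimal right ideal
  satisfies \<open>e x e = e\<close> for all \<open>x\<close>.\<close>

lemma ptype_absorbing: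
  "\<exists>e\<in>Perms. \<forall>x\<in>Perms. ptype k (psum (psum e x) e) = ptype k e"
proof -
  let ?f = "ptype k"
  define N where "N = (2::nat) ^ k"
  have N: "N \<ge> 1" by (simp add: N_def)
  have one: "(0, id) \<in> Perms" by (simp add: Perms_def)
  have pow: "?f (ppow x i) = ?f (ppow x j)" if xP: "x \<in> Perms" and ij: "i \<ge> N" "j \<ge> N" for x i j
  proof -
    obtain n \<pi> where x: "x = (n, \<pi>)" "\<pi> \<in> perms n" using xP by (auto simp: Perms_def)
    have "tp k k (i * n) (snd (ppow x i)) (\<lambda>_. 0) = tp k k (j * n) (snd (ppow x j)) (\<lambda>_. 0)"
      unfolding x(1) using ij by (intro tp_ppow x(2)) (auto simp: N_def)
    moreover have "ppow x i = (i * n, snd (ppow x i))" for i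
      using fst_ppow[of n \<pi> i] by (simp add: x prod_eq_iff)
    ultimately show ?thesis by (metis (no_types, lifting) case_prod_conv ptype_def)
  qed
  define I where "I a = {?f (psum a b) | b. b \<in> Perms}" for a
  have "?f x \<in> {tp k k n \<pi> e | n \<pi> e. True}" for x
    by (cases x) (auto simp: ptype_def)
  hence fin: "finite (I a)" for a
    unfolding I_def by (intro finite_subset[OF _ finite_tp[of k k]]) blast
  \<comment> \<open>\<open>I a\<close> is the right ideal generated by \<open>a\<close>, as a set of
    types. One with fewest types is minimal: every right ideal contained in it has the same
    types.\<close>
  obtain a where a: "a \<in> Perms" "\<And>b. b \<in> Perms \<Longrightarrow> card (I a) \<le> card (I b)"
    using ex_has_least_nat[of "\<lambda>a. a \<in> Perms" "(0, id)" "\<lambda>a. card (I a)"] one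
    by blast
  define e where "e = ppow a N"
  have e: "e \<in> Perms" unfolding e_def by (intro ppow_Perms a)
  have idem: "?f (psum e e) = ?f e"
    unfolding e_def ppow_add[OF a(1)] by (rule pow[OF a(1)]) auto
  have Isub: "I (psum x y) \<subseteq> I x" if "x \<in> Perms" "y \<in> Perms" for x y
    unfolding I_def psum_assoc using psum_Perms[OF that(2)] by blast
  have "e = psum a (ppow a (N - 1))" using N unfolding e_def by (cases N) auto
  hence "I e \<subseteq> I a" using Isub[OF a(1) ppow_Perms[OF a(1)]] by simp
  hence le: "card (I e) \<le> card (I a)" by (intro card_mono fin)
  show ?thesis
  proof (intro bexI[OF _ e] ballI)
    fix x assume x: "x \<in> Perms"
    define y where "y = psum (psum e x) e"
    have y: "y \<in> Perms" unfolding y_def by (intro psum_Perms e x)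
    have "I y \<subseteq> I e" unfolding y_def psum_assoc by (intro Isub psum_Perms e x)
    moreover have "card (I e) \<le> card (I y)" using le a(2)[OF y] by simp
    ultimately have "I y = I e" using fin by (metis card_seteq)
    moreover have "?f e \<in> I e"
      unfolding I_def using one psum_id(2)[OF e] by force
    ultimately have "?f e \<in> I y" by simp
    then obtain z where z: "z \<in> Perms" "?f e = ?f (psum y z)" unfolding I_def by blast
    have ye: "?f (psum y e) = ?f y"
      unfolding y_def psum_assoc by (intro ptype_psum psum_Perms e x refl idem)
    \<comment> \<open>By minimality \<open>e\<close> is \<open>y z\<close> for some
      \<open>z\<close>, up to type; since \<open>y e\<close> and \<open>y\<close> have the same
      type, a copy of \<open>e\<close> can be placed after \<open>y\<close> and expanded again,
      which yields \<open>y ^ i z ^ i\<close>.\<close>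
    have yz: "?f e = ?f (psum (ppow y i) (ppow z i))" if "i \<ge> 1" for i
      using that
    proof (induction i rule: dec_induct)
      case base
      show ?case using z y by (simp add: psum_id)
    next
      case (step i)
      have "?f e = ?f (psum y z)" by (rule z)
      also have "\<dots> = ?f (psum (psum y e) z)"
        by (intro ptype_psum psum_Perms e y z(1) refl ye[symmetric])
      also have "\<dots> = ?f (psum (psum y (psum (ppow y i) (ppow z i))) z)"
        using step by (intro ptype_psum psum_Perms ppow_Perms e y z(1) refl)
      also have "psum (psum y (psum (ppow y i) (ppow z i))) z = psum (ppow y (Suc i)) (psum (ppow z i) (ppow z 1))"
        using z(1) by (simp add: psum_assoc psum_id)
      also have "psum (ppow z i) (ppow z 1) = ppow z (Suc i)"
        using ppow_add[OF z(1), of i 1] by simp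
      finally show ?case .
    qed
    \<comment> \<open>Aperiodicity enters here: up to type,
      \<open>y = y e = y ^ (N + 1) z ^ N = y ^ N z ^ N = e\<close>.\<close>
    have "?f y = ?f (psum y e)" by (rule ye[symmetric])
    also have "\<dots> = ?f (psum y (psum (ppow y N) (ppow z N)))"
      by (intro ptype_psum psum_Perms ppow_Perms e y z(1) refl yz N)
    also have "\<dots> = ?f (psum (ppow y (Suc N)) (ppow z N))"
      by (simp add: psum_assoc)
    also have "\<dots> = ?f (psum (ppow y N) (ppow z N))"
      by (intro ptype_psum psum_Perms ppow_Perms e y z(1) refl pow) auto
    also have "\<dots> = ?f e" by (rule yz[OF N, symmetric])
    finally show "?f (psum (psum e x) e) = ?f e" by (simp add: y_def)
  qed
qed

lemma absorbing_block:
  assumes "sentence \<phi>"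
  shows "\<exists>c \<kappa>. c \<ge> 1 \<and> \<kappa> \<in> perms c \<and>
    (\<forall>a b d \<alpha> \<beta> \<gamma>. \<alpha> \<in> perms a \<longrightarrow> \<beta> \<in> perms b \<longrightarrow> \<gamma> \<in> perms d \<longrightarrow>
      (perm_models (a + (c + (b + (c + d)))) (dsum a \<alpha> (dsum c \<kappa> (dsum b \<beta> (dsum c \<kappa> \<gamma>)))) \<phi> \<longleftrightarrow>
       perm_models (a + (c + d)) (dsum a \<alpha> (dsum c \<kappa> \<gamma>)) \<phi>))"
proof -
  let ?f = "ptype (qdepth \<phi>)"
  obtain e where e: "e \<in> Perms" "\<And>x. x \<in> Perms \<Longrightarrow> ?f (psum (psum e x) e) = ?f e"
    using ptype_absorbing by blast
  define u :: "nat \<times> (nat \<Rightarrow> nat)" where "u = (1, id)"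
  have u: "u \<in> Perms" by (simp add: u_def Perms_def)
  \<comment> \<open>The inserted one-point permutation makes the block nonempty; by absorption the
    type remains that of \<open>e\<close>.\<close>
  define g where "g = psum (psum e u) e"
  have g: "g \<in> Perms" "?f g = ?f e"
    unfolding g_def by (intro psum_Perms e(1) u) (rule e(2)[OF u])
  have absorb: "?f (psum (psum g x) g) = ?f g" if x: "x \<in> Perms" for x
  proof -
    have "?f (psum (psum g x) g) = ?f (psum (psum e x) e)"
      by (intro ptype_psum psum_Perms g e(1) x refl)
    thus ?thesis using e(2)[OF x] g(2) by simp
  qed
  obtain c \<kappa> where c: "g = (c, \<kappa>)" "\<kappa> \<in> perms c"
    using g(1) by (auto simp: Perms_def)
  have fst_psum: "fst (psum x y) = fst x + fst y" for x y
    by (simp add: psum_def split: prod.splits)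
  have "c = fst g" by (simp only: c(1) fst_conv)
  hence "c \<ge> 1" by (simp add: g_def fst_psum u_def)
  moreover have "perm_models (a + (c + (b + (c + d)))) (dsum a \<alpha> (dsum c \<kappa> (dsum b \<beta> (dsum c \<kappa> \<gamma>)))) \<phi> \<longleftrightarrow>
       perm_models (a + (c + d)) (dsum a \<alpha> (dsum c \<kappa> \<gamma>)) \<phi>"
    if "\<alpha> \<in> perms a" "\<beta> \<in> perms b" "\<gamma> \<in> perms d" for a b d \<alpha> \<beta> \<gamma>
  proof (rule perm_models_ptype[OF assms])
    have P: "(a, \<alpha>) \<in> Perms" "(b, \<beta>) \<in> Perms" "(d, \<gamma>) \<in> Perms"
      using that by (auto simp: Perms_def)
    have "?f (psum (a, \<alpha>) (psum (psum (psum g (b, \<beta>)) g) (d, \<gamma>))) = ?f (psum (a, \<alpha>) (psum g (d, \<gamma>)))"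
      by (intro ptype_psum psum_Perms P g(1) refl absorb)
    thus "?f (a + (c + (b + (c + d))), dsum a \<alpha> (dsum c \<kappa> (dsum b \<beta> (dsum c \<kappa> \<gamma>)))) =
          ?f (a + (c + d), dsum a \<alpha> (dsum c \<kappa> \<gamma>))"
      by (simp only: psum_assoc c(1)) (simp only: psum_def prod.case)
  qed
  ultimately show ?thesis using c(2) by blast
qed

section \<open>Limits for fixed \<open>q\<close>\<close>

subsection \<open>Inversions of direct sums and the normalising constant\<close>

definition inversions :: "nat \<Rightarrow> (nat \<Rightarrow> nat) \<Rightarrow> (nat \<times> nat) set" where
  "inversions n \<pi> = {(i, j). i \<in> {1..n} \<and> j \<in> {1..n} \<and> i < j \<and> \<pi> i > \<pi> j}"

lemma inv_count_card: "inv_count n \<pi> = card (inversions n \<pi>)"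
  by (simp add: inv_count_def inversions_def)

lemma finite_inversions [simp]: "finite (inversions n \<pi>)"
  by (rule finite_subset[of _ "{1..n} \<times> {1..n}"]) (auto simp: inversions_def)

lemma inv_count_dsum:
  assumes "\<pi> \<in> perms n" "\<sigma> \<in> perms m"
  shows "inv_count (n + m) (dsum n \<pi> \<sigma>) = inv_count n \<pi> + inv_count m \<sigma>"
proof -
  define sh where "sh = (\<lambda>(i, j). (n + i, n + j :: nat))"
  have "inversions (n + m) (dsum n \<pi> \<sigma>) = inversions n \<pi> \<union> sh ` inversions m \<sigma>"
  proof (intro equalityI subsetI)
    fix x assume "x \<in> inversions (n + m) (dsum n \<pi> \<sigma>)"
    then obtain i j where x: "x = (i, j)" "1 \<le> i" "i < j" "j \<le> n + m" "dsum n \<pi> \<sigma> j < dsum n \<pi> \<sigma> i"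
      by (auto simp: inversions_def)
    consider "j \<le> n" | "i \<le> n" "n < j" | "n < i" by linarith
    thus "x \<in> inversions n \<pi> \<union> sh ` inversions m \<sigma>"
    proof cases
      case 1
      thus ?thesis using x by (auto simp: inversions_def dsum_def)
    next
      case 2
      have "\<pi> i \<le> n" using perms_le[OF assms(1)] 2 by simp
      hence False using 2 x(5) by (simp add: dsum_def)
      thus ?thesis ..
    next
      case 3
      have "(i - n, j - n) \<in> inversions m \<sigma>"
        using 3 x by (auto simp: inversions_def dsum_def)
      moreover have "x = sh (i - n, j - n)" using 3 x by (simp add: sh_def)
      ultimately show ?thesis by blast
    qed
  next
    fix x assume "x \<in> inversions n \<pi> \<union> sh ` inversions m \<sigma>"
    thus "x \<in> inversions (n + m) (dsum n \<pi> \<sigma>)"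
      by (auto simp: inversions_def dsum_def sh_def)
  qed
  moreover have "card (inversions n \<pi> \<union> sh ` inversions m \<sigma>) =
      card (inversions n \<pi>) + card (sh ` inversions m \<sigma>)"
    by (rule card_Un_disjoint, simp, simp) (auto simp: inversions_def sh_def)
  moreover have "card (sh ` inversions m \<sigma>) = card (inversions m \<sigma>)"
    by (rule card_image) (auto simp: inj_on_def sh_def)
  ultimately show ?thesis by (simp add: inv_count_card)
qed

section \<open>The normalising constant as a product\<close>

definition insert_max :: "nat \<Rightarrow> nat \<Rightarrow> (nat \<Rightarrow> nat) \<Rightarrow> nat \<Rightarrow> nat" where
  "insert_max n j \<pi> i =
     (if i < j then \<pi> i else if i = j then Suc n else if i \<le> Suc n then \<pi> (i - 1) else i)"

lemma insert_max_perms: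
  assumes "\<pi> \<in> perms n" "j \<in> {1..Suc n}"
  shows "insert_max n j \<pi> \<in> perms (Suc n)"
proof (rule permsI)
  have in1: "insert_max n j \<pi> i \<in> {1..n}" if "i \<in> {1..Suc n}" "i \<noteq> j" for i
    using that assms(2) perms_in[OF assms(1), of i] perms_in[OF assms(1), of "i - 1"]
    by (auto simp: insert_max_def)
  show "inj_on (insert_max n j \<pi>) {1..Suc n}"
  proof (rule inj_onI)
    fix i l assume il: "i \<in> {1..Suc n}" "l \<in> {1..Suc n}" "insert_max n j \<pi> i = insert_max n j \<pi> l"
    have j: "insert_max n j \<pi> j = Suc n" by (simp add: insert_max_def)
    show "i = l"
    proof (cases "i = j \<or> l = j")
      case True
      thus ?thesis using in1[OF il(1)] in1[OF il(2)] j il(3) by (cases "i = j"; cases "l = j") auto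
    next
      case False
      hence "(if i < j then i else i - 1) = (if l < j then l else l - 1)"
        using il perms_inj[OF assms(1)] by (auto simp: insert_max_def split: if_splits)
      thus ?thesis using False il by (auto split: if_splits)
    qed
  qed
  fix i assume "i \<in> {1..Suc n}"
  thus "insert_max n j \<pi> i \<in> {1..Suc n}"
    using in1[of i] by (cases "i = j") (auto simp: insert_max_def)
next
  fix i assume "i \<notin> {1..Suc n}"
  thus "insert_max n j \<pi> i = i"
    using assms(2) perms_0[OF assms(1)] by (cases "i = 0") (auto simp: insert_max_def)
qed

text \<open>The new maximum is inverted with exactly the entries to its right, and the order among
  the old entries is unchanged.\<close>

lemma inv_count_insert_max:
  assumes "\<pi> \<in> perms n" "j \<in> {1..Suc n}"
  shows "inv_count (Suc n) (insert_max n j \<pi>) = inv_count n \<pi> + (Suc n - j)"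
proof -
  define sk where "sk i = (if i < j then i else Suc i)" for i
  define sh where "sh = (\<lambda>(i, l). (sk i, sk l))"
  have sk_less: "sk i < sk l \<longleftrightarrow> i < l" for i l by (auto simp: sk_def)
  have sk_val: "insert_max n j \<pi> (sk i) = \<pi> i" if "i \<in> {1..n}" for i
    using that assms(2) by (auto simp: insert_max_def sk_def)
  have sk_in: "sk i \<in> {1..Suc n}" if "i \<in> {1..n}" for i
    using that by (auto simp: sk_def)
  have sk_surj: "\<exists>l\<in>{1..n}. i = sk l" if "i \<in> {1..Suc n}" "i \<noteq> j" for i
    using that assms(2) by (intro bexI[of _ "if i < j then i else i - 1"]) (auto simp: sk_def)
  have j: "insert_max n j \<pi> j = Suc n" by (simp add: insert_max_def)
  have le: "insert_max n j \<pi> i \<le> Suc n" if "i \<in> {1..Suc n}" for i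
    using perms_in[OF insert_max_perms[OF assms], of i] that by simp
  have "inversions (Suc n) (insert_max n j \<pi>) = sh ` inversions n \<pi> \<union> {j} \<times> {Suc j..Suc n}"
  proof (intro equalityI subsetI)
    fix x assume "x \<in> inversions (Suc n) (insert_max n j \<pi>)"
    then obtain i l where x: "x = (i, l)" "i \<in> {1..Suc n}" "l \<in> {1..Suc n}" "i < l"
      "insert_max n j \<pi> l < insert_max n j \<pi> i" by (auto simp: inversions_def)
    have lj: "l \<noteq> j" using le[OF x(2)] x(5) j by auto
    show "x \<in> sh ` inversions n \<pi> \<union> {j} \<times> {Suc j..Suc n}"
    proof (cases "i = j")
      case True
      thus ?thesis using x by auto
    next
      case False
      obtain i' l' where il: "i' \<in> {1..n}" "i = sk i'" "l' \<in> {1..n}" "l = sk l'"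
        using sk_surj[OF x(2) False] sk_surj[OF x(3) lj] by blast
      hence "(i', l') \<in> inversions n \<pi>"
        using x sk_less sk_val by (auto simp: inversions_def)
      moreover have "x = sh (i', l')" by (simp add: sh_def x il)
      ultimately show ?thesis by blast
    qed
  next
    fix x assume "x \<in> sh ` inversions n \<pi> \<union> {j} \<times> {Suc j..Suc n}"
    thus "x \<in> inversions (Suc n) (insert_max n j \<pi>)"
    proof
      assume "x \<in> sh ` inversions n \<pi>"
      then obtain i l where "x = (sk i, sk l)" "i \<in> {1..n}" "l \<in> {1..n}" "i < l" "\<pi> l < \<pi> i"
        by (auto simp: inversions_def sh_def)
      thus ?thesis using sk_in[of i] sk_in[of l] sk_val sk_less by (simp add: inversions_def)
    next
      assume "x \<in> {j} \<times> {Suc j..Suc n}"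
      then obtain l where l: "x = (j, l)" "j < l" "l \<le> Suc n" by auto
      obtain l' where "l' \<in> {1..n}" "l = sk l'" using sk_surj[of l] l assms(2) by auto
      hence "insert_max n j \<pi> l < Suc n" using sk_val[of l'] perms_in[OF assms(1), of l'] by simp
      thus ?thesis using l j assms(2) by (simp add: inversions_def)
    qed
  qed
  moreover have "card (sh ` inversions n \<pi> \<union> {j} \<times> {Suc j..Suc n}) =
      card (sh ` inversions n \<pi>) + card ({j} \<times> {Suc j..Suc n})"
    by (rule card_Un_disjoint, simp, simp) (auto simp: sh_def sk_def inversions_def split: if_splits)
  moreover have "card (sh ` inversions n \<pi>) = card (inversions n \<pi>)"
    by (rule card_image) (auto simp: inj_on_def sh_def sk_def split: if_splits)
  ultimately show ?thesis by (simp add: inv_count_card card_cartesian_product)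
qed

lemma bij_insert_max:
  "bij_betw (\<lambda>(j, \<pi>). insert_max n j \<pi>) ({1..Suc n} \<times> perms n) (perms (Suc n))"
proof -
  have inj: "inj_on (\<lambda>(j, \<pi>). insert_max n j \<pi>) ({1..Suc n} \<times> perms n)"
  proof (rule inj_onI, clarify)
    fix j \<pi> j' \<pi>' assume *: "j \<in> {1..Suc n}" "j' \<in> {1..Suc n}" "\<pi> \<in> perms n" "\<pi>' \<in> perms n"
      "insert_max n j \<pi> = insert_max n j' \<pi>'"
    have nle: "\<not> j < j'" if "j \<in> {1..Suc n}" "j' \<in> {1..Suc n}" "\<pi>' \<in> perms n"
      "insert_max n j \<pi> = insert_max n j' \<pi>'" for j j' \<pi> \<pi>'
    proof
      assume "j < j'"
      hence "Suc n = \<pi>' j" using fun_cong[OF that(4), of j] by (simp add: insert_max_def)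
      moreover have "\<pi>' j \<le> n" using perms_le[OF that(3), of j] \<open>j < j'\<close> that(2) by simp
      ultimately show False by simp
    qed
    have j: "j = j'" using nle[OF *(1,2,4,5)] nle[OF *(2,1,3) *(5)[symmetric]] by simp
    have "\<pi> i = \<pi>' i" for i
    proof (cases "i \<le> n")
      case True
      define l where "l = (if i < j then i else Suc i)"
      have "insert_max n j \<pi> l = \<pi> i" "insert_max n j' \<pi>' l = \<pi>' i"
        using True *(1) j by (auto simp: insert_max_def l_def)
      thus ?thesis using *(5) by simp
    next
      case False
      thus ?thesis using perms_out[OF *(3), of i] perms_out[OF *(4), of i] by simp
    qed
    thus "j = j' \<and> \<pi> = \<pi>'" using j by blast
  qed
  have "(\<lambda>(j, \<pi>). insert_max n j \<pi>) ` ({1..Suc n} \<times> perms n) = perms (Suc n)"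
  proof (rule card_subset_eq)
    show "(\<lambda>(j, \<pi>). insert_max n j \<pi>) ` ({1..Suc n} \<times> perms n) \<subseteq> perms (Suc n)"
      using insert_max_perms by auto
    have "card (perms m) = fact m" for m
      unfolding perms_def by (rule card_permutations) auto
    thus "card ((\<lambda>(j, \<pi>). insert_max n j \<pi>) ` ({1..Suc n} \<times> perms n)) = card (perms (Suc n))"
      unfolding card_image[OF inj] card_cartesian_product by simp
  qed simp
  with inj show ?thesis by (simp add: bij_betw_def)
qed

text \<open>The scaling by \<open>(1 - q) ^ n\<close> is compatible with direct sums, and with it
  the totals become the partial products of \<open>(1 - q ^ i)\<close>, whose limit is positive for
  \<open>q < 1\<close>.\<close>

definition wt :: "real \<Rightarrow> nat \<Rightarrow> (nat \<Rightarrow> nat) \<Rightarrow> real" where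
  "wt q n \<pi> = (1 - q) ^ n * q ^ inv_count n \<pi>"

definition wtot :: "real \<Rightarrow> nat \<Rightarrow> real" where
  "wtot q n = (\<Sum>\<pi>\<in>perms n. wt q n \<pi>)"

lemma wt_dsum:
  "\<pi> \<in> perms n \<Longrightarrow> \<sigma> \<in> perms m \<Longrightarrow> wt q (n + m) (dsum n \<pi> \<sigma>) = wt q n \<pi> * wt q m \<sigma>"
  by (simp add: wt_def inv_count_dsum power_add)

lemma wtot_0 [simp]: "wtot q 0 = 1"
  by (simp add: wtot_def wt_def inv_count_def)

text \<open>Summing over the position of the maximum gives a geometric sum, in which
  \<open>1 - q\<close> cancels the denominator.\<close>

lemma wtot_Suc:
  assumes "q \<noteq> 1"
  shows "wtot q (Suc n) = wtot q n * (1 - q ^ Suc n)"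
proof -
  have "wtot q (Suc n) = (\<Sum>(j, \<pi>)\<in>{1..Suc n} \<times> perms n. wt q (Suc n) (insert_max n j \<pi>))"
    unfolding wtot_def by (subst sum.reindex_bij_betw[OF bij_insert_max, symmetric]) (simp add: case_prod_unfold)
  also have "\<dots> = (\<Sum>(j, \<pi>)\<in>{1..Suc n} \<times> perms n. ((1 - q) * q ^ (Suc n - j)) * wt q n \<pi>)"
  proof (rule sum.cong[OF refl])
    fix x assume "x \<in> {1..Suc n} \<times> perms n"
    then obtain j \<pi> where x: "x = (j, \<pi>)" "j \<in> {1..Suc n}" "\<pi> \<in> perms n" by auto
    show "(case x of (j, \<pi>) \<Rightarrow> wt q (Suc n) (insert_max n j \<pi>)) =
          (case x of (j, \<pi>) \<Rightarrow> ((1 - q) * q ^ (Suc n - j)) * wt q n \<pi>)"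
      using inv_count_insert_max[OF x(3,2)] by (simp add: x(1) wt_def power_add)
  qed
  also have "\<dots> = (\<Sum>j\<in>{1..Suc n}. (1 - q) * q ^ (Suc n - j)) * wtot q n"
    by (simp only: sum.cartesian_product[symmetric] wtot_def sum_product)
  also have "(\<Sum>j\<in>{1..Suc n}. (1 - q) * q ^ (Suc n - j)) = (1 - q) * (\<Sum>j<Suc n. q ^ j)"
    unfolding sum_distrib_left
    by (rule sum.reindex_bij_witness[of _ "\<lambda>j. Suc n - j" "\<lambda>j. Suc n - j"]) auto
  also have "\<dots> = 1 - q ^ Suc n"
    by (rule one_diff_power_eq[symmetric])
  finally show ?thesis by simp
qed

text \<open>Positivity of the limit: choose \<open>n0\<close> with the sum of \<open>q ^ i\<close>
  over \<open>i > n0\<close> at most \<open>1 / 2\<close>; since a product of factors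
  \<open>1 - x\<close> is at least 1 minus the sum of the \<open>x\<close>, the remaining factors
  never lose more than half of \<open>wtot q n0\<close>.\<close>

lemma wtot_properties:
  assumes q: "0 < q" "q < 1"
  shows "wtot q n > 0" "wtot q n \<le> 1" "decseq (wtot q)"
    and "\<exists>w>0. wtot q \<longlonglongrightarrow> w \<and> (\<forall>n. w \<le> wtot q n)"
proof -
  have pow0: "0 \<le> q ^ Suc n" for n
    using q by simp
  have pow1: "q ^ Suc n < 1" for n
    by (rule power_Suc_less_one) (use q in auto)
  note pow = pow0 pow1
  have pos: "wtot q n > 0" for n
  proof (induction n)
    case (Suc n)
    have "q \<noteq> 1" using q by simp
    show ?case
      unfolding wtot_Suc[OF \<open>q \<noteq> 1\<close>] using Suc.IH pow(2)[of n] by (intro mult_pos_pos) linarith+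
  qed simp
  thus "wtot q n > 0" .
  show dec: "decseq (wtot q)"
  proof (rule decseq_SucI)
    fix n
    have "wtot q n * (1 - q ^ Suc n) \<le> wtot q n * 1"
      using pos[of n] pow(1)[of n] by (intro mult_left_mono) linarith+
    thus "wtot q (Suc n) \<le> wtot q n" using q by (simp add: wtot_Suc)
  qed
  show "wtot q n \<le> 1" using decseqD[OF dec, of 0 n] by simp
  have "(\<lambda>n. q ^ n / (1 - q)) \<longlonglongrightarrow> 0 / (1 - q)"
    using q by (intro tendsto_divide LIMSEQ_realpow_zero tendsto_const) auto
  hence "eventually (\<lambda>n. q ^ n / (1 - q) < 1 / 2) sequentially"
    by (intro order_tendstoD) auto
  then obtain n0 where n0: "q ^ n0 / (1 - q) < 1 / 2"
    by (auto simp: eventually_sequentially)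
  have sum_le: "(\<Sum>i=1..m. q ^ (n0 + i)) \<le> 1 / 2" for m
  proof -
    have "(\<Sum>i=1..m. q ^ (n0 + i)) \<le> (\<Sum>i<Suc m. q ^ (n0 + i))"
      using q by (intro sum_mono2) auto
    also have "\<dots> = q ^ n0 * (\<Sum>i<Suc m. q ^ i)"
      by (simp only: power_add sum_distrib_left)
    also have "(\<Sum>i<Suc m. q ^ i) = (1 - q ^ Suc m) / (1 - q)"
      using q one_diff_power_eq[of q "Suc m"] by (simp add: field_simps)
    also have "q ^ n0 * ((1 - q ^ Suc m) / (1 - q)) \<le> q ^ n0 * (1 / (1 - q))"
      using q pow(1)[of m] by (intro mult_left_mono divide_right_mono) auto
    also have "q ^ n0 * (1 / (1 - q)) = q ^ n0 / (1 - q)" by simp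
    finally show ?thesis using n0 by linarith
  qed
  have lower: "wtot q n0 * (1 - (\<Sum>i=1..m. q ^ (n0 + i))) \<le> wtot q (n0 + m)" for m
  proof (induction m)
    case (Suc m)
    define S where "S = (\<Sum>i=1..m. q ^ (n0 + i))"
    define x where "x = q ^ Suc (n0 + m)"
    have S: "S \<ge> 0" unfolding S_def using q by (intro sum_nonneg) auto
    have x: "0 \<le> x" "x < 1" using pow(1,2)[of "n0 + m"] by (simp_all only: x_def)
    have "1 - (S + x) \<le> (1 - S) * (1 - x)"
      using S x by (simp add: algebra_simps)
    hence "wtot q n0 * (1 - (S + x)) \<le> wtot q n0 * (1 - S) * (1 - x)"
      using pos[of n0] by (simp add: mult.assoc mult_left_mono)
    also have "\<dots> \<le> wtot q (n0 + m) * (1 - x)"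
      using Suc.IH x unfolding S_def by (intro mult_right_mono) auto
    also have "\<dots> = wtot q (n0 + Suc m)"
      using q by (simp add: wtot_Suc x_def)
    finally show ?case by (simp add: S_def x_def)
  qed simp
  define d where "d = wtot q n0 / 2"
  have d: "d > 0" using pos[of n0] by (simp add: d_def)
  have dle: "d \<le> wtot q n" for n
  proof -
    have "wtot q n0 * (1 / 2) \<le> wtot q n0 * (1 - (\<Sum>i=1..n. q ^ (n0 + i)))"
      using sum_le[of n] pos[of n0] by (intro mult_left_mono) auto
    also have "\<dots> \<le> wtot q (n0 + n)" by (rule lower)
    also have "\<dots> \<le> wtot q n" using decseqD[OF dec, of n "n0 + n"] by simp
    finally show ?thesis by (simp add: d_def)
  qed
  obtain w where w: "wtot q \<longlonglongrightarrow> w" "\<forall>n. w \<le> wtot q n"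
    using decseq_convergent[OF dec, of d] dle by auto
  have "d \<le> w" by (rule LIMSEQ_le_const[OF w(1)]) (use dle in auto)
  with d w show "\<exists>w>0. wtot q \<longlonglongrightarrow> w \<and> (\<forall>n. w \<le> wtot q n)"
    by (intro exI[of _ w]) auto
qed

subsection \<open>Decomposition at occurrences of a block\<close>

definition wsum :: "real \<Rightarrow> nat \<Rightarrow> ((nat \<Rightarrow> nat) \<Rightarrow> bool) \<Rightarrow> real" where
  "wsum q n P = (\<Sum>\<pi> | \<pi> \<in> perms n \<and> P \<pi>. wt q n \<pi>)"

lemma wt_nonneg: "0 < q \<Longrightarrow> q < 1 \<Longrightarrow> wt q n \<pi> \<ge> 0"
  by (simp add: wt_def)

lemma wsum_nonneg: "0 < q \<Longrightarrow> q < 1 \<Longrightarrow> wsum q n P \<ge> 0"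
  unfolding wsum_def by (intro sum_nonneg wt_nonneg)

lemma wsum_mono:
  "0 < q \<Longrightarrow> q < 1 \<Longrightarrow> (\<And>\<pi>. \<pi> \<in> perms n \<Longrightarrow> P \<pi> \<Longrightarrow> Q \<pi>) \<Longrightarrow> wsum q n P \<le> wsum q n Q"
  unfolding wsum_def by (intro sum_mono2 wt_nonneg) auto

lemma wsum_cong: "(\<And>\<pi>. \<pi> \<in> perms n \<Longrightarrow> P \<pi> \<longleftrightarrow> Q \<pi>) \<Longrightarrow> wsum q n P = wsum q n Q"
  unfolding wsum_def by (intro sum.cong) auto

lemma wsum_True: "wsum q n (\<lambda>_. True) = wtot q n"
  by (simp add: wsum_def wtot_def)

lemma wsum_le_wtot: "0 < q \<Longrightarrow> q < 1 \<Longrightarrow> wsum q n P \<le> wtot q n"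
  unfolding wsum_True[symmetric] by (rule wsum_mono) auto

lemma dsum_inject:
  assumes "\<alpha> \<in> perms n" "\<alpha>' \<in> perms n" "\<beta> \<in> perms m" "\<beta>' \<in> perms m"
    and "dsum n \<alpha> \<beta> = dsum n \<alpha>' \<beta>'"
  shows "\<alpha> = \<alpha>' \<and> \<beta> = \<beta>'"
proof
  show "\<alpha> = \<alpha>'"
  proof
    fix i show "\<alpha> i = \<alpha>' i"
      using fun_cong[OF assms(5), of i] perms_out[OF assms(1), of i] perms_out[OF assms(2), of i]
      by (cases "i \<le> n") (auto simp: dsum_def)
  qed
  show "\<beta> = \<beta>'"
  proof
    fix i show "\<beta> i = \<beta>' i"
      using fun_cong[OF assms(5), of "n + i"] perms_0[OF assms(3)] perms_0[OF assms(4)]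
      by (cases "i = 0") (auto simp: dsum_def)
  qed
qed

text \<open>By injectivity the first \<open>s\<close> values fill \<open>{1..s}\<close>, so every
  later value exceeds \<open>s\<close> and the remainder is a permutation after subtracting
  \<open>s\<close>.\<close>

lemma cut_decomposition:
  assumes \<pi>: "\<pi> \<in> perms (s + m)" and cut: "\<And>i. i \<in> {1..s} \<Longrightarrow> \<pi> i \<le> s"
  shows "\<exists>\<alpha>\<in>perms s. \<exists>\<beta>\<in>perms m. \<pi> = dsum s \<alpha> \<beta>"
proof -
  define \<alpha> where "\<alpha> i = (if i \<le> s then \<pi> i else i)" for i
  define \<beta> where "\<beta> i = (if i = 0 then 0 else \<pi> (s + i) - s)" for i
  have \<alpha>: "\<alpha> \<in> perms s"
  proof (rule permsI)
    show "inj_on \<alpha> {1..s}" using perms_inj[OF \<pi>] by (auto simp: inj_on_def \<alpha>_def)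
    show "\<alpha> i \<in> {1..s}" if "i \<in> {1..s}" for i
      using cut[OF that] perms_in[OF \<pi>, of i] that by (simp add: \<alpha>_def)
    show "\<alpha> i = i" if "i \<notin> {1..s}" for i
      using that perms_0[OF \<pi>] by (cases "i = 0") (auto simp: \<alpha>_def)
  qed
  have gt: "\<pi> (s + i) > s" if "i > 0" for i
  proof (rule ccontr)
    assume *: "\<not> \<pi> (s + i) > s"
    have "\<pi> (s + i) \<noteq> 0" using perms_inj[OF \<pi>, of "s + i" 0] perms_0[OF \<pi>] that by simp
    hence "\<pi> (s + i) \<in> {1..s}" using * by auto
    moreover have "\<alpha> ` {1..s} = {1..s}"
      using \<alpha> unfolding perms_def by (auto simp: permutes_image)
    ultimately obtain l where l: "l \<in> {1..s}" "\<alpha> l = \<pi> (s + i)" by (metis imageE)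
    hence "\<pi> l = \<pi> (s + i)" by (simp add: \<alpha>_def)
    thus False using perms_inj[OF \<pi>, of l "s + i"] l that by simp
  qed
  have "\<beta> \<in> perms m"
  proof (rule permsI)
    show "inj_on \<beta> {1..m}"
    proof (rule inj_onI)
      fix i l assume il: "i \<in> {1..m}" "l \<in> {1..m}" "\<beta> i = \<beta> l"
      hence "\<pi> (s + i) = \<pi> (s + l)" using gt[of i] gt[of l] by (simp add: \<beta>_def)
      thus "i = l" using perms_inj[OF \<pi>] by simp
    qed
    show "\<beta> i \<in> {1..m}" if "i \<in> {1..m}" for i
      using gt[of i] perms_in[OF \<pi>, of "s + i"] that by (auto simp: \<beta>_def)
    show "\<beta> i = i" if "i \<notin> {1..m}" for i
      using that perms_out[OF \<pi>, of "s + i"] by (cases "i = 0") (auto simp: \<beta>_def)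
  qed
  moreover have "\<pi> = dsum s \<alpha> \<beta>"
  proof
    fix i show "\<pi> i = dsum s \<alpha> \<beta> i"
      using gt[of "i - s"] by (cases "i \<le> s") (auto simp: dsum_def \<alpha>_def \<beta>_def)
  qed
  ultimately show ?thesis using \<alpha> by blast
qed

text \<open>The block is required as a direct summand, hence the cut after position
  \<open>s\<close>; equal relative order of some entries would not be enough to split the
  type.\<close>

definition occurs :: "nat \<Rightarrow> (nat \<Rightarrow> nat) \<Rightarrow> nat \<Rightarrow> (nat \<Rightarrow> nat) \<Rightarrow> bool" where
  "occurs c \<kappa> s \<pi> \<longleftrightarrow> (\<forall>i\<in>{1..s}. \<pi> i \<le> s) \<and> (\<forall>i\<in>{1..c}. \<pi> (s + i) = s + \<kappa> i)"

lemma occurs_dsum: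
  assumes "\<alpha> \<in> perms s"
  shows "occurs c \<kappa> s (dsum s \<alpha> (dsum c \<kappa> \<beta>))"
  using perms_le[OF assms] by (auto simp: occurs_def dsum_def)

lemma occurs_local:
  assumes "\<And>i. 1 \<le> i \<Longrightarrow> i \<le> s + c \<Longrightarrow> \<pi> i = \<pi>' i"
  shows "occurs c \<kappa> s \<pi> \<longleftrightarrow> occurs c \<kappa> s \<pi>'"
  using assms by (auto simp: occurs_def)

lemma occurs_shift:
  assumes "\<delta> \<in> perms s"
  shows "occurs c \<kappa> (s + t) (dsum s \<delta> \<rho>) \<longleftrightarrow> occurs c \<kappa> t \<rho>"
proof -
  have "(\<forall>i\<in>{1..s + t}. dsum s \<delta> \<rho> i \<le> s + t) \<longleftrightarrow> (\<forall>i\<in>{1..t}. \<rho> i \<le> t)"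
  proof
    assume *: "\<forall>i\<in>{1..s + t}. dsum s \<delta> \<rho> i \<le> s + t"
    show "\<forall>i\<in>{1..t}. \<rho> i \<le> t"
    proof
      fix i assume "i \<in> {1..t}"
      thus "\<rho> i \<le> t" using *[rule_format, of "s + i"] by (auto simp: dsum_def)
    qed
  next
    assume *: "\<forall>i\<in>{1..t}. \<rho> i \<le> t"
    show "\<forall>i\<in>{1..s + t}. dsum s \<delta> \<rho> i \<le> s + t"
    proof
      fix i assume i: "i \<in> {1..s + t}"
      hence "i - s \<le> t" by auto
      thus "dsum s \<delta> \<rho> i \<le> s + t"
        using i *[rule_format, of "i - s"] perms_le[OF assms, of i] by (auto simp: dsum_def)
    qed
  qed
  moreover have "(\<forall>i\<in>{1..c}. dsum s \<delta> \<rho> (s + t + i) = s + t + \<kappa> i) \<longleftrightarrow> (\<forall>i\<in>{1..c}. \<rho> (t + i) = t + \<kappa> i)"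
    by (intro ball_cong refl) (auto simp: dsum_def add.assoc)
  ultimately show ?thesis by (simp add: occurs_def)
qed

lemma occurs_decomposition:
  assumes \<kappa>: "\<kappa> \<in> perms c" and \<pi>: "\<pi> \<in> perms (s + (c + m))" and occ: "occurs c \<kappa> s \<pi>"
  shows "\<exists>\<alpha>\<in>perms s. \<exists>\<beta>\<in>perms m. \<pi> = dsum s \<alpha> (dsum c \<kappa> \<beta>)"
proof -
  obtain \<alpha> \<rho> where \<alpha>: "\<alpha> \<in> perms s" "\<rho> \<in> perms (c + m)" "\<pi> = dsum s \<alpha> \<rho>"
    using cut_decomposition[OF \<pi>] occ by (auto simp: occurs_def)
  have \<rho>: "\<rho> i = \<kappa> i" if "i \<in> {1..c}" for i
    using occ that unfolding occurs_def \<alpha>(3) by (auto simp: dsum_def)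
  obtain \<kappa>' \<beta> where \<beta>: "\<kappa>' \<in> perms c" "\<beta> \<in> perms m" "\<rho> = dsum c \<kappa>' \<beta>"
    using cut_decomposition[OF \<alpha>(2)] \<rho> perms_in[OF \<kappa>] by auto
  have "\<kappa>' = \<kappa>"
  proof
    fix i show "\<kappa>' i = \<kappa> i"
    proof (cases "i \<in> {1..c}")
      case True
      thus ?thesis using \<rho>[OF True] \<beta>(3) by (simp add: dsum_def)
    next
      case False
      thus ?thesis
        using perms_out[OF \<kappa>, of i] perms_out[OF \<beta>(1), of i] perms_0[OF \<kappa>] perms_0[OF \<beta>(1)]
        by (cases "i = 0") auto
    qed
  qed
  thus ?thesis using \<alpha> \<beta> by blast
qed

lemma sum_wt_dsum:
  assumes "A \<subseteq> perms n" "B \<subseteq> perms m"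
  shows "(\<Sum>\<pi>\<in>(\<lambda>(\<alpha>, \<beta>). dsum n \<alpha> \<beta>) ` (SIGMA \<alpha>:A. {\<beta> \<in> B. P \<alpha> \<beta>}). wt q (n + m) \<pi>) =
         (\<Sum>\<alpha>\<in>A. wt q n \<alpha> * (\<Sum>\<beta> | \<beta> \<in> B \<and> P \<alpha> \<beta>. wt q m \<beta>))"
proof -
  have inj: "inj_on (\<lambda>(\<alpha>, \<beta>). dsum n \<alpha> \<beta>) (SIGMA \<alpha>:A. {\<beta> \<in> B. P \<alpha> \<beta>})"
    using assms dsum_inject by (auto simp: inj_on_def) blast+
  have fin: "finite A" "finite B"
    using assms finite_subset finite_perms by blast+
  have "(\<Sum>\<pi>\<in>(\<lambda>(\<alpha>, \<beta>). dsum n \<alpha> \<beta>) ` (SIGMA \<alpha>:A. {\<beta> \<in> B. P \<alpha> \<beta>}). wt q (n + m) \<pi>) =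
        (\<Sum>(\<alpha>, \<beta>)\<in>(SIGMA \<alpha>:A. {\<beta> \<in> B. P \<alpha> \<beta>}). wt q n \<alpha> * wt q m \<beta>)"
    unfolding sum.reindex[OF inj] using assms by (intro sum.cong) (auto intro!: wt_dsum)
  also have "\<dots> = (\<Sum>\<alpha>\<in>A. \<Sum>\<beta> | \<beta> \<in> B \<and> P \<alpha> \<beta>. wt q n \<alpha> * wt q m \<beta>)"
    using fin by (subst sum.Sigma[symmetric]) auto
  finally show ?thesis by (simp add: sum_distrib_left)
qed

definition avoids :: "nat \<Rightarrow> (nat \<Rightarrow> nat) \<Rightarrow> nat \<Rightarrow> (nat \<Rightarrow> nat) \<Rightarrow> bool" where
  "avoids c \<kappa> n \<pi> \<longleftrightarrow> (\<forall>s. s + c \<le> n \<longrightarrow> \<not> occurs c \<kappa> s \<pi>)"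

text \<open>An earlier occurrence may overlap the block that follows the prefix, so the test is made
  on the prefix together with that block.\<close>

definition before_first :: "nat \<Rightarrow> (nat \<Rightarrow> nat) \<Rightarrow> nat \<Rightarrow> (nat \<Rightarrow> nat) \<Rightarrow> bool" where
  "before_first c \<kappa> s \<alpha> \<longleftrightarrow> (\<forall>t<s. \<not> occurs c \<kappa> t (dsum s \<alpha> \<kappa>))"

text \<open>The leading block is included for the same reason: a later occurrence may begin inside
  it.\<close>

definition after_last :: "nat \<Rightarrow> (nat \<Rightarrow> nat) \<Rightarrow> nat \<Rightarrow> (nat \<Rightarrow> nat) \<Rightarrow> bool" where
  "after_last c \<kappa> m \<gamma> \<longleftrightarrow> (\<forall>t. 0 < t \<and> t \<le> m \<longrightarrow> \<not> occurs c \<kappa> t (dsum c \<kappa> \<gamma>))"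

lemma sum_wt_block:
  assumes \<kappa>: "\<kappa> \<in> perms c" and n: "n = s + (c + m)"
  shows "(\<Sum>\<pi>\<in>{dsum s \<alpha> (dsum c \<kappa> \<beta>) | \<alpha> \<beta>. \<alpha> \<in> perms s \<and> \<beta> \<in> perms m \<and> P \<alpha> \<beta>}. wt q n \<pi>) =
    wt q c \<kappa> * (\<Sum>\<alpha>\<in>perms s. wt q s \<alpha> * wsum q m (P \<alpha>))"
proof -
  define B where "B = (\<lambda>\<beta>. dsum c \<kappa> \<beta>) ` perms m"
  define P' where "P' \<alpha> \<rho> \<longleftrightarrow> (\<exists>\<beta>\<in>perms m. \<rho> = dsum c \<kappa> \<beta> \<and> P \<alpha> \<beta>)" for \<alpha> \<rho>
  have B: "B \<subseteq> perms (c + m)" using dsum_perms[OF \<kappa>] by (auto simp: B_def)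
  have "{dsum s \<alpha> (dsum c \<kappa> \<beta>) | \<alpha> \<beta>. \<alpha> \<in> perms s \<and> \<beta> \<in> perms m \<and> P \<alpha> \<beta>} =
        (\<lambda>(\<alpha>, \<rho>). dsum s \<alpha> \<rho>) ` (SIGMA \<alpha>:perms s. {\<rho> \<in> B. P' \<alpha> \<rho>})"
    by (force simp: B_def P'_def image_iff)
  hence "(\<Sum>\<pi>\<in>{dsum s \<alpha> (dsum c \<kappa> \<beta>) | \<alpha> \<beta>. \<alpha> \<in> perms s \<and> \<beta> \<in> perms m \<and> P \<alpha> \<beta>}. wt q n \<pi>) =
    (\<Sum>\<alpha>\<in>perms s. wt q s \<alpha> * (\<Sum>\<rho> | \<rho> \<in> B \<and> P' \<alpha> \<rho>. wt q (c + m) \<rho>))"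
    unfolding n using sum_wt_dsum[OF order.refl B] by simp
  also have "\<dots> = (\<Sum>\<alpha>\<in>perms s. wt q s \<alpha> * (wt q c \<kappa> * wsum q m (P \<alpha>)))"
  proof (intro sum.cong refl arg_cong2[where f = "(*)"])
    fix \<alpha>
    have "{\<rho>. \<rho> \<in> B \<and> P' \<alpha> \<rho>} = (\<lambda>(\<kappa>, \<beta>). dsum c \<kappa> \<beta>) ` (SIGMA \<kappa>:{\<kappa>}. {\<beta> \<in> perms m. P \<alpha> \<beta>})"
      by (auto simp: B_def P'_def)
    hence "(\<Sum>\<rho> | \<rho> \<in> B \<and> P' \<alpha> \<rho>. wt q (c + m) \<rho>) =
       (\<Sum>\<kappa>\<in>{\<kappa>}. wt q c \<kappa> * (\<Sum>\<beta> | \<beta> \<in> perms m \<and> P \<alpha> \<beta>. wt q m \<beta>))"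
      using sum_wt_dsum[where A = "{\<kappa>}" and n = c and B = "perms m" and m = m and P = "\<lambda>_. P \<alpha>" and q = q] \<kappa> by simp
    thus "(\<Sum>\<rho> | \<rho> \<in> B \<and> P' \<alpha> \<rho>. wt q (c + m) \<rho>) = wt q c \<kappa> * wsum q m (P \<alpha>)"
      by (simp add: wsum_def)
  qed
  also have "\<dots> = wt q c \<kappa> * (\<Sum>\<alpha>\<in>perms s. wt q s \<alpha> * wsum q m (P \<alpha>))"
    by (simp add: sum_distrib_left mult_ac)
  finally show ?thesis .
qed

text \<open>Whether the occurrence at \<open>s\<close> is the first depends only on the positions up
  to \<open>s + c\<close>, hence only on the prefix \<open>\<alpha>\<close>; the remainder
  \<open>\<beta>\<close> is an arbitrary permutation, and the weights multiply.\<close>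

lemma first_occurrence_decomposition:
  assumes \<kappa>: "\<kappa> \<in> perms c"
  shows "wsum q (N + c) P = wsum q (N + c) (\<lambda>\<pi>. avoids c \<kappa> (N + c) \<pi> \<and> P \<pi>) +
    (\<Sum>s\<le>N. wt q c \<kappa> * (\<Sum>\<alpha> | \<alpha> \<in> perms s \<and> before_first c \<kappa> s \<alpha>.
        wt q s \<alpha> * wsum q (N - s) (\<lambda>\<beta>. P (dsum s \<alpha> (dsum c \<kappa> \<beta>)))))"
proof -
  define n where "n = N + c"
  define F where "F s = {\<pi> \<in> perms n. P \<pi> \<and> occurs c \<kappa> s \<pi> \<and> (\<forall>t<s. \<not> occurs c \<kappa> t \<pi>)}" for s
  define H where "H = {\<pi> \<in> perms n. avoids c \<kappa> n \<pi> \<and> P \<pi>}"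
  have eq: "{\<pi> \<in> perms n. P \<pi>} = H \<union> (\<Union>s\<le>N. F s)"
  proof (intro equalityI subsetI)
    fix \<pi> assume \<pi>: "\<pi> \<in> {\<pi> \<in> perms n. P \<pi>}"
    show "\<pi> \<in> H \<union> (\<Union>s\<le>N. F s)"
    proof (cases "avoids c \<kappa> n \<pi>")
      case False
      then obtain s where s: "s \<le> N" "occurs c \<kappa> s \<pi>"
        by (auto simp: avoids_def n_def)
      define s0 where "s0 = (LEAST s. occurs c \<kappa> s \<pi>)"
      have "occurs c \<kappa> s0 \<pi>" "s0 \<le> s"
        unfolding s0_def using s(2) by (auto intro: LeastI Least_le)
      moreover have "\<forall>t<s0. \<not> occurs c \<kappa> t \<pi>" unfolding s0_def using not_less_Least by blast
      ultimately show ?thesis using \<pi> s by (auto simp: F_def)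
    qed (use \<pi> in \<open>auto simp: H_def\<close>)
  qed (auto simp: H_def F_def)
  have disj: "H \<inter> (\<Union>s\<le>N. F s) = {}"
    by (auto simp: H_def F_def avoids_def n_def)
  have disjF: "F s \<inter> F t = {}" if "s \<noteq> t" for s t
    using that by (cases s t rule: linorder_cases) (auto simp: F_def)
  have finF: "finite (F s)" for s
    unfolding F_def by simp
  have F: "F s = {dsum s \<alpha> (dsum c \<kappa> \<beta>) | \<alpha> \<beta>. \<alpha> \<in> perms s \<and> \<beta> \<in> perms (N - s) \<and>
       (before_first c \<kappa> s \<alpha> \<and> P (dsum s \<alpha> (dsum c \<kappa> \<beta>)))}" if "s \<le> N" for s
  proof -
    have n: "n = s + (c + (N - s))" using that by (simp add: n_def)
    have bf: "(\<forall>t<s. \<not> occurs c \<kappa> t (dsum s \<alpha> (dsum c \<kappa> \<beta>))) \<longleftrightarrow> before_first c \<kappa> s \<alpha>"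
      if "\<alpha> \<in> perms s" for \<alpha> \<beta>
      unfolding before_first_def
      by (intro all_cong arg_cong[where f = Not] occurs_local) (auto simp: dsum_def)
    show ?thesis
    proof (intro equalityI subsetI)
      fix \<pi> assume \<pi>: "\<pi> \<in> F s"
      then obtain \<alpha> \<beta> where ab: "\<alpha> \<in> perms s" "\<beta> \<in> perms (N - s)" "\<pi> = dsum s \<alpha> (dsum c \<kappa> \<beta>)"
        using occurs_decomposition[OF \<kappa>, of \<pi> s "N - s"] n by (auto simp: F_def)
      thus "\<pi> \<in> {dsum s \<alpha> (dsum c \<kappa> \<beta>) | \<alpha> \<beta>. \<alpha> \<in> perms s \<and> \<beta> \<in> perms (N - s) \<and>
       (before_first c \<kappa> s \<alpha> \<and> P (dsum s \<alpha> (dsum c \<kappa> \<beta>)))}"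
        using \<pi> bf[OF ab(1), of \<beta>] by (auto simp: F_def)
    next
      fix \<pi> assume "\<pi> \<in> {dsum s \<alpha> (dsum c \<kappa> \<beta>) | \<alpha> \<beta>. \<alpha> \<in> perms s \<and> \<beta> \<in> perms (N - s) \<and>
       (before_first c \<kappa> s \<alpha> \<and> P (dsum s \<alpha> (dsum c \<kappa> \<beta>)))}"
      then obtain \<alpha> \<beta> where ab: "\<alpha> \<in> perms s" "\<beta> \<in> perms (N - s)" "\<pi> = dsum s \<alpha> (dsum c \<kappa> \<beta>)"
        "before_first c \<kappa> s \<alpha>" "P \<pi>" by blast
      have "\<pi> \<in> perms n" unfolding ab(3) n by (intro dsum_perms ab \<kappa>)
      thus "\<pi> \<in> F s"
        using ab occurs_dsum[OF ab(1)] bf[OF ab(1), of \<beta>] by (simp add: F_def)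
    qed
  qed
  have "wsum q n P = (\<Sum>\<pi>\<in>H. wt q n \<pi>) + (\<Sum>\<pi>\<in>(\<Union>s\<le>N. F s). wt q n \<pi>)"
    unfolding wsum_def eq by (rule sum.union_disjoint) (use disj finF in \<open>auto simp: H_def\<close>)
  also have "(\<Sum>\<pi>\<in>(\<Union>s\<le>N. F s). wt q n \<pi>) = (\<Sum>s\<le>N. \<Sum>\<pi>\<in>F s. wt q n \<pi>)"
    by (rule sum.UNION_disjoint) (use finF disjF in auto)
  also have "\<dots> = (\<Sum>s\<le>N. wt q c \<kappa> * (\<Sum>\<alpha> | \<alpha> \<in> perms s \<and> before_first c \<kappa> s \<alpha>.
        wt q s \<alpha> * wsum q (N - s) (\<lambda>\<beta>. P (dsum s \<alpha> (dsum c \<kappa> \<beta>)))))"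
  proof (rule sum.cong[OF refl])
    fix s assume "s \<in> {..N}"
    hence s: "s \<le> N" by simp
    have "(\<Sum>\<pi>\<in>F s. wt q n \<pi>) = wt q c \<kappa> * (\<Sum>\<alpha>\<in>perms s. wt q s \<alpha> *
        wsum q (N - s) (\<lambda>\<beta>. before_first c \<kappa> s \<alpha> \<and> P (dsum s \<alpha> (dsum c \<kappa> \<beta>))))"
      unfolding F[OF s] by (rule sum_wt_block[OF \<kappa>]) (use s in \<open>simp add: n_def\<close>)
    also have "(\<Sum>\<alpha>\<in>perms s. wt q s \<alpha> *
        wsum q (N - s) (\<lambda>\<beta>. before_first c \<kappa> s \<alpha> \<and> P (dsum s \<alpha> (dsum c \<kappa> \<beta>)))) =
       (\<Sum>\<alpha> | \<alpha> \<in> perms s \<and> before_first c \<kappa> s \<alpha>.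
        wt q s \<alpha> * wsum q (N - s) (\<lambda>\<beta>. P (dsum s \<alpha> (dsum c \<kappa> \<beta>))))"
      by (rule sum.mono_neutral_cong_right) (auto simp: wsum_def)
    finally show "(\<Sum>\<pi>\<in>F s. wt q n \<pi>) = wt q c \<kappa> * (\<Sum>\<alpha> | \<alpha> \<in> perms s \<and> before_first c \<kappa> s \<alpha>.
        wt q s \<alpha> * wsum q (N - s) (\<lambda>\<beta>. P (dsum s \<alpha> (dsum c \<kappa> \<beta>))))" .
  qed
  finally show ?thesis by (simp add: H_def n_def wsum_def)
qed

text \<open>The assumption on \<open>P\<close> makes its truth independent of the part
  \<open>\<delta>\<close> before the last block, so that part is free and sums to
  \<open>wtot\<close>. The index \<open>t\<close> is the length of the part after the last
  block.\<close>

lemma last_occurrence_decomposition: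
  assumes \<kappa>: "\<kappa> \<in> perms c"
    and P: "\<And>t \<delta> \<gamma>. t \<le> N \<Longrightarrow> \<delta> \<in> perms (N - t) \<Longrightarrow> \<gamma> \<in> perms t \<Longrightarrow>
       P (dsum (N - t) \<delta> (dsum c \<kappa> \<gamma>)) \<longleftrightarrow> p t \<gamma>"
  shows "wsum q (N + c) P = wsum q (N + c) (\<lambda>\<pi>. avoids c \<kappa> (N + c) \<pi> \<and> P \<pi>) +
    (\<Sum>t\<le>N. wt q c \<kappa> * wsum q t (\<lambda>\<gamma>. after_last c \<kappa> t \<gamma> \<and> p t \<gamma>) * wtot q (N - t))"
proof -
  define n where "n = N + c"
  define F where "F t = {\<pi> \<in> perms n. P \<pi> \<and> occurs c \<kappa> (N - t) \<pi> \<and> (\<forall>s. N - t < s \<and> s \<le> N \<longrightarrow> \<not> occurs c \<kappa> s \<pi>)}" for t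
  define H where "H = {\<pi> \<in> perms n. avoids c \<kappa> n \<pi> \<and> P \<pi>}"
  have eq: "{\<pi> \<in> perms n. P \<pi>} = H \<union> (\<Union>t\<le>N. F t)"
  proof (intro equalityI subsetI)
    fix \<pi> assume \<pi>: "\<pi> \<in> {\<pi> \<in> perms n. P \<pi>}"
    show "\<pi> \<in> H \<union> (\<Union>t\<le>N. F t)"
    proof (cases "avoids c \<kappa> n \<pi>")
      case False
      define S where "S = {s. s \<le> N \<and> occurs c \<kappa> s \<pi>}"
      have mem: "s \<in> S \<longleftrightarrow> s \<le> N \<and> occurs c \<kappa> s \<pi>" for s by (simp add: S_def)
      have "finite S" by (rule finite_subset[of _ "{..N}"]) (auto simp: S_def)
      moreover have "S \<noteq> {}" using False by (auto simp: avoids_def n_def S_def)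
      ultimately have M: "Max S \<in> S" "\<And>s. s \<in> S \<Longrightarrow> s \<le> Max S" by simp_all
      define t where "t = N - Max S"
      have t: "t \<le> N" "N - t = Max S" using M(1) mem by (auto simp: t_def)
      have "\<pi> \<in> F t"
        using \<pi> M mem unfolding F_def t(2) by fastforce
      thus ?thesis using t by blast
    qed (use \<pi> in \<open>auto simp: H_def\<close>)
  qed (auto simp: H_def F_def)
  have disj: "H \<inter> (\<Union>t\<le>N. F t) = {}"
    by (auto simp: H_def F_def avoids_def n_def)
  have disjF: "F s \<inter> F t = {}" if "s \<noteq> t" "s \<le> N" "t \<le> N" for s t
  proof -
    have *: "F s \<inter> F t = {}" if "s < t" "t \<le> N" for s t
    proof -
      have "N - t < N - s" "N - s \<le> N" using that by linarith+
      thus ?thesis by (auto simp: F_def)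
    qed
    show ?thesis using *[of s t] *[of t s] that by (cases s t rule: linorder_cases) auto
  qed
  have finF: "finite (F s)" for s
    unfolding F_def by simp
  have F: "F t = {dsum (N - t) \<delta> (dsum c \<kappa> \<gamma>) | \<delta> \<gamma>. \<delta> \<in> perms (N - t) \<and> \<gamma> \<in> perms t \<and>
       (after_last c \<kappa> t \<gamma> \<and> p t \<gamma>)}" if t: "t \<le> N" for t
  proof -
    have n: "n = (N - t) + (c + t)" using that by (simp add: n_def)
    have al: "(\<forall>s. N - t < s \<and> s \<le> N \<longrightarrow> \<not> occurs c \<kappa> s (dsum (N - t) \<delta> (dsum c \<kappa> \<gamma>))) \<longleftrightarrow> after_last c \<kappa> t \<gamma>"
      if "\<delta> \<in> perms (N - t)" for \<delta> \<gamma>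
    proof
      assume *: "\<forall>s. N - t < s \<and> s \<le> N \<longrightarrow> \<not> occurs c \<kappa> s (dsum (N - t) \<delta> (dsum c \<kappa> \<gamma>))"
      show "after_last c \<kappa> t \<gamma>"
        unfolding after_last_def
      proof (intro allI impI)
        fix r assume r: "0 < r \<and> r \<le> t"
        hence "N - t < N - t + r" "N - t + r \<le> N" using t by linarith+
        thus "\<not> occurs c \<kappa> r (dsum c \<kappa> \<gamma>)"
          using *[rule_format, of "N - t + r"] unfolding occurs_shift[OF that] by blast
      qed
    next
      assume *: "after_last c \<kappa> t \<gamma>"
      show "\<forall>s. N - t < s \<and> s \<le> N \<longrightarrow> \<not> occurs c \<kappa> s (dsum (N - t) \<delta> (dsum c \<kappa> \<gamma>))"
      proof (intro allI impI)
        fix s assume s: "N - t < s \<and> s \<le> N"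
        hence "0 < s - (N - t)" "s - (N - t) \<le> t" "N - t + (s - (N - t)) = s" using t by linarith+
        thus "\<not> occurs c \<kappa> s (dsum (N - t) \<delta> (dsum c \<kappa> \<gamma>))"
          using * occurs_shift[OF that, of c \<kappa> "s - (N - t)"] by (auto simp: after_last_def)
      qed
    qed
    show ?thesis
    proof (intro equalityI subsetI)
      fix \<pi> assume \<pi>: "\<pi> \<in> F t"
      then obtain \<delta> \<gamma> where ab: "\<delta> \<in> perms (N - t)" "\<gamma> \<in> perms t" "\<pi> = dsum (N - t) \<delta> (dsum c \<kappa> \<gamma>)"
        using occurs_decomposition[OF \<kappa>, of \<pi> "N - t" t] n by (auto simp: F_def)
      moreover have "after_last c \<kappa> t \<gamma>" "p t \<gamma>"
        using \<pi> al[OF ab(1), of \<gamma>] P[OF t ab(1,2)] ab(3) by (auto simp: F_def)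
      ultimately show "\<pi> \<in> {dsum (N - t) \<delta> (dsum c \<kappa> \<gamma>) | \<delta> \<gamma>. \<delta> \<in> perms (N - t) \<and> \<gamma> \<in> perms t \<and>
       (after_last c \<kappa> t \<gamma> \<and> p t \<gamma>)}" by blast
    next
      fix \<pi> assume "\<pi> \<in> {dsum (N - t) \<delta> (dsum c \<kappa> \<gamma>) | \<delta> \<gamma>. \<delta> \<in> perms (N - t) \<and> \<gamma> \<in> perms t \<and>
       (after_last c \<kappa> t \<gamma> \<and> p t \<gamma>)}"
      then obtain \<delta> \<gamma> where ab: "\<delta> \<in> perms (N - t)" "\<gamma> \<in> perms t" "\<pi> = dsum (N - t) \<delta> (dsum c \<kappa> \<gamma>)"
        "after_last c \<kappa> t \<gamma>" "p t \<gamma>" by blast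
      have "\<pi> \<in> perms n" unfolding ab(3) n by (intro dsum_perms ab \<kappa>)
      thus "\<pi> \<in> F t"
        using ab occurs_dsum[OF ab(1)] al[OF ab(1), of \<gamma>] P[OF t ab(1,2)] by (simp add: F_def)
    qed
  qed
  have "wsum q n P = (\<Sum>\<pi>\<in>H. wt q n \<pi>) + (\<Sum>\<pi>\<in>(\<Union>s\<le>N. F s). wt q n \<pi>)"
    unfolding wsum_def eq by (rule sum.union_disjoint) (use disj finF in \<open>auto simp: H_def\<close>)
  also have "(\<Sum>\<pi>\<in>(\<Union>s\<le>N. F s). wt q n \<pi>) = (\<Sum>s\<le>N. \<Sum>\<pi>\<in>F s. wt q n \<pi>)"
    by (rule sum.UNION_disjoint) (use finF disjF in auto)
  also have "\<dots> = (\<Sum>t\<le>N. wt q c \<kappa> * wsum q t (\<lambda>\<gamma>. after_last c \<kappa> t \<gamma> \<and> p t \<gamma>) * wtot q (N - t))"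
  proof (rule sum.cong[OF refl])
    fix t assume "t \<in> {..N}"
    hence t: "t \<le> N" by simp
    have "(\<Sum>\<pi>\<in>F t. wt q n \<pi>) = wt q c \<kappa> * (\<Sum>\<delta>\<in>perms (N - t). wt q (N - t) \<delta> *
        wsum q t (\<lambda>\<gamma>. after_last c \<kappa> t \<gamma> \<and> p t \<gamma>))"
      unfolding F[OF t] by (rule sum_wt_block[OF \<kappa>]) (use t in \<open>simp add: n_def\<close>)
    also have "\<dots> = wt q c \<kappa> * wsum q t (\<lambda>\<gamma>. after_last c \<kappa> t \<gamma> \<and> p t \<gamma>) * wtot q (N - t)"
      by (simp add: wtot_def sum_distrib_right[symmetric])
    finally show "(\<Sum>\<pi>\<in>F t. wt q n \<pi>) =
       wt q c \<kappa> * wsum q t (\<lambda>\<gamma>. after_last c \<kappa> t \<gamma> \<and> p t \<gamma>) * wtot q (N - t)" .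
  qed
  finally show ?thesis by (simp add: H_def n_def wsum_def)
qed

subsection \<open>Limits of convolutions\<close>

text \<open>Tannery's theorem (dominated convergence for series), applied after extending the terms
  by 0 beyond the diagonal.\<close>

lemma tendsto_convolution:
  fixes f :: "nat \<Rightarrow> nat \<Rightarrow> real"
  assumes M: "summable M" and bound: "\<And>s N. s \<le> N \<Longrightarrow> \<bar>f s N\<bar> \<le> M s"
    and lim: "\<And>s. f s \<longlonglongrightarrow> L s"
  shows "(\<lambda>N. \<Sum>s\<le>N. f s N) \<longlonglongrightarrow> suminf L"
proof -
  define a where "a s N = (if s \<le> N then f s N else 0)" for s N
  have M0: "M s \<ge> 0" for s using bound[of s s] by (simp add: order.trans[OF abs_ge_zero])
  have "a s \<longlonglongrightarrow> L s" for s
  proof (rule Lim_transform_eventually[OF lim])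
    show "\<forall>\<^sub>F N in sequentially. f s N = a s N"
      using eventually_ge_at_top[of s] by eventually_elim (simp add: a_def)
  qed
  moreover have "\<bar>a s N\<bar> \<le> M s" for s N using bound M0 by (simp add: a_def)
  ultimately have "(\<lambda>N. suminf (\<lambda>s. a s N)) \<longlonglongrightarrow> suminf L"
    using tannerys_theorem[of a L sequentially M] M by (simp add: case_prod_unfold)
  moreover have "suminf (\<lambda>s. a s N) = (\<Sum>s\<le>N. f s N)" for N
    by (subst suminf_finite[of "{..N}"]) (auto simp: a_def)
  ultimately show ?thesis by simp
qed

section \<open>Renewal estimates for occurrences of a block\<close>

lemma wt_pos: "0 < q \<Longrightarrow> q < 1 \<Longrightarrow> wt q n \<pi> > 0"
  by (simp add: wt_def)

lemma wsum_occurs: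
  assumes "\<kappa> \<in> perms c"
  shows "wsum q (s + (c + m)) (occurs c \<kappa> s) = wt q c \<kappa> * wtot q s * wtot q m"
proof -
  have "{\<pi> \<in> perms (s + (c + m)). occurs c \<kappa> s \<pi>} =
      {dsum s \<alpha> (dsum c \<kappa> \<beta>) | \<alpha> \<beta>. \<alpha> \<in> perms s \<and> \<beta> \<in> perms m \<and> True}"
  proof (intro equalityI subsetI)
    fix \<pi> assume "\<pi> \<in> {\<pi> \<in> perms (s + (c + m)). occurs c \<kappa> s \<pi>}"
    thus "\<pi> \<in> {dsum s \<alpha> (dsum c \<kappa> \<beta>) | \<alpha> \<beta>. \<alpha> \<in> perms s \<and> \<beta> \<in> perms m \<and> True}"
      using occurs_decomposition[OF assms, of \<pi> s m] by blast
  next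
    fix \<pi> assume "\<pi> \<in> {dsum s \<alpha> (dsum c \<kappa> \<beta>) | \<alpha> \<beta>. \<alpha> \<in> perms s \<and> \<beta> \<in> perms m \<and> True}"
    then obtain \<alpha> \<beta> where "\<pi> = dsum s \<alpha> (dsum c \<kappa> \<beta>)" "\<alpha> \<in> perms s" "\<beta> \<in> perms m" by blast
    thus "\<pi> \<in> {\<pi> \<in> perms (s + (c + m)). occurs c \<kappa> s \<pi>}"
      using occurs_dsum assms by (auto intro!: dsum_perms)
  qed
  thus ?thesis
    using sum_wt_block[OF assms refl, where s = s and m = m and P = "\<lambda>_ _. True" and q = q]
    by (simp add: wsum_def wtot_def sum_distrib_right)
qed

lemma first_occurrence_total:
  assumes "\<kappa> \<in> perms c"
  shows "wtot q (N + c) = wsum q (N + c) (avoids c \<kappa> (N + c)) +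
    wt q c \<kappa> * (\<Sum>s\<le>N. wsum q s (before_first c \<kappa> s) * wtot q (N - s))"
proof -
  have "wtot q (N + c) = wsum q (N + c) (\<lambda>_. True)"
    by (simp add: wsum_True)
  also have "\<dots> = wsum q (N + c) (avoids c \<kappa> (N + c)) +
    (\<Sum>s\<le>N. wt q c \<kappa> * (\<Sum>\<alpha> | \<alpha> \<in> perms s \<and> before_first c \<kappa> s \<alpha>. wt q s \<alpha> * wtot q (N - s)))"
    by (subst first_occurrence_decomposition[OF assms]) (simp add: wsum_True)
  also have "(\<Sum>s\<le>N. wt q c \<kappa> * (\<Sum>\<alpha> | \<alpha> \<in> perms s \<and> before_first c \<kappa> s \<alpha>. wt q s \<alpha> * wtot q (N - s)))
      = wt q c \<kappa> * (\<Sum>s\<le>N. wsum q s (before_first c \<kappa> s) * wtot q (N - s))"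
    by (simp only: wsum_def sum_distrib_right sum_distrib_left)
  finally show ?thesis .
qed

lemma last_occurrence_total:
  assumes "\<kappa> \<in> perms c"
  shows "wtot q (N + c) = wsum q (N + c) (avoids c \<kappa> (N + c)) +
    wt q c \<kappa> * (\<Sum>t\<le>N. wsum q t (after_last c \<kappa> t) * wtot q (N - t))"
proof -
  have "wtot q (N + c) = wsum q (N + c) (\<lambda>_. True)"
    by (simp add: wsum_True)
  also have "\<dots> = wsum q (N + c) (avoids c \<kappa> (N + c)) +
    (\<Sum>t\<le>N. wt q c \<kappa> * wsum q t (after_last c \<kappa> t) * wtot q (N - t))"
    by (subst last_occurrence_decomposition[OF assms, where p = "\<lambda>_ _. True"]) (simp_all add: wsum_True)
  finally show ?thesis
    by (simp add: sum_distrib_left mult.assoc)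
qed

text \<open>The second factor is at least \<open>wi > 0\<close> throughout, so the partial sums of
  \<open>f\<close> are at most \<open>C / wi\<close>.\<close>

lemma summable_convolution_bound:
  fixes f w :: "nat \<Rightarrow> real"
  assumes f: "\<And>s. f s \<ge> 0" and w: "\<And>n. w n \<ge> wi" "wi > 0"
    and bound: "\<And>N. (\<Sum>s\<le>N. f s * w (N - s)) \<le> C"
  shows "summable f"
proof (rule summableI_nonneg_bounded[OF f])
  fix n
  have "(\<Sum>s<n. f s) * wi \<le> (\<Sum>s\<le>n. f s) * wi"
    using f w(2) by (intro mult_right_mono sum_mono2) auto
  also have "\<dots> \<le> (\<Sum>s\<le>n. f s * w (n - s))"
    unfolding sum_distrib_right using f w(1) by (intro sum_mono mult_left_mono) auto
  also have "\<dots> \<le> C" by (rule bound)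
  finally show "(\<Sum>s<n. f s) \<le> C / wi" using w(2) by (simp add: field_simps)
qed

lemma summable_first_last:
  assumes q: "0 < q" "q < 1" and \<kappa>: "\<kappa> \<in> perms c"
  shows "summable (\<lambda>s. wsum q s (before_first c \<kappa> s))" "summable (\<lambda>t. wsum q t (after_last c \<kappa> t))"
proof -
  obtain wi where wi: "wi > 0" "\<And>n. wi \<le> wtot q n"
    using wtot_properties(4)[OF q] by blast
  have k: "wt q c \<kappa> > 0" by (rule wt_pos[OF q])
  have bound: "(\<Sum>s\<le>N. f s * wtot q (N - s)) \<le> 1 / wt q c \<kappa>"
    if "wtot q (N + c) = wsum q (N + c) (avoids c \<kappa> (N + c)) + wt q c \<kappa> * (\<Sum>s\<le>N. f s * wtot q (N - s))" for f N
  proof -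
    have "wt q c \<kappa> * (\<Sum>s\<le>N. f s * wtot q (N - s)) \<le> 1"
      using that wsum_nonneg[OF q, of "N + c" "avoids c \<kappa> (N + c)"] wtot_properties(2)[OF q, of "N + c"] by linarith
    thus ?thesis using k by (simp add: field_simps)
  qed
  show "summable (\<lambda>s. wsum q s (before_first c \<kappa> s))"
    by (rule summable_convolution_bound[OF wsum_nonneg[OF q] wi(2,1)]) (rule bound[OF first_occurrence_total[OF \<kappa>]])
  show "summable (\<lambda>t. wsum q t (after_last c \<kappa> t))"
    by (rule summable_convolution_bound[OF wsum_nonneg[OF q] wi(2,1)]) (rule bound[OF last_occurrence_total[OF \<kappa>]])
qed

text \<open>Counting all occurrences by means of the first one shows that the first occurrence has total
  mass at least \<open>1\<close>, since the expected number of occurrences is unbounded.\<close>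

lemma first_occurrence_mass:
  assumes q: "0 < q" "q < 1" and \<kappa>: "\<kappa> \<in> perms c"
  shows "wt q c \<kappa> * (\<Sum>s. wsum q s (before_first c \<kappa> s)) \<ge> 1"
proof (rule ccontr)
  define a where "a s = wsum q s (before_first c \<kappa> s)" for s
  define k where "k = wt q c \<kappa>"
  define A where "A = suminf a"
  assume "\<not> wt q c \<kappa> * (\<Sum>s. wsum q s (before_first c \<kappa> s)) \<ge> 1"
  hence kA: "k * A < 1" unfolding k_def A_def a_def by simp
  obtain wi where wi: "wi > 0" "\<And>n. wi \<le> wtot q n"
    using wtot_properties(4)[OF q] by blast
  have k: "k > 0" unfolding k_def by (rule wt_pos[OF q])
  have a0: "a s \<ge> 0" for s unfolding a_def by (rule wsum_nonneg[OF q])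
  have sa: "summable a" unfolding a_def by (rule summable_first_last[OF q \<kappa>])
  have A0: "A \<ge> 0" unfolding A_def by (rule suminf_nonneg[OF sa a0])
  \<comment> \<open>\<open>g d\<close> bounds the mass of the continuations that show the block
    again at distance \<open>d\<close> after an occurrence. At distances below \<open>c\<close> the
    two copies would overlap, and the trivial bound 1 is used.\<close>
  define g where "g d = (if d < c then 1 else k * wtot q (d - c))" for d
  have w0: "wtot q n \<ge> 0" for n using wtot_properties(1)[OF q, of n] by simp
  have g0: "g d \<ge> 0" for d using k w0 by (simp add: g_def)
  \<comment> \<open>\<open>k * wtot q s\<close> is the mass of the permutations that end with the
    block after position \<open>s\<close>; splitting by the first occurrence \<open>r\<close> turns
    it into a convolution.\<close>
  have step: "wtot q s \<le> (\<Sum>r\<le>s. a r * g (s - r))" for s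
  proof -
    have inner: "wsum q (s - r) (\<lambda>\<beta>. occurs c \<kappa> s (dsum r \<alpha> (dsum c \<kappa> \<beta>))) \<le> g (s - r)"
      if r: "r \<le> s" "\<alpha> \<in> perms r" for r \<alpha>
    proof (cases "s - r < c")
      case True
      thus ?thesis
        using order.trans[OF wsum_le_wtot[OF q] wtot_properties(2)[OF q]] by (simp add: g_def)
    next
      case False
      define d where "d = s - r - c"
      have s: "s = r + (c + d)" "s - r = d + (c + 0)" using False r by (auto simp: d_def)
      have "occurs c \<kappa> s (dsum r \<alpha> (dsum c \<kappa> \<beta>)) \<longleftrightarrow> occurs c \<kappa> d \<beta>" for \<beta>
        unfolding s(1) by (simp only: occurs_shift[OF r(2)] occurs_shift[OF \<kappa>])
      hence "wsum q (s - r) (\<lambda>\<beta>. occurs c \<kappa> s (dsum r \<alpha> (dsum c \<kappa> \<beta>))) = wsum q (d + (c + 0)) (occurs c \<kappa> d)"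
        by (simp only: s(2))
      also have "\<dots> = k * wtot q d" by (simp only: wsum_occurs[OF \<kappa>] k_def wtot_0 mult_1_right)
      finally show ?thesis using False by (simp add: g_def d_def)
    qed
    have "k * wtot q s = wsum q (s + c) (occurs c \<kappa> s)"
      using wsum_occurs[OF \<kappa>, of q s 0] by (simp add: k_def)
    also have "\<dots> = wsum q (s + c) (\<lambda>\<pi>. avoids c \<kappa> (s + c) \<pi> \<and> occurs c \<kappa> s \<pi>) +
      (\<Sum>r\<le>s. k * (\<Sum>\<alpha> | \<alpha> \<in> perms r \<and> before_first c \<kappa> r \<alpha>.
        wt q r \<alpha> * wsum q (s - r) (\<lambda>\<beta>. occurs c \<kappa> s (dsum r \<alpha> (dsum c \<kappa> \<beta>)))))"
      unfolding k_def by (rule first_occurrence_decomposition[OF \<kappa>])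
    also have "wsum q (s + c) (\<lambda>\<pi>. avoids c \<kappa> (s + c) \<pi> \<and> occurs c \<kappa> s \<pi>) = 0"
      unfolding wsum_def by (rule sum.neutral) (auto simp: avoids_def)
    finally have "k * wtot q s = (\<Sum>r\<le>s. k * (\<Sum>\<alpha> | \<alpha> \<in> perms r \<and> before_first c \<kappa> r \<alpha>.
        wt q r \<alpha> * wsum q (s - r) (\<lambda>\<beta>. occurs c \<kappa> s (dsum r \<alpha> (dsum c \<kappa> \<beta>)))))"
      by simp
    also have "\<dots> \<le> (\<Sum>r\<le>s. k * (\<Sum>\<alpha> | \<alpha> \<in> perms r \<and> before_first c \<kappa> r \<alpha>. wt q r \<alpha> * g (s - r)))"
    proof (intro sum_mono mult_left_mono wt_nonneg[OF q])
      fix r \<alpha> assume "r \<in> {..s}" "\<alpha> \<in> {\<alpha> \<in> perms r. before_first c \<kappa> r \<alpha>}"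
      thus "wsum q (s - r) (\<lambda>\<beta>. occurs c \<kappa> s (dsum r \<alpha> (dsum c \<kappa> \<beta>))) \<le> g (s - r)"
        by (intro inner) auto
    qed (use k in simp)
    also have "\<dots> = (\<Sum>r\<le>s. k * (a r * g (s - r)))"
      unfolding a_def wsum_def by (simp only: sum_distrib_right)
    also have "\<dots> = k * (\<Sum>r\<le>s. a r * g (s - r))"
      by (rule sum_distrib_left[symmetric])
    finally have "k * wtot q s \<le> k * (\<Sum>r\<le>s. a r * g (s - r))" by simp
    thus ?thesis using k by simp
  qed
  define Q where "Q n = (\<Sum>s\<le>n. wtot q s)" for n
  have gQ: "(\<Sum>d\<le>n. g d) \<le> c + k * Q n" for n
  proof -
    have "(\<Sum>d\<le>n. g d) \<le> (\<Sum>d\<le>n + c. g d)"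
      using g0 by (intro sum_mono2) auto
    also have "{..n + c} = {..<c} \<union> {c..n + c}" by auto
    also have "(\<Sum>d\<in>{..<c} \<union> {c..n + c}. g d) = (\<Sum>d<c. g d) + (\<Sum>d\<in>{c..n + c}. g d)"
      by (rule sum.union_disjoint) auto
    also have "(\<Sum>d<c. g d) = c" by (simp add: g_def)
    also have "(\<Sum>d\<in>{c..n + c}. g d) = (\<Sum>d\<le>n. k * wtot q d)"
      by (rule sum.reindex_bij_witness[of _ "\<lambda>d. d + c" "\<lambda>d. d - c"]) (auto simp: g_def)
    also have "\<dots> = k * Q n" by (simp add: Q_def sum_distrib_left)
    finally show ?thesis .
  qed
  \<comment> \<open>With \<open>k * A < 1\<close> this renewal inequality would keep
    \<open>Q n\<close> bounded, whereas \<open>Q n\<close> grows at least like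
    \<open>n * wi\<close>.\<close>
  have Qle: "Q n \<le> A * (c + k * Q n)" for n
  proof -
    have "Q n \<le> (\<Sum>s\<le>n. \<Sum>r\<le>s. a r * g (s - r))"
      unfolding Q_def by (intro sum_mono step)
    also have "\<dots> = (\<Sum>(r, d)\<in>{(r, d). r + d \<le> n}. a r * g d)"
      by (rule sum.triangle_reindex_eq[symmetric])
    also have "\<dots> \<le> (\<Sum>(r, d)\<in>{..n} \<times> {..n}. a r * g d)"
      using a0 g0 by (intro sum_mono2) auto
    also have "\<dots> = (\<Sum>r\<le>n. a r) * (\<Sum>d\<le>n. g d)"
      by (simp only: sum.cartesian_product[symmetric] sum_product)
    also have "\<dots> \<le> A * (c + k * Q n)"
    proof (rule mult_mono)
      show "(\<Sum>r\<le>n. a r) \<le> A" unfolding A_def using a0 by (intro sum_le_suminf sa) auto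
    qed (use gQ A0 g0 in \<open>auto intro: sum_nonneg\<close>)
    finally show ?thesis .
  qed
  have Qge: "real n * wi \<le> Q n" for n
  proof -
    have "real n * wi \<le> (\<Sum>s\<le>n. wi)" using wi by simp
    also have "\<dots> \<le> Q n" unfolding Q_def using wi by (intro sum_mono) auto
    finally show ?thesis .
  qed
  have "real n * (wi * (1 - k * A)) \<le> A * c" for n
  proof -
    have "real n * wi * (1 - k * A) \<le> Q n * (1 - k * A)"
      using kA by (intro mult_right_mono Qge) auto
    also have "\<dots> \<le> A * c" using Qle[of n] by (simp add: algebra_simps)
    finally show ?thesis by (simp add: mult.assoc)
  qed
  moreover have "wi * (1 - k * A) > 0" using wi kA by simp
  ultimately show False
    using reals_Archimedean3[of "wi * (1 - k * A)"] by (meson not_le)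
qed

text \<open>The avoiding mass is the total minus a convolution and so converges to
  \<open>wi * (1 - k * A)\<close>, where \<open>A\<close> sums the masses of first occurrences.
  Being a limit of nonnegative numbers, this is at least 0; since the first occurrence has mass
  \<open>k * A \<ge> 1\<close>, it is at most 0.\<close>

lemma avoids_tendsto_0:
  assumes q: "0 < q" "q < 1" and \<kappa>: "\<kappa> \<in> perms c"
  shows "(\<lambda>N. wsum q (N + c) (avoids c \<kappa> (N + c))) \<longlonglongrightarrow> 0"
proof -
  define a where "a s = wsum q s (before_first c \<kappa> s)" for s
  define k where "k = wt q c \<kappa>"
  define h where "h N = wsum q (N + c) (avoids c \<kappa> (N + c))" for N
  obtain wi where wi: "wi > 0" "\<And>n. wi \<le> wtot q n" "wtot q \<longlonglongrightarrow> wi"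
    using wtot_properties(4)[OF q] by blast
  have a0: "a s \<ge> 0" for s unfolding a_def by (rule wsum_nonneg[OF q])
  have sa: "summable a" unfolding a_def by (rule summable_first_last[OF q \<kappa>])
  have conv: "(\<lambda>N. \<Sum>s\<le>N. a s * wtot q (N - s)) \<longlonglongrightarrow> (\<Sum>s. a s * wi)"
  proof (rule tendsto_convolution[OF sa])
    fix s N :: nat
    have "a s * wtot q (N - s) \<le> a s * 1"
      using a0 wtot_properties(2)[OF q] by (intro mult_left_mono) auto
    thus "\<bar>a s * wtot q (N - s)\<bar> \<le> a s"
      using a0[of s] wtot_properties(1)[OF q, of "N - s"] by (simp add: abs_mult)
    have "filterlim (\<lambda>N. N - s) at_top at_top" by (rule filterlim_minus_const_nat_at_top)
    from filterlim_compose[OF wi(3) this] show "(\<lambda>N. a s * wtot q (N - s)) \<longlonglongrightarrow> a s * wi"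
      by (intro tendsto_mult tendsto_const)
  qed
  have heq: "h = (\<lambda>N. wtot q (N + c) - k * (\<Sum>s\<le>N. a s * wtot q (N - s)))"
    using first_occurrence_total[OF \<kappa>, of q] by (simp add: fun_eq_iff h_def k_def a_def)
  have "h \<longlonglongrightarrow> wi - k * (\<Sum>s. a s * wi)"
    unfolding heq by (intro tendsto_diff tendsto_mult tendsto_const conv LIMSEQ_ignore_initial_segment wi(3))
  moreover have "wi - k * (\<Sum>s. a s * wi) = wi * (1 - k * suminf a)"
    using suminf_mult2[OF sa, of wi] by (simp add: algebra_simps)
  ultimately have lim: "h \<longlonglongrightarrow> wi * (1 - k * suminf a)" by simp
  have "wi * (1 - k * suminf a) \<ge> 0"
    by (rule LIMSEQ_le_const[OF lim]) (auto simp: h_def intro: wsum_nonneg[OF q])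
  moreover have "1 - k * suminf a \<le> 0"
    using first_occurrence_mass[OF q \<kappa>] by (simp add: k_def a_def[abs_def])
  hence "wi * (1 - k * suminf a) \<le> 0"
    using wi(1) by (simp add: mult_nonneg_nonpos)
  ultimately have "wi * (1 - k * suminf a) = 0" by simp
  with lim show ?thesis by (simp add: h_def[abs_def])
qed

lemma avoids_part_tendsto_0:
  assumes q: "0 < q" "q < 1" and \<kappa>: "\<kappa> \<in> perms c"
  shows "(\<lambda>N. wsum q (N + c) (\<lambda>\<pi>. avoids c \<kappa> (N + c) \<pi> \<and> P N \<pi>)) \<longlonglongrightarrow> 0"
proof (rule tendsto_sandwich[OF _ _ tendsto_const avoids_tendsto_0[OF q \<kappa>]])
  show "eventually (\<lambda>N. 0 \<le> wsum q (N + c) (\<lambda>\<pi>. avoids c \<kappa> (N + c) \<pi> \<and> P N \<pi>)) sequentially"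
    using wsum_nonneg[OF q] by simp
  show "eventually (\<lambda>N. wsum q (N + c) (\<lambda>\<pi>. avoids c \<kappa> (N + c) \<pi> \<and> P N \<pi>) \<le>
     wsum q (N + c) (avoids c \<kappa> (N + c))) sequentially"
    by (intro always_eventually allI wsum_mono[OF q]) auto
qed

section \<open>Convergence by splitting at the first and the last occurrence\<close>

lemma convergent_offset:
  fixes f :: "nat \<Rightarrow> real"
  shows "convergent (\<lambda>N. f (N + c)) \<Longrightarrow> convergent f"
  unfolding convergent_def using LIMSEQ_offset[of f c] by blast

text \<open>After fixing the prefix before the first block, the remainder is split at its own last
  occurrence. Absorption erases everything between the two blocks from the truth value, so the
  middle part contributes only its total, which converges. Dominated convergence is used once for
  each end.\<close>

lemma convergent_absorbing:
  assumes q: "0 < q" "q < 1" and \<kappa>: "\<kappa> \<in> perms c"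
    and absorb: "\<And>a b d \<alpha> \<beta> \<gamma>. \<alpha> \<in> perms a \<Longrightarrow> \<beta> \<in> perms b \<Longrightarrow> \<gamma> \<in> perms d \<Longrightarrow>
      P (a + (c + (b + (c + d)))) (dsum a \<alpha> (dsum c \<kappa> (dsum b \<beta> (dsum c \<kappa> \<gamma>)))) \<longleftrightarrow>
      P (a + (c + d)) (dsum a \<alpha> (dsum c \<kappa> \<gamma>))"
  shows "convergent (\<lambda>n. wsum q n (P n))"
proof -
  obtain wi where wi: "wi > 0" "\<And>n. wi \<le> wtot q n" "wtot q \<longlonglongrightarrow> wi"
    using wtot_properties(4)[OF q] by blast
  define k where "k = wt q c \<kappa>"
  have k: "k > 0" unfolding k_def by (rule wt_pos[OF q])
  \<comment> \<open>\<open>z s \<alpha> m\<close> is the mass of the remainders of length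
    \<open>m\<close> that make \<open>P\<close> true once the prefix and the first block are
    fixed.\<close>
  define z where "z s \<alpha> m = wsum q m (\<lambda>\<beta>. P (s + (c + m)) (dsum s \<alpha> (dsum c \<kappa> \<beta>)))" for s \<alpha> m
  have z: "0 \<le> z s \<alpha> m" "z s \<alpha> m \<le> 1" for s \<alpha> m
    unfolding z_def using wsum_nonneg[OF q] order.trans[OF wsum_le_wtot[OF q] wtot_properties(2)[OF q]] by auto
  have z_conv: "convergent (z s \<alpha>)" if \<alpha>: "\<alpha> \<in> perms s" for s \<alpha>
  proof (rule convergent_offset[of _ c])
    define p where "p t \<gamma> = P (s + (c + t)) (dsum s \<alpha> (dsum c \<kappa> \<gamma>))" for t \<gamma>
    define b where "b t = wsum q t (\<lambda>\<gamma>. after_last c \<kappa> t \<gamma> \<and> p t \<gamma>)" for t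
    have b0: "b t \<ge> 0" for t unfolding b_def by (rule wsum_nonneg[OF q])
    have bl: "b t \<le> wsum q t (after_last c \<kappa> t)" for t
      unfolding b_def by (rule wsum_mono[OF q]) auto
    have eq: "z s \<alpha> (N + c) = wsum q (N + c) (\<lambda>\<pi>. avoids c \<kappa> (N + c) \<pi> \<and> P (s + (c + (N + c))) (dsum s \<alpha> (dsum c \<kappa> \<pi>))) +
       (\<Sum>t\<le>N. k * b t * wtot q (N - t))" for N
      unfolding z_def k_def b_def
    proof (rule last_occurrence_decomposition[OF \<kappa>])
      fix t \<delta> \<gamma> assume t: "t \<le> N" "\<delta> \<in> perms (N - t)" "\<gamma> \<in> perms t"
      have "s + (c + (N + c)) = s + (c + ((N - t) + (c + t)))" using t by simp
      thus "P (s + (c + (N + c))) (dsum s \<alpha> (dsum c \<kappa> (dsum (N - t) \<delta> (dsum c \<kappa> \<gamma>)))) \<longleftrightarrow> p t \<gamma>"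
        unfolding p_def using absorb[OF \<alpha> t(2,3)] by simp
    qed
    have conv: "(\<lambda>N. \<Sum>t\<le>N. k * b t * wtot q (N - t)) \<longlonglongrightarrow> (\<Sum>t. k * b t * wi)"
    proof (rule tendsto_convolution)
      show "summable (\<lambda>t. k * wsum q t (after_last c \<kappa> t))"
        by (intro summable_mult summable_first_last[OF q \<kappa>])
      fix t N :: nat
      have "b t * wtot q (N - t) \<le> wsum q t (after_last c \<kappa> t) * 1"
        using b0 bl wtot_properties(1)[OF q, of "N - t"] wtot_properties(2)[OF q, of "N - t"]
        by (intro mult_mono wsum_nonneg[OF q]) auto
      hence "k * (b t * wtot q (N - t)) \<le> k * wsum q t (after_last c \<kappa> t)"
        using k by simp
      moreover have "k * (b t * wtot q (N - t)) \<ge> 0"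
        using k b0[of t] wtot_properties(1)[OF q, of "N - t"] by simp
      ultimately show "\<bar>k * b t * wtot q (N - t)\<bar> \<le> k * wsum q t (after_last c \<kappa> t)"
        by (simp add: mult.assoc)
      have "filterlim (\<lambda>N. N - t) at_top at_top" by (rule filterlim_minus_const_nat_at_top)
      from filterlim_compose[OF wi(3) this] show "(\<lambda>N. k * b t * wtot q (N - t)) \<longlonglongrightarrow> k * b t * wi"
        by (intro tendsto_mult tendsto_const)
    qed
    show "convergent (\<lambda>N. z s \<alpha> (N + c))"
      unfolding convergent_def eq
      by (rule exI) (rule tendsto_add[OF avoids_part_tendsto_0[OF q \<kappa>] conv])
  qed
  define L where "L s = k * (\<Sum>\<alpha> | \<alpha> \<in> perms s \<and> before_first c \<kappa> s \<alpha>. wt q s \<alpha> * lim (z s \<alpha>))" for s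
  have "convergent (\<lambda>N. wsum q (N + c) (P (N + c)))"
  proof -
    have eq: "wsum q (N + c) (P (N + c)) = wsum q (N + c) (\<lambda>\<pi>. avoids c \<kappa> (N + c) \<pi> \<and> P (N + c) \<pi>) +
      (\<Sum>s\<le>N. k * (\<Sum>\<alpha> | \<alpha> \<in> perms s \<and> before_first c \<kappa> s \<alpha>. wt q s \<alpha> * z s \<alpha> (N - s)))" for N
    proof -
      have "(\<Sum>s\<le>N. k * (\<Sum>\<alpha> | \<alpha> \<in> perms s \<and> before_first c \<kappa> s \<alpha>. wt q s \<alpha> * z s \<alpha> (N - s))) =
        (\<Sum>s\<le>N. k * (\<Sum>\<alpha> | \<alpha> \<in> perms s \<and> before_first c \<kappa> s \<alpha>.
           wt q s \<alpha> * wsum q (N - s) (\<lambda>\<beta>. P (N + c) (dsum s \<alpha> (dsum c \<kappa> \<beta>)))))"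
      proof (intro sum.cong refl arg_cong2[where f = "(*)"])
        fix s \<alpha> assume "s \<in> {..N}"
        hence "s + (c + (N - s)) = N + c" by simp
        thus "z s \<alpha> (N - s) = wsum q (N - s) (\<lambda>\<beta>. P (N + c) (dsum s \<alpha> (dsum c \<kappa> \<beta>)))"
          by (simp only: z_def)
      qed
      thus ?thesis
        using first_occurrence_decomposition[OF \<kappa>, of q N "P (N + c)"] by (simp add: k_def)
    qed
    \<comment> \<open>The masses of first occurrences dominate, because \<open>z\<close> never
      exceeds 1; for fixed \<open>s\<close> only finitely many prefixes occur, so limits may be
      taken termwise.\<close>
    have conv: "(\<lambda>N. \<Sum>s\<le>N. k * (\<Sum>\<alpha> | \<alpha> \<in> perms s \<and> before_first c \<kappa> s \<alpha>. wt q s \<alpha> * z s \<alpha> (N - s)))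
        \<longlonglongrightarrow> suminf L"
    proof (rule tendsto_convolution)
      show "summable (\<lambda>s. k * wsum q s (before_first c \<kappa> s))"
        by (intro summable_mult summable_first_last[OF q \<kappa>])
      fix s N :: nat
      have nn: "0 \<le> (\<Sum>\<alpha> | \<alpha> \<in> perms s \<and> before_first c \<kappa> s \<alpha>. wt q s \<alpha> * z s \<alpha> (N - s))"
        by (intro sum_nonneg mult_nonneg_nonneg wt_nonneg[OF q] z)
      have "(\<Sum>\<alpha> | \<alpha> \<in> perms s \<and> before_first c \<kappa> s \<alpha>. wt q s \<alpha> * z s \<alpha> (N - s)) \<le>
            (\<Sum>\<alpha> | \<alpha> \<in> perms s \<and> before_first c \<kappa> s \<alpha>. wt q s \<alpha> * 1)"
        by (intro sum_mono mult_left_mono wt_nonneg[OF q] z)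
      also have "\<dots> = wsum q s (before_first c \<kappa> s)" by (simp add: wsum_def)
      finally show "\<bar>k * (\<Sum>\<alpha> | \<alpha> \<in> perms s \<and> before_first c \<kappa> s \<alpha>. wt q s \<alpha> * z s \<alpha> (N - s))\<bar>
           \<le> k * wsum q s (before_first c \<kappa> s)"
        using k nn by (simp add: abs_mult)
      have "(\<lambda>N. z s \<alpha> (N - s)) \<longlonglongrightarrow> lim (z s \<alpha>)" if "\<alpha> \<in> perms s" for \<alpha>
        using z_conv[OF that] filterlim_minus_const_nat_at_top[of s]
        unfolding convergent_LIMSEQ_iff by (rule filterlim_compose)
      thus "(\<lambda>N. k * (\<Sum>\<alpha> | \<alpha> \<in> perms s \<and> before_first c \<kappa> s \<alpha>. wt q s \<alpha> * z s \<alpha> (N - s))) \<longlonglongrightarrow> L s"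
        unfolding L_def by (intro tendsto_mult tendsto_const tendsto_sum) auto
    qed
    show ?thesis
      unfolding convergent_def eq
      by (rule exI) (rule tendsto_add[OF avoids_part_tendsto_0[OF q \<kappa>] conv])
  qed
  thus ?thesis by (rule convergent_offset)
qed

lemma wsum_mweight: "wsum q n P = (1 - q) ^ n * mweight q n P"
  by (simp add: wsum_def mweight_def wt_def sum_distrib_left)

lemma mallows_prob_wsum:
  assumes "0 < q" "q < 1"
  shows "mallows_prob n q \<phi> = wsum q n (\<lambda>\<pi>. perm_models n \<pi> \<phi>) / wtot q n"
  using assms by (simp add: mallows_prob_eq wsum_mweight flip: wsum_True)

lemma convergence_law_less:
  assumes q: "0 < q" "q < 1" and \<phi>: "sentence \<phi>"
  shows "convergent (\<lambda>n. mallows_prob n q \<phi>)"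
proof -
  obtain c \<kappa> where \<kappa>: "\<kappa> \<in> perms c" and
    absorb: "\<And>a b d \<alpha> \<beta> \<gamma>. \<alpha> \<in> perms a \<Longrightarrow> \<beta> \<in> perms b \<Longrightarrow> \<gamma> \<in> perms d \<Longrightarrow>
      perm_models (a + (c + (b + (c + d)))) (dsum a \<alpha> (dsum c \<kappa> (dsum b \<beta> (dsum c \<kappa> \<gamma>)))) \<phi> \<longleftrightarrow>
      perm_models (a + (c + d)) (dsum a \<alpha> (dsum c \<kappa> \<gamma>)) \<phi>"
    using absorbing_block[OF \<phi>] by blast
  have "convergent (\<lambda>n. wsum q n (\<lambda>\<pi>. perm_models n \<pi> \<phi>))"
    by (rule convergent_absorbing[OF q \<kappa>]) (rule absorb)
  moreover obtain wi where wi: "wi > 0" "wtot q \<longlonglongrightarrow> wi"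
    using wtot_properties(4)[OF q] by blast
  ultimately show ?thesis
    unfolding mallows_prob_wsum[OF q] convergent_def by (auto intro: tendsto_divide)
qed

subsection \<open>The zero-one law fails\<close>

definition fixes_first :: toto where
  "fixes_first = Exists 0 (Conj (Neg (Exists 1 (Less1 1 0))) (Neg (Exists 1 (Less2 1 0))))"

lemma sentence_fixes_first: "sentence fixes_first"
  by (auto simp: sentence_def fixes_first_def)

lemma perm_models_fixes_first:
  assumes "\<pi> \<in> perms (Suc m)"
  shows "perm_models (Suc m) \<pi> fixes_first \<longleftrightarrow> \<pi> 1 = 1"
proof -
  have "perm_models (Suc m) \<pi> fixes_first \<longleftrightarrow>
    (\<exists>a\<in>{1..Suc m}. (\<forall>b\<in>{1..Suc m}. \<not> b < a) \<and> (\<forall>b\<in>{1..Suc m}. \<not> \<pi> b < \<pi> a))"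
    by (subst perm_models_iff[OF sentence_fixes_first]) (simp add: fixes_first_def)
  also have "\<dots> \<longleftrightarrow> (\<forall>b\<in>{1..Suc m}. \<not> \<pi> b < \<pi> 1)"
  proof
    assume "\<exists>a\<in>{1..Suc m}. (\<forall>b\<in>{1..Suc m}. \<not> b < a) \<and> (\<forall>b\<in>{1..Suc m}. \<not> \<pi> b < \<pi> a)"
    then obtain a where a: "a \<in> {1..Suc m}" "\<forall>b\<in>{1..Suc m}. \<not> b < a" "\<forall>b\<in>{1..Suc m}. \<not> \<pi> b < \<pi> a" by blast
    have "a = 1" using a(1) a(2)[rule_format, of 1] by simp
    thus "\<forall>b\<in>{1..Suc m}. \<not> \<pi> b < \<pi> 1" using a(3) by simp
  qed (auto intro!: bexI[of _ 1])
  also have "\<dots> \<longleftrightarrow> \<pi> 1 = 1"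
  proof
    assume *: "\<forall>b\<in>{1..Suc m}. \<not> \<pi> b < \<pi> 1"
    have "1 \<in> \<pi> ` {1..Suc m}"
      using assms unfolding perms_def by (auto simp: permutes_image)
    then obtain b where "b \<in> {1..Suc m}" "\<pi> b = 1" by auto
    hence "\<pi> 1 \<le> 1" using *[rule_format, of b] by simp
    thus "\<pi> 1 = 1" using perms_in[OF assms, of 1] by simp
  next
    assume "\<pi> 1 = 1"
    show "\<forall>b\<in>{1..Suc m}. \<not> \<pi> b < \<pi> 1"
    proof
      fix b assume "b \<in> {1..Suc m}"
      hence "1 \<le> \<pi> b" using perms_in[OF assms, of b] by simp
      thus "\<not> \<pi> b < \<pi> 1" using \<open>\<pi> 1 = 1\<close> by linarith
    qed
  qed
  finally show ?thesis .
qed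

text \<open>\<open>\<pi> 1 = 1\<close> is an occurrence of the one-point block at the very
  beginning, which splits off the factor \<open>1 - q\<close>; the totals of the two lengths have
  the same positive limit.\<close>

lemma mallows_prob_fixes_first:
  assumes q: "0 < q" "q < 1"
  shows "(\<lambda>n. mallows_prob n q fixes_first) \<longlonglongrightarrow> 1 - q"
proof -
  have "mallows_prob (Suc m) q fixes_first = (1 - q) * wtot q m / wtot q (Suc m)" for m
  proof -
    have "wsum q (Suc m) (\<lambda>\<pi>. perm_models (Suc m) \<pi> fixes_first) = wsum q (Suc m) (occurs 1 id 0)"
      by (rule wsum_cong) (simp add: perm_models_fixes_first occurs_def)
    also have "\<dots> = wt q 1 id * wtot q m"
      using wsum_occurs[of id 1 q 0 m] by simp
    also have "inversions 1 id = {}"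
      by (auto simp: inversions_def)
    hence "wt q 1 id = 1 - q" by (simp add: wt_def inv_count_card)
    finally show ?thesis by (simp add: mallows_prob_wsum[OF q])
  qed
  moreover obtain wi where wi: "wi > 0" "wtot q \<longlonglongrightarrow> wi"
    using wtot_properties(4)[OF q] by blast
  have "(\<lambda>m. (1 - q) * wtot q m / wtot q (Suc m)) \<longlonglongrightarrow> (1 - q) * wi / wi"
    using wi by (intro tendsto_divide tendsto_mult tendsto_const LIMSEQ_Suc) auto
  ultimately have "(\<lambda>m. mallows_prob (Suc m) q fixes_first) \<longlonglongrightarrow> 1 - q"
    using wi(1) by simp
  thus ?thesis by (rule LIMSEQ_imp_Suc)
qed

subsection \<open>Reversing the second order\<close>

primrec swap_less2 :: "toto \<Rightarrow> toto" where
  "swap_less2 (Eq x y) = Eq x y"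
| "swap_less2 (Less1 x y) = Less1 x y"
| "swap_less2 (Less2 x y) = Less2 y x"
| "swap_less2 (Neg \<phi>) = Neg (swap_less2 \<phi>)"
| "swap_less2 (Conj \<phi> \<psi>) = Conj (swap_less2 \<phi>) (swap_less2 \<psi>)"
| "swap_less2 (Exists x \<phi>) = Exists x (swap_less2 \<phi>)"

lemma swap_less2_involutive [simp]: "swap_less2 (swap_less2 \<phi>) = \<phi>"
  by (induction \<phi>) auto

lemma free_vars_swap_less2 [simp]: "free_vars (swap_less2 \<phi>) = free_vars \<phi>"
  by (induction \<phi>) auto

lemma sentence_swap_less2 [simp]: "sentence (swap_less2 \<phi>) \<longleftrightarrow> sentence \<phi>"
  by (simp add: sentence_def)

lemma sat_swap_less2:
  assumes "\<And>x y. x \<in> D \<Longrightarrow> y \<in> D \<Longrightarrow> R2 x y \<longleftrightarrow> R2' y x" "\<And>v. v \<in> free_vars \<phi> \<Longrightarrow> e v \<in> D"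
  shows "sat D R1 R2 e \<phi> \<longleftrightarrow> sat D R1 R2' e (swap_less2 \<phi>)"
  using assms(2)
proof (induction \<phi> arbitrary: e)
  case (Exists x \<phi>)
  have "sat D R1 R2 (e(x := a)) \<phi> \<longleftrightarrow> sat D R1 R2' (e(x := a)) (swap_less2 \<phi>)" if "a \<in> D" for a
    using Exists.prems that by (intro Exists.IH) auto
  thus ?case by auto
qed (auto simp: assms(1))

definition reverse :: "nat \<Rightarrow> nat \<Rightarrow> nat" where
  "reverse n v = (if v \<in> {1..n} then Suc n - v else v)"

lemma reverse_perms: "reverse n \<in> perms n"
  by (rule permsI) (auto simp: reverse_def inj_on_def)

lemma reverse_reverse: "reverse n (reverse n v) = v"
  by (auto simp: reverse_def)

lemma reverse_less: "a \<in> {1..n} \<Longrightarrow> b \<in> {1..n} \<Longrightarrow> reverse n a < reverse n b \<longleftrightarrow> b < a"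
  by (auto simp: reverse_def)

lemma bij_reverse: "bij_betw (\<lambda>\<pi>. reverse n \<circ> \<pi>) (perms n) (perms n)"
proof (rule bij_betw_byWitness[where f' = "\<lambda>\<pi>. reverse n \<circ> \<pi>"])
  have "reverse n \<circ> \<pi> \<in> perms n" if "\<pi> \<in> perms n" for \<pi>
    using that reverse_perms[of n] unfolding perms_def by (auto intro: permutes_compose)
  thus "(\<lambda>\<pi>. reverse n \<circ> \<pi>) ` perms n \<subseteq> perms n" "(\<lambda>\<pi>. reverse n \<circ> \<pi>) ` perms n \<subseteq> perms n" by auto
qed (auto simp: fun_eq_iff reverse_reverse)

text \<open>Each pair of positions is inverted in exactly one of the two permutations.\<close>

lemma inv_count_reverse:
  assumes "\<pi> \<in> perms n"
  shows "inv_count n (reverse n \<circ> \<pi>) + inv_count n \<pi> = card {(i, j). i \<in> {1..n} \<and> j \<in> {1..n} \<and> i < j}"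
proof -
  have eq: "inversions n (reverse n \<circ> \<pi>) = {(i, j). i \<in> {1..n} \<and> j \<in> {1..n} \<and> i < j \<and> \<pi> i < \<pi> j}"
  proof -
    have "reverse n (\<pi> j) < reverse n (\<pi> i) \<longleftrightarrow> \<pi> i < \<pi> j" if "i \<in> {1..n}" "j \<in> {1..n}" for i j
      using that perms_in[OF assms, of i] perms_in[OF assms, of j] by (intro reverse_less) auto
    thus ?thesis unfolding inversions_def by auto
  qed
  have "inversions n (reverse n \<circ> \<pi>) \<union> inversions n \<pi> = {(i, j). i \<in> {1..n} \<and> j \<in> {1..n} \<and> i < j}"
  proof -
    have tri: "\<pi> i < \<pi> j \<or> \<pi> j < \<pi> i" if "i < j" for i j
      using perms_inj[OF assms, of i j] that by (metis less_irrefl nat_neq_iff)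
    show ?thesis
    proof (rule set_eqI)
      fix x :: "nat \<times> nat"
      obtain i j where "x = (i, j)" by (cases x)
      thus "x \<in> inversions n (reverse n \<circ> \<pi>) \<union> inversions n \<pi> \<longleftrightarrow>
            x \<in> {(i, j). i \<in> {1..n} \<and> j \<in> {1..n} \<and> i < j}"
        unfolding eq unfolding inversions_def using tri[of i j] by auto
    qed
  qed
  moreover have "card (inversions n (reverse n \<circ> \<pi>) \<union> inversions n \<pi>) =
      card (inversions n (reverse n \<circ> \<pi>)) + card (inversions n \<pi>)"
  proof (rule card_Un_disjoint)
    show "inversions n (reverse n \<circ> \<pi>) \<inter> inversions n \<pi> = {}"
      unfolding eq unfolding inversions_def by auto
  qed simp_all
  ultimately show ?thesis by (simp add: inv_count_card)
qed

text \<open>Reversal turns \<open>q ^ inv\<close> into \<open>q ^ T * (1 / q) ^ inv\<close>, with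
  \<open>T\<close> the number of pairs of positions; the constant \<open>q ^ T\<close> cancels
  against the normaliser. On the logical side it exchanges the arguments of the second
  order.\<close>

lemma mallows_prob_reverse:
  assumes q: "q > 0" and \<phi>: "sentence \<phi>"
  shows "mallows_prob n q \<phi> = mallows_prob n (1 / q) (swap_less2 \<phi>)"
proof -
  define T where "T = card {(i, j). i \<in> {1..n} \<and> j \<in> {1..n} \<and> i < (j :: nat)}"
  have rev: "mweight q n P = q ^ T * mweight (1 / q) n (\<lambda>\<pi>. P (reverse n \<circ> \<pi>))" for P
  proof -
    have "mweight q n P = (\<Sum>\<pi>\<in>perms n. if P (reverse n \<circ> \<pi>) then q ^ inv_count n (reverse n \<circ> \<pi>) else 0)"
      unfolding mweight_alt by (rule sum.reindex_bij_betw[OF bij_reverse, symmetric])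
    also have "\<dots> = (\<Sum>\<pi>\<in>perms n. q ^ T * (if P (reverse n \<circ> \<pi>) then (1 / q) ^ inv_count n \<pi> else 0))"
    proof (rule sum.cong[OF refl])
      fix \<pi> assume "\<pi> \<in> perms n"
      hence "q ^ T = q ^ inv_count n (reverse n \<circ> \<pi>) * q ^ inv_count n \<pi>"
        unfolding T_def by (simp only: inv_count_reverse[symmetric] power_add)
      thus "(if P (reverse n \<circ> \<pi>) then q ^ inv_count n (reverse n \<circ> \<pi>) else 0) =
            q ^ T * (if P (reverse n \<circ> \<pi>) then (1 / q) ^ inv_count n \<pi> else 0)"
        using q by (simp add: power_one_over field_simps)
    qed
    finally show ?thesis by (simp add: mweight_alt sum_distrib_left)
  qed
  have "perm_models n (reverse n \<circ> \<pi>) \<phi> \<longleftrightarrow> perm_models n \<pi> (swap_less2 \<phi>)" if "\<pi> \<in> perms n" for \<pi>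
  proof -
    have "sat {1..n} (\<lambda>i j. i < j) (\<lambda>i j. (reverse n \<circ> \<pi>) i < (reverse n \<circ> \<pi>) j) (\<lambda>_. 0) \<phi> \<longleftrightarrow>
          sat {1..n} (\<lambda>i j. i < j) (\<lambda>i j. \<pi> i < \<pi> j) (\<lambda>_. 0) (swap_less2 \<phi>)"
    proof (rule sat_swap_less2)
      fix x y assume "x \<in> {1..n}" "y \<in> {1..n}"
      thus "(reverse n \<circ> \<pi>) x < (reverse n \<circ> \<pi>) y \<longleftrightarrow> \<pi> y < \<pi> x"
        using perms_in[OF that, of x] perms_in[OF that, of y] by (simp add: reverse_less)
    qed (use \<phi> in \<open>simp add: sentence_def\<close>)
    thus ?thesis
      using \<phi> by (simp add: perm_models_iff[where e = "\<lambda>_. 0"])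
  qed
  hence "mweight (1 / q) n (\<lambda>\<pi>. perm_models n (reverse n \<circ> \<pi>) \<phi>) =
         mweight (1 / q) n (\<lambda>\<pi>. perm_models n \<pi> (swap_less2 \<phi>))"
    by (rule mweight_cong)
  thus ?thesis
    using q by (simp add: mallows_prob_eq rev[of "\<lambda>\<pi>. perm_models n \<pi> \<phi>"] rev[of "\<lambda>_. True"])
qed

theorem convergence_law_fixed_q:
  fixes q :: real
  assumes q: "q > 0" "q \<noteq> 1" and \<phi>: "sentence \<phi>"
  shows "convergent (\<lambda>n. mallows_prob n q \<phi>)"
proof (cases "q < 1")
  case True
  thus ?thesis using q \<phi> by (intro convergence_law_less)
next
  case False
  have "convergent (\<lambda>n. mallows_prob n (1 / q) (swap_less2 \<phi>))"
    using False q \<phi> by (intro convergence_law_less) auto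
  thus ?thesis using q \<phi> by (simp add: mallows_prob_reverse[of q])
qed

theorem zero_one_law_fails_fixed_q:
  fixes q :: real
  assumes q: "q > 0" "q \<noteq> 1"
  shows "\<exists>\<phi> L. sentence \<phi> \<and> (\<lambda>n. mallows_prob n q \<phi>) \<longlonglongrightarrow> L \<and> L \<notin> {0, 1}"
proof (cases "q < 1")
  case True
  thus ?thesis
    using q mallows_prob_fixes_first[of q] sentence_fixes_first
    by (intro exI[of _ fixes_first] exI[of _ "1 - q"]) auto
next
  case False
  have "(\<lambda>n. mallows_prob n (1 / q) fixes_first) \<longlonglongrightarrow> 1 - 1 / q"
    using False q by (intro mallows_prob_fixes_first) auto
  hence "(\<lambda>n. mallows_prob n q (swap_less2 fixes_first)) \<longlonglongrightarrow> 1 - 1 / q"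
    using q sentence_fixes_first by (simp add: mallows_prob_reverse[of q])
  thus ?thesis
    using False q sentence_fixes_first
    by (intro exI[of _ "swap_less2 fixes_first"] exI[of _ "1 - 1 / q"]) auto
qed

theorem theorem1p2:
  shows
    "(\<forall>q::real. q > 0 \<and> q \<noteq> 1 \<longrightarrow>
        (\<forall>\<phi>. sentence \<phi> \<longrightarrow> convergent (\<lambda>n. mallows_prob n q \<phi>)) \<and>
        (\<exists>\<phi> L. sentence \<phi> \<and> (\<lambda>n. mallows_prob n q \<phi>) \<longlonglongrightarrow> L \<and> L \<notin> {0, 1}))
     \<and>
     (\<forall>q::nat \<Rightarrow> real.
        (\<forall>n\<ge>1. q n > 0) \<and>
        (\<forall>n\<ge>2. 1 - 1 / real (log_star n) < q n \<and> q n < 1 + 1 / real (log_star n)) \<longrightarrow>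
        (\<exists>\<phi>. sentence \<phi> \<and> \<not> convergent (\<lambda>n. mallows_prob n (q n) \<phi>)))"
proof (intro conjI allI impI)
  fix q :: real and \<phi>
  assume "q > 0 \<and> q \<noteq> 1" "sentence \<phi>"
  thus "convergent (\<lambda>n. mallows_prob n q \<phi>)"
    using convergence_law_fixed_q by blast
next
  fix q :: real
  assume "q > 0 \<and> q \<noteq> 1"
  thus "\<exists>\<phi> L. sentence \<phi> \<and> (\<lambda>n. mallows_prob n q \<phi>) \<longlonglongrightarrow> L \<and> L \<notin> {0, 1}"
    using zero_one_law_fails_fixed_q by blast
next
  fix q :: "nat \<Rightarrow> real"
  assume "(\<forall>n\<ge>1. q n > 0) \<and>
    (\<forall>n\<ge>2. 1 - 1 / real (log_star n) < q n \<and> q n < 1 + 1 / real (log_star n))"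
  thus "\<exists>\<phi>. sentence \<phi> \<and> \<not> convergent (\<lambda>n. mallows_prob n (q n) \<phi>)"
    by (intro convergence_law_fails_near_uniform) auto
qed

end
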